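(* Assume $d\in\{3,4\}$ and let $\frac{d}{d-2}<q<\infty$. If $s>0$ is sufficiently small, depending on $d$ and $q$, then the inverse of the operator $1+(-\Delta+s)^{-1}V\colon L^{q}_{\rm rad}(\mathbb{R}^{d})\to L^{q}_{\rm rad}(\mathbb{R}^{d})$ exists, and the following estimates hold: (i) If $f\in L^{q}_{\rm rad}(\mathbb{R}^{d})$, then $$\big\|\{1+(-\Delta+s)^{-1}V\}^{-1}f\big\|_{L^{q}}\le C\,\delta(s)\,s^{-1}\,\|f\|_{L^{q}},$$ where the constant $C>0$ depends only on $d$ and $q$. (ii) If $f\in X_{q}$, then $$\big\|\{1+(-\Delta+s)^{-1}V\}^{-1}f\big\|_{L^{q}}\le C\,\|f\|_{L^{q}},$$ where the constant $C>0$ depends only on $d$ and $q$.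
   Context: $L^{q}_{\rm rad}(\mathbb{R}^{d})$ is the set of functions in $L^{q}(\mathbb{R}^{d})$ that are radially symmetric about $0$. Define $$W(x):=\Big(1+\frac{|x|^{2}}{d(d-2)}\Big)^{-\frac{d-2}{2}},\qquad V:=-\frac{d+2}{d-2}W^{\frac{4}{d-2}},\qquad \Lambda W:=\frac{d-2}{2}W+x\cdot\nabla W.$$ Let $\langle f,g\rangle:=\Re\int_{\mathbb{R}^{d}}f(x)\,\overline{g(x)}\,dx$, and $$X_{q}:=\{f\in L^{q}_{\rm rad}(\mathbb{R}^{d})\colon\langle f,V\Lambda W\rangle=0\}.$$ For $s>0$, $(-\Delta+s)^{-1}$ is convolution with the kernel $x\mapsto\int_{0}^{\infty}(4\pi t)^{-\frac d2}e^{-\frac{|x|^{2}}{4t}}e^{-st}\,dt$, and $(-\Delta+s)^{-1}V$ denotes the operator $f\mapsto(-\Delta+s)^{-1}(Vf)$. The function $\delta$ on $(0,\infty)$ is $$\delta(s):=s^{\frac12}\ \text{ if } d=3,\qquad \delta(s):=\frac{1}{\log(1+s^{-1})}\ \text{ if } d=4.$$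
   Formalization: Estimate (ii) is stated for f with both f and if in X_q (automatic for real-valued f in X_q); for complex-valued f with the real-part pairing it fails as written, e.g. for f = {1+(-Δ+s)^{-1}V}(iΛW), which lies in X_q and tends to 0 in L^q while its preimage iΛW is fixed. *)

theory Defs
  imports "HOL-Analysis.Analysis"
begin

text \<open>
  Elements of \<open>L\<^sup>q\<close> are represented by Borel functions; two functions represent the same
  element when they agree almost everywhere, and statements about operators on \<open>L\<^sup>q\<close> are made
  modulo this relation.  Every Lebesgue measurable function has a Borel representative, so no
  class is lost.
\<close>

definition ae_eq :: "(real^'n \<Rightarrow> complex) \<Rightarrow> (real^'n \<Rightarrow> complex) \<Rightarrow> bool" where
  "ae_eq f g \<longleftrightarrow> (AE x in lborel. f x = g x)"

definition Lq :: "real \<Rightarrow> (real^'n \<Rightarrow> complex) set" where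
  "Lq q = {f \<in> borel_measurable lborel. integrable lborel (\<lambda>x. norm (f x) powr q)}"

definition Lq_norm :: "real \<Rightarrow> (real^'n \<Rightarrow> complex) \<Rightarrow> real" where
  "Lq_norm q f = (LINT x|lborel. norm (f x) powr q) powr (1 / q)"

definition radial :: "(real^'n \<Rightarrow> complex) \<Rightarrow> bool" where
  "radial f \<longleftrightarrow> (\<exists>g. ae_eq f (\<lambda>x. g (norm x)))"

definition Lq_rad :: "real \<Rightarrow> (real^'n \<Rightarrow> complex) set" where
  "Lq_rad q = {f \<in> Lq q. radial f}"

definition W :: "real^'n \<Rightarrow> real" where
  "W x = (let d = real CARD('n)
          in (1 + (norm x)\<^sup>2 / (d * (d - 2))) powr (- (d - 2) / 2))"

definition V :: "real^'n \<Rightarrow> real" where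
  "V x = (let d = real CARD('n) in - ((d + 2) / (d - 2)) * W x powr (4 / (d - 2)))"

text \<open>The gradient; meaningful only where the function is differentiable (as \<open>W\<close> is everywhere).\<close>

definition gradient :: "(real^'n \<Rightarrow> real) \<Rightarrow> real^'n \<Rightarrow> real^'n" where
  "gradient f x = (THE D. GDERIV f x :> D)"

definition LambdaW :: "real^'n \<Rightarrow> real" where
  "LambdaW x = (real CARD('n) - 2) / 2 * W x + x \<bullet> gradient W x"

definition pairing :: "(real^'n \<Rightarrow> complex) \<Rightarrow> (real^'n \<Rightarrow> complex) \<Rightarrow> real" where
  "pairing f g = Re (LINT x|lborel. f x * cnj (g x))"

definition X :: "real \<Rightarrow> (real^'n \<Rightarrow> complex) set" where
  "X q = {f \<in> Lq_rad q. pairing f (\<lambda>x. complex_of_real (V x * LambdaW x)) = 0}"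

text \<open>
  For \<open>s > 0\<close> and \<open>d \<ge> 2\<close> the integral diverges exactly at \<open>x = 0\<close>, where the Bochner integral
  returns 0; this affects a null set only.
\<close>

definition resolvent_kernel :: "real \<Rightarrow> real^'n \<Rightarrow> real" where
  "resolvent_kernel s x =
     (LINT t:{0<..}|lborel.
        (4 * pi * t) powr (- (real CARD('n) / 2)) * exp (- ((norm x)\<^sup>2 / (4 * t))) * exp (- (s * t)))"

definition resolvent :: "real \<Rightarrow> (real^'n \<Rightarrow> complex) \<Rightarrow> real^'n \<Rightarrow> complex" where
  "resolvent s f x = (LINT y|lborel. complex_of_real (resolvent_kernel s (x - y)) * f y)"

text \<open>The operator \<open>1 + (-\<Delta> + s)\<^sup>-\<^sup>1 V\<close>.\<close>

definition one_plus_RV :: "real \<Rightarrow> (real^'n \<Rightarrow> complex) \<Rightarrow> real^'n \<Rightarrow> complex" where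
  "one_plus_RV s f x = f x + resolvent s (\<lambda>y. complex_of_real (V y) * f y) x"

text \<open>A map on representatives that induces a map from \<open>L\<^sup>q\<^sub>r\<^sub>a\<^sub>d\<close> to itself.\<close>

definition operator_on_Lq_rad ::
    "real \<Rightarrow> ((real^'n \<Rightarrow> complex) \<Rightarrow> real^'n \<Rightarrow> complex) \<Rightarrow> bool" where
  "operator_on_Lq_rad q T \<longleftrightarrow>
     (\<forall>f \<in> Lq_rad q. T f \<in> Lq_rad q) \<and>
     (\<forall>f \<in> Lq_rad q. \<forall>g \<in> Lq_rad q. ae_eq f g \<longrightarrow> ae_eq (T f) (T g))"

text \<open>\<open>S\<close> is the two-sided inverse of \<open>T\<close> on \<open>L\<^sup>q\<^sub>r\<^sub>a\<^sub>d\<close>; it is unique up to equality a.e.\<close>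

definition inverse_on_Lq_rad ::
    "real \<Rightarrow> ((real^'n \<Rightarrow> complex) \<Rightarrow> real^'n \<Rightarrow> complex)
          \<Rightarrow> ((real^'n \<Rightarrow> complex) \<Rightarrow> real^'n \<Rightarrow> complex) \<Rightarrow> bool" where
  "inverse_on_Lq_rad q T S \<longleftrightarrow>
     operator_on_Lq_rad q T \<and> operator_on_Lq_rad q S \<and>
     (\<forall>f \<in> Lq_rad q. ae_eq (S (T f)) f \<and> ae_eq (T (S f)) f)"

text \<open>Used only for \<open>d = 3\<close> and \<open>d = 4\<close>.\<close>

definition delta :: "nat \<Rightarrow> real \<Rightarrow> real" where
  "delta d s = (if d = 3 then s powr (1 / 2) else 1 / ln (1 + 1 / s))"

text \<open>
  On scalars.  The pairing is the real part of the complex one, so \<open>X q\<close> is a real-linear but not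
  a complex-linear space of complex-valued functions.  An estimate for the inverse that is uniform
  in \<open>s\<close> cannot hold on all of it: \<open>\<i> \<Lambda>W\<close> and its images under \<open>one_plus_RV s\<close> lie in \<open>X q\<close>, since
  \<open>V \<Lambda>W\<close> is real, while these images tend to 0 in \<open>L\<^sup>q\<close> as \<open>s\<close> tends to 0, because
  \<open>\<Lambda>W + (-\<Delta>)\<^sup>-\<^sup>1 (V \<Lambda>W) = 0\<close>.  The uniform estimate concerns real-valued functions, or, over the
  complex scalars, functions \<open>f\<close> with both \<open>f\<close> and \<open>\<i> f\<close> in \<open>X q\<close>.  If \<open>f\<close> is real-valued and
  in \<open>X q\<close>, then \<open>\<i> f\<close> is in \<open>X q\<close> automatically, so the second formulation covers the first.
\<close>

end

theory Submission
  imports Defs "HOL-Probability.Probability" "HOL-Real_Asymp.Real_Asymp"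
begin

text \<open>
  Write \<open>K\<^sub>s\<close> for the operator \<open>f \<mapsto> (-\<Delta> + s)\<^sup>-\<^sup>1(V f)\<close>, with \<open>s = 0\<close> allowed, where the resolvent is the Newton
  potential.  At \<open>s = 0\<close> the operator \<open>1 + K\<^sub>0\<close> annihilates \<open>\<Lambda>W\<close>, because \<open>\<Delta>\<Lambda>W = V \<Lambda>W\<close>, and on radial functions
  it annihilates nothing else.  The inverse for small \<open>s\<close> is therefore large only along \<open>\<Lambda>W\<close>, and its size there
  is dictated by how fast \<open>(1 + K\<^sub>s) \<Lambda>W\<close> vanishes.  The proof makes both points explicit and uses neither compactness
  nor differential equations for general right-hand sides.
  
  The radial structure enters through Newton's theorem: the Newton kernel averaged over the sphere of radius
  \<open>\<rho>\<close> is a multiple of \<open>max |x| \<rho>\<close> to the power \<open>2 - d\<close>.  It is first checked for Gaussian charges and extends to all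
  radial charges since Gaussians determine a measure on the half-line.  Two things follow.  The difference
  \<open>K\<^sub>0 f 0 - K\<^sub>0 f x\<close> only involves the values of \<open>f\<close> inside the ball of radius \<open>|x|\<close>, so it is of Volterra type and
  halves a suitable weighted supremum norm (\<open>newton_difference_contracts\<close>).  Moreover \<open>K\<^sub>s\<close> maps both \<open>L\<^sup>q\<^sub>r\<^sub>a\<^sub>d\<close> and
  the bounded radial functions to bounded functions with a decay that puts them in \<open>L\<^sup>q\<close>
  (\<open>RV_integrable_and_bound\<close>); hence \<open>(1 + K\<^sub>s) u = f\<close> is solved by \<open>u = f - v\<close> with \<open>(1 + K\<^sub>s) v = K\<^sub>s f\<close>, and it suffices to
  work with bounded radial functions.
  
  There, \<open>(1 + K\<^sub>s) v = A v + K\<^sub>s v 0\<close> where \<open>A v = v + K\<^sub>s v - K\<^sub>s v 0\<close> is a perturbation of one minus a contraction.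
  The perturbation is small because the gap \<open>R\<^sub>s\<close> between the Newton kernel and the resolvent kernel is radially
  decreasing, and convolutions of radially decreasing functions are largest at the origin up to a factor 2.
  So \<open>A\<close> is invertible with bounds uniform in \<open>s\<close>, and \<open>1 + K\<^sub>s\<close> is a rank one perturbation of \<open>A\<close>.
  
  The remaining scalar is controlled by duality.  With \<open>L\<^sub>s = (1 + K\<^sub>s) \<Lambda>W\<close>, which is minus the convolution of \<open>R\<^sub>s\<close>
  with \<open>V \<Lambda>W\<close>, Fubini's theorem gives \<open>\<langle>(1 + K\<^sub>s) f, V \<Lambda>W\<rangle> = \<langle>f, V L\<^sub>s\<rangle>\<close>.  To leading order \<open>R\<^sub>s\<close> is the constant \<open>\<kappa> s / \<delta>(s)\<close>,
  so \<open>L\<^sub>s\<close> is of size \<open>s / \<delta>(s)\<close> and \<open>\<langle>\<Lambda>W, V L\<^sub>s\<rangle>\<close> is asymptotically \<open>- \<kappa> (s / \<delta>(s)) (\<integral> V \<Lambda>W)\<^sup>2\<close>, which is not zero since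
  \<open>\<integral> V \<Lambda>W\<close> is the flux of \<open>\<nabla>\<Lambda>W\<close> at infinity (\<open>defect_asymptotics\<close>).  Splitting \<open>v = w - b \<Lambda>W\<close> and pairing the
  equation with \<open>V \<Lambda>W\<close> bounds \<open>b\<close> by \<open>\<delta>(s) / s\<close> times the pairing of the right-hand side plus a term that is uniform
  in \<open>s\<close> (\<open>bounded_a_priori\<close>).  For the right-hand side \<open>K\<^sub>s f\<close> this pairing is \<open>- \<langle>f, V \<Lambda>W\<rangle> + \<langle>f, V L\<^sub>s\<rangle>\<close>: of order one in
  general, and of order \<open>s / \<delta>(s)\<close> if \<open>f\<close> is orthogonal to \<open>V \<Lambda>W\<close>.  These are the two estimates.
\<close>

section \<open>Polar coordinates and the heat kernel\<close>

text \<open>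
  Both measures give the half-line up to \<open>a\<close> the volume of the ball of radius \<open>a\<close>.
\<close>
lemma distr_norm_lborel:
  "distr lborel borel (norm :: 'a::euclidean_space \<Rightarrow> real) =
   density lborel (\<lambda>r. ennreal (real DIM('a) * unit_ball_vol DIM('a) * r ^ (DIM('a) - 1)) * indicator {0..} r)"
  (is "?L = ?R")
proof (rule measure_eqI_generator_eq[where \<Omega> = UNIV and E = "range atMost" and A = "\<lambda>i. {..real i}"])
  have dim: "DIM('a) > 0" by simp
  have L: "emeasure ?L {..a} = ennreal (unit_ball_vol DIM('a) * a ^ DIM('a))" if "a \<ge> 0" for a
  proof -
    have "emeasure ?L {..a} = emeasure lborel (cball (0::'a) a)"
      by (subst emeasure_distr) (auto intro!: arg_cong[where f = "emeasure lborel"])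
    then show ?thesis using that by (simp add: emeasure_cball)
  qed
  have R: "emeasure ?R {..a} = ennreal (unit_ball_vol DIM('a) * a ^ DIM('a))" if "a \<ge> 0" for a
  proof -
    have "emeasure ?R {..a} =
        (\<integral>\<^sup>+r. ennreal (real DIM('a) * unit_ball_vol DIM('a) * r ^ (DIM('a) - 1)) * indicator {0..a} r \<partial>lborel)"
      by (subst emeasure_density) (auto intro!: nn_integral_cong split: split_indicator)
    also have "\<dots> = ennreal (unit_ball_vol DIM('a) * a ^ DIM('a) - unit_ball_vol DIM('a) * 0 ^ DIM('a))"
      by (rule nn_integral_FTC_Icc) (use that in \<open>auto intro!: derivative_eq_intros\<close>)
    finally show ?thesis by (simp add: power_0_left)
  qed
  show "emeasure ?L X = emeasure ?R X" if "X \<in> range atMost" for X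
  proof -
    obtain a where X: "X = {..a}" using \<open>X \<in> range atMost\<close> by auto
    show ?thesis
    proof (cases "a \<ge> 0")
      case True
      then show ?thesis using L R X by simp
    next
      case False
      have "emeasure ?L X = 0"
        using False X
        by (subst emeasure_distr) (auto intro!: arg_cong[where f = "emeasure lborel", of _ "{}", simplified] simp: vimage_def dest: order_trans[OF norm_ge_zero])
      moreover have "emeasure ?R X = 0"
        using False X by (subst emeasure_density) (auto simp: nn_integral_0_iff_AE split: split_indicator)
      ultimately show ?thesis by simp
    qed
  qed
  show "(\<Union>i. {..real i}) = UNIV"
    by (auto intro: real_arch_simple)
  show "emeasure ?L {..real i} \<noteq> \<infinity>" for i by (simp add: L del: emeasure_distr)
  show "sets ?L = sigma_sets UNIV (range atMost)" "sets ?R = sigma_sets UNIV (range atMost)"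
    using arg_cong[OF borel_eq_atMost, where f=sets] by (simp_all)
qed (auto simp: Int_stable_def)

lemma nn_integral_radial:
  fixes g :: "real \<Rightarrow> ennreal"
  assumes [measurable]: "g \<in> borel_measurable borel"
  shows "(\<integral>\<^sup>+x. g (norm (x::'a::euclidean_space)) \<partial>lborel) =
    (\<integral>\<^sup>+r. ennreal (real DIM('a) * unit_ball_vol DIM('a) * r ^ (DIM('a) - 1)) * indicator {0..} r * g r \<partial>lborel)"
proof -
  have "(\<integral>\<^sup>+x. g (norm (x::'a)) \<partial>lborel) = (\<integral>\<^sup>+r. g r \<partial>distr lborel borel (norm :: 'a \<Rightarrow> real))"
    by (subst nn_integral_distr) auto
  also have "\<dots> = (\<integral>\<^sup>+r. ennreal (real DIM('a) * unit_ball_vol DIM('a) * r ^ (DIM('a) - 1)) * indicator {0..} r * g r \<partial>lborel)"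
    by (subst distr_norm_lborel, subst nn_integral_density) auto
  finally show ?thesis .
qed

definition heat :: "real \<Rightarrow> real^'n \<Rightarrow> real" where
  "heat t x = (4 * pi * t) powr (- (real CARD('n) / 2)) * exp (- ((norm x)\<^sup>2 / (4 * t)))"

lemma heat_nonneg [simp]: "0 \<le> heat t x"
  by (simp add: heat_def)

lemma heat_measurable [measurable (raw)]:
  assumes "f \<in> borel_measurable M" "g \<in> borel_measurable M"
  shows "(\<lambda>x. heat (f x) (g x)) \<in> borel_measurable M"
  using assms unfolding heat_def by measurable

text \<open>
  The normal densities have variance \<open>2 t\<close>; the semigroup law thus follows from the convolution of normal densities.
\<close>
lemma heat_eq_prod_normal:
  assumes "t > 0"
  shows "heat t (x :: real^'n) = (\<Prod>b\<in>Basis. normal_density 0 (sqrt (2 * t)) (x \<bullet> b))"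
proof -
  have "(\<Prod>b\<in>(Basis::(real^'n) set). normal_density 0 (sqrt (2 * t)) (x \<bullet> b)) =
     (1 / sqrt (4 * pi * t)) ^ CARD('n) * exp (\<Sum>b\<in>(Basis::(real^'n) set). - (x \<bullet> b)\<^sup>2 / (4 * t))"
    using assms by (simp add: normal_density_def prod.distrib exp_sum power2_eq_square field_simps prod_dividef)
  also have "(\<Sum>b\<in>(Basis::(real^'n) set). - (x \<bullet> b)\<^sup>2 / (4 * t)) = - ((norm x)\<^sup>2 / (4 * t))"
    by (simp add: sum_negf sum_divide_distrib[symmetric] power2_norm_eq_inner)
       (subst euclidean_inner, simp add: power2_eq_square)
  also have "(1 / sqrt (4 * pi * t)) ^ CARD('n) = (4 * pi * t) powr (- (real CARD('n) / 2))"
    using assms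
    by (simp add: powr_half_sqrt[symmetric] powr_minus_divide[symmetric] powr_realpow[symmetric] powr_powr power_one_over[symmetric])
  finally show ?thesis by (simp add: heat_def)
qed

lemma nn_integral_prod_basis:
  fixes f :: "'a::euclidean_space \<Rightarrow> real \<Rightarrow> ennreal"
  assumes [measurable]: "\<And>b. b \<in> Basis \<Longrightarrow> f b \<in> borel_measurable borel"
  shows "(\<integral>\<^sup>+x. (\<Prod>b\<in>Basis. f b (x \<bullet> b)) \<partial>lborel) = (\<Prod>b\<in>Basis. \<integral>\<^sup>+x. f b x \<partial>lborel)"
proof -
  interpret product_sigma_finite "\<lambda>_::'a. lborel :: real measure" by standard
  have "(\<integral>\<^sup>+x. (\<Prod>b\<in>Basis. f b (x \<bullet> b)) \<partial>(lborel::'a measure)) =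
     (\<integral>\<^sup>+x. (\<Prod>b\<in>Basis. f b (x b)) \<partial>Pi\<^sub>M (Basis::'a set) (\<lambda>_. lborel))"
    by (subst lborel_eq, subst nn_integral_distr) (auto intro!: nn_integral_cong prod.cong)
  also have "\<dots> = (\<Prod>b\<in>Basis. \<integral>\<^sup>+x. f b x \<partial>lborel)"
    by (rule product_nn_integral_prod) auto
  finally show ?thesis .
qed

lemma heat_convolution:
  assumes "s > 0" "t > 0"
  shows "(\<integral>\<^sup>+y. ennreal (heat s (x - y) * heat t y) \<partial>lborel) = ennreal (heat (s + t) (x :: real^'n))"
proof -
  have "(\<integral>\<^sup>+y. ennreal (heat s (x - y) * heat t y) \<partial>lborel) =
     (\<integral>\<^sup>+y. (\<Prod>b\<in>Basis. ennreal (normal_density 0 (sqrt (2 * s)) (x \<bullet> b - y \<bullet> b) * normal_density 0 (sqrt (2 * t)) (y \<bullet> b))) \<partial>lborel)"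
    using assms by (simp add: heat_eq_prod_normal prod.distrib[symmetric] prod_ennreal inner_diff_left)
  also have "\<dots> = (\<Prod>b\<in>(Basis::(real^'n) set). \<integral>\<^sup>+y. ennreal (normal_density 0 (sqrt (2 * s)) (x \<bullet> b - y) * normal_density 0 (sqrt (2 * t)) y) \<partial>lborel)"
    by (rule nn_integral_prod_basis) measurable
  also have "\<dots> = (\<Prod>b\<in>(Basis::(real^'n) set). ennreal (normal_density 0 (sqrt (2 * (s + t))) (x \<bullet> b)))"
  proof (rule prod.cong[OF refl])
    fix b :: "real^'n"
    show "(\<integral>\<^sup>+y. ennreal (normal_density 0 (sqrt (2 * s)) (x \<bullet> b - y) * normal_density 0 (sqrt (2 * t)) y) \<partial>lborel)
      = ennreal (normal_density 0 (sqrt (2 * (s + t))) (x \<bullet> b))"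
      using fun_cong[OF conv_normal_density_zero_mean[of "sqrt (2 * s)" "sqrt (2 * t)"], of "x \<bullet> b"] assms
      by (simp add: algebra_simps)
  qed
  also have "\<dots> = ennreal (heat (s + t) x)"
    using assms by (simp add: heat_eq_prod_normal prod_ennreal)
  finally show ?thesis .
qed

section \<open>Newton's shell theorem\<close>

definition heat_profile :: "nat \<Rightarrow> real \<Rightarrow> real \<Rightarrow> real" where
  "heat_profile n t r = (4 * pi * t) powr (- (real n / 2)) * exp (- (r\<^sup>2 / (4 * t)))"

lemma heat_eq_profile: "heat t (x :: real^'n) = heat_profile CARD('n) t (norm x)"
  by (simp add: heat_def heat_profile_def)

lemma heat_profile_nonneg [simp]: "0 \<le> heat_profile n t r"
  by (simp add: heat_profile_def)

lemma heat_profile_measurable [measurable (raw)]: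
  assumes "f \<in> borel_measurable M" "g \<in> borel_measurable M"
  shows "(\<lambda>x. heat_profile n (f x) (g x)) \<in> borel_measurable M"
  using assms unfolding heat_profile_def by measurable

text \<open>
  The factor \<open>r ^ (n - 1)\<close> makes the right-hand side, up to \<open>1 / sqrt t\<close>, a function of \<open>r / sqrt t\<close> alone.
\<close>
lemma heat_profile_scaling:
  assumes "t > 0" "n > 0"
  shows "heat_profile n t r * r ^ (n - 1) = heat_profile n 1 (r / sqrt t) * (r / sqrt t) ^ (n - 1) / sqrt t"
proof -
  have "(4 * pi * t) powr (- (real n / 2)) = (4 * pi) powr (- (real n / 2)) * t powr (- (real n / 2))"
    using assms by (simp add: powr_mult)
  also have "t powr (- (real n / 2)) = 1 / sqrt t ^ n"
    using assms by (simp add: powr_half_sqrt[symmetric] powr_minus_divide powr_realpow[symmetric] powr_powr)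
  also have "sqrt t ^ n = sqrt t ^ (n - 1) * sqrt t"
    using assms by (metis Suc_diff_1 power_Suc2)
  finally show ?thesis
    using assms by (simp add: heat_profile_def power_divide)
qed

lemma heat_profile_antiderivative:
  obtains \<Psi> where "\<And>x. x \<ge> 0 \<Longrightarrow> (\<Psi> has_real_derivative heat_profile n 1 x * x ^ (n - 1)) (at x)" "\<Psi> 0 = 0"
proof -
  define g where "g = (\<lambda>x. heat_profile n 1 x * x ^ (n - 1))"
  have cont: "continuous_on A g" for A
    unfolding g_def heat_profile_def by (intro continuous_intros) auto
  (* The lower end -1 makes 0 an interior point, so that the derivative at 0 is two-sided. *)
  define \<Psi> where "\<Psi> = (\<lambda>x. integral {-1..x} g - integral {-1..0} g)"
  have "(\<Psi> has_real_derivative g x) (at x)" if "x \<ge> 0" for x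
  proof -
    have "((\<lambda>x. integral {-1..x} g) has_real_derivative g x) (at x within {-1..x + 1})"
      using that by (intro integral_has_real_derivative cont) auto
    then have "((\<lambda>x. integral {-1..x} g) has_real_derivative g x) (at x)"
      using that by (subst (asm) at_within_interior) (auto simp: interior_atLeastAtMost_real)
    then show ?thesis unfolding \<Psi>_def by (auto intro!: derivative_eq_intros)
  qed
  then show ?thesis by (intro that[of \<Psi>]) (auto simp: g_def \<Psi>_def)
qed

text \<open>
  The heat inside the ball of radius \<open>\<sigma>\<close> at time \<open>a\<close> eventually leaves through the boundary, so it equals the
  flux integrated over all later times.  By scaling both sides are values of one antiderivative \<open>\<Psi>\<close>.
\<close>
lemma heat_content_eq_flux:
  assumes "a > 0" "\<sigma> > 0" "n > 0"
  shows "ennreal (\<sigma> powr (1 - real n)) * (\<integral>\<^sup>+\<rho>. ennreal (heat_profile n a \<rho> * \<rho> ^ (n - 1)) * indicator {0..\<sigma>} \<rho> \<partial>lborel)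
    = (\<integral>\<^sup>+t. ennreal (\<sigma> / (2 * t) * heat_profile n t \<sigma>) * indicator {a..} t \<partial>lborel)"
proof -
  obtain \<Psi> where \<Psi>: "\<And>x. x \<ge> 0 \<Longrightarrow> (\<Psi> has_real_derivative heat_profile n 1 x * x ^ (n - 1)) (at x)" "\<Psi> 0 = 0"
    using heat_profile_antiderivative by blast
  have 1: "(\<integral>\<^sup>+\<rho>. ennreal (heat_profile n a \<rho> * \<rho> ^ (n - 1)) * indicator {0..\<sigma>} \<rho> \<partial>lborel)
     = ennreal (\<Psi> (\<sigma> / sqrt a) - \<Psi> (0 / sqrt a))"
  proof (rule nn_integral_FTC_Icc)
    show "((\<lambda>x. \<Psi> (x / sqrt a)) has_real_derivative heat_profile n a x * x ^ (n - 1)) (at x)" if "x \<in> {0..\<sigma>}" for x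
      unfolding heat_profile_scaling[OF assms(1,3)]
      by (rule DERIV_cong, rule DERIV_chain2[OF \<Psi>(1)]) (use that assms DERIV_cdivide[OF DERIV_ident, where c = "sqrt a"] in auto)
  qed (use assms in auto)
  have flux: "\<sigma> powr (1 - real n) * (heat_profile n 1 (\<sigma> / sqrt t) * (\<sigma> / sqrt t) ^ (n - 1)) * (\<sigma> / (2 * t * sqrt t))
       = \<sigma> / (2 * t) * heat_profile n t \<sigma>" if "t > 0" for t
  proof -
    have "\<sigma> powr (1 - real n) * \<sigma> ^ (n - 1) = 1"
      using assms by (simp add: powr_realpow[symmetric] powr_add[symmetric])
    then have "\<sigma> / (2 * t) * heat_profile n t \<sigma> = \<sigma> / (2 * t) * \<sigma> powr (1 - real n) * (heat_profile n t \<sigma> * \<sigma> ^ (n - 1))"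
      by simp
    also have "\<dots> = \<sigma> powr (1 - real n) * (heat_profile n 1 (\<sigma> / sqrt t) * (\<sigma> / sqrt t) ^ (n - 1)) * (\<sigma> / (2 * t * sqrt t))"
      unfolding heat_profile_scaling[OF that assms(3)] by simp
    finally show ?thesis by simp
  qed
  have "(\<integral>\<^sup>+t. ennreal (\<sigma> / (2 * t) * heat_profile n t \<sigma>) * indicator {a..} t \<partial>lborel)
     = ennreal (0 - (- (\<sigma> powr (1 - real n) * \<Psi> (\<sigma> / sqrt a))))"
  proof (rule nn_integral_FTC_atLeast)
    show "((\<lambda>t. - (\<sigma> powr (1 - real n) * \<Psi> (\<sigma> / sqrt t))) has_real_derivative \<sigma> / (2 * t) * heat_profile n t \<sigma>) (at t)"
      if "a \<le> t" for t
    proof -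
      have t: "t > 0" using that assms by simp
      have "((\<lambda>t. \<sigma> / sqrt t) has_real_derivative - (\<sigma> / (2 * t * sqrt t))) (at t)"
        using t by (auto intro!: derivative_eq_intros simp: field_simps)
      from DERIV_chain2[OF \<Psi>(1) this]
      have "((\<lambda>t. \<Psi> (\<sigma> / sqrt t)) has_real_derivative
          (heat_profile n 1 (\<sigma> / sqrt t) * (\<sigma> / sqrt t) ^ (n - 1)) * (- (\<sigma> / (2 * t * sqrt t)))) (at t)"
        using t assms by simp
      then have "((\<lambda>t. - (\<sigma> powr (1 - real n) * \<Psi> (\<sigma> / sqrt t))) has_real_derivative
          - (\<sigma> powr (1 - real n) * ((heat_profile n 1 (\<sigma> / sqrt t) * (\<sigma> / sqrt t) ^ (n - 1)) * (- (\<sigma> / (2 * t * sqrt t)))))) (at t)"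
        by (intro DERIV_minus DERIV_cmult)
      then show ?thesis
        by (rule DERIV_cong) (use flux[OF t] in simp)
    qed
    have "((\<lambda>t. \<sigma> / sqrt t) \<longlongrightarrow> 0) at_top"
      by (intro real_tendsto_divide_at_top[OF tendsto_const] sqrt_at_top)
    then have "((\<lambda>t. \<Psi> (\<sigma> / sqrt t)) \<longlongrightarrow> \<Psi> 0) at_top"
      by (rule isCont_tendsto_compose[OF DERIV_isCont[OF \<Psi>(1)[OF order_refl]]])
    then show "((\<lambda>t. - (\<sigma> powr (1 - real n) * \<Psi> (\<sigma> / sqrt t))) \<longlongrightarrow> 0) at_top"
      using \<Psi>(2) by (auto intro!: tendsto_eq_intros)
  qed (use assms in auto)
  then show ?thesis
    unfolding 1 using \<Psi>(2) assms by (simp add: ennreal_mult')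
qed

lemma heat_profile_eq_tail_flux:
  assumes "t > 0" "r \<ge> 0"
  shows "(\<integral>\<^sup>+\<sigma>. ennreal (\<sigma> / (2 * t) * heat_profile n t \<sigma>) * indicator {r..} \<sigma> \<partial>lborel) = ennreal (heat_profile n t r)"
proof -
  have "(\<integral>\<^sup>+\<sigma>. ennreal (\<sigma> / (2 * t) * heat_profile n t \<sigma>) * indicator {r..} \<sigma> \<partial>lborel) = ennreal (0 - (- heat_profile n t r))"
  proof (rule nn_integral_FTC_atLeast)
    show "((\<lambda>\<sigma>. - heat_profile n t \<sigma>) has_real_derivative \<sigma> / (2 * t) * heat_profile n t \<sigma>) (at \<sigma>)" for \<sigma>
      unfolding heat_profile_def using assms by (auto intro!: derivative_eq_intros)
    have "((\<lambda>\<sigma>. exp (- (\<sigma>\<^sup>2 / (4 * t)))) \<longlongrightarrow> 0) at_top"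
      using assms by real_asymp
    then show "((\<lambda>\<sigma>. - heat_profile n t \<sigma>) \<longlongrightarrow> 0) at_top"
      unfolding heat_profile_def
      by (intro tendsto_minus_cancel_left[THEN iffD1]) (simp, rule tendsto_mult_right_zero)
  qed (use assms in auto)
  then show ?thesis by simp
qed

lemma nn_integral_powr_tail:
  assumes "m > 0" "p > 1"
  shows "(\<integral>\<^sup>+\<sigma>. ennreal (\<sigma> powr (- p)) * indicator {m..} \<sigma> \<partial>lborel) = ennreal (m powr (1 - p) / (p - 1))"
proof -
  have "(\<integral>\<^sup>+\<sigma>. ennreal (\<sigma> powr (- p)) * indicator {m..} \<sigma> \<partial>lborel) = ennreal (0 - (- (m powr (1 - p) / (p - 1))))"
  proof (rule nn_integral_FTC_atLeast)
    show "((\<lambda>x. - (x powr (1 - p) / (p - 1))) has_real_derivative x powr (- p)) (at x)" if "m \<le> x" for x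
      using assms that
      by (intro DERIV_cong[OF DERIV_minus[OF DERIV_cdivide[OF DERIV_powr[OF DERIV_ident _ DERIV_const]]]])
        (auto simp: powr_diff powr_minus field_simps)
    show "((\<lambda>x. - (x powr (1 - p) / (p - 1))) \<longlongrightarrow> 0) at_top"
      using assms by real_asymp
  qed auto
  then show ?thesis by simp
qed

text \<open>
  Newton's theorem for a Gaussian charge: the kernel \<open>max r \<rho> powr (2 - n) / (n - 2)\<close> is the integral of
  \<open>\<sigma> powr (1 - n)\<close> over \<open>\<sigma> > max r \<rho>\<close>, so after exchanging the integrals the inner one is the heat content of the ball
  of radius \<open>\<sigma>\<close>.  Expressing it by the flux and integrating over \<open>\<sigma>\<close> leaves the time integral of the heat kernel.
\<close>
lemma newton_heat_profile:
  assumes "a > 0" "n \<ge> 3" "r \<ge> 0"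
  shows "(\<integral>\<^sup>+\<rho>. ennreal (\<rho> ^ (n - 1) * (max r \<rho> powr (2 - real n) / (real n - 2)) * heat_profile n a \<rho>) * indicator {0..} \<rho> \<partial>lborel)
    = (\<integral>\<^sup>+t. ennreal (heat_profile n t r) * indicator {a..} t \<partial>lborel)"
proof -
  have "(\<integral>\<^sup>+\<rho>. ennreal (\<rho> ^ (n - 1) * (max r \<rho> powr (2 - real n) / (real n - 2)) * heat_profile n a \<rho>) * indicator {0..} \<rho> \<partial>lborel)
    = (\<integral>\<^sup>+\<rho>. \<integral>\<^sup>+\<sigma>. ennreal (\<sigma> powr (1 - real n)) * indicator {max r 0<..} \<sigma> * (ennreal (heat_profile n a \<rho> * \<rho> ^ (n - 1)) * indicator {0..\<sigma>} \<rho>) \<partial>lborel \<partial>lborel)"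
  proof (rule nn_integral_cong_AE)
    have "AE \<rho> in lborel. \<rho> \<noteq> (0::real)" by (rule AE_lborel_singleton)
    then show "AE \<rho> in lborel. ennreal (\<rho> ^ (n - 1) * (max r \<rho> powr (2 - real n) / (real n - 2)) * heat_profile n a \<rho>) * indicator {0..} \<rho>
      = (\<integral>\<^sup>+\<sigma>. ennreal (\<sigma> powr (1 - real n)) * indicator {max r 0<..} \<sigma> * (ennreal (heat_profile n a \<rho> * \<rho> ^ (n - 1)) * indicator {0..\<sigma>} \<rho>) \<partial>lborel)"
    proof eventually_elim
      case (elim \<rho>)
      show ?case
      proof (cases "\<rho> > 0")
        case True
        have "(\<integral>\<^sup>+\<sigma>. ennreal (\<sigma> powr (1 - real n)) * indicator {max r 0<..} \<sigma> * (ennreal (heat_profile n a \<rho> * \<rho> ^ (n - 1)) * indicator {0..\<sigma>} \<rho>) \<partial>lborel)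
          = (\<integral>\<^sup>+\<sigma>. ennreal (heat_profile n a \<rho> * \<rho> ^ (n - 1)) * (ennreal (\<sigma> powr (- (real n - 1))) * indicator {max r \<rho>..} \<sigma>) \<partial>lborel)"
        proof (rule nn_integral_cong_AE)
          have "AE \<sigma> in lborel. \<sigma> \<noteq> r" by (rule AE_lborel_singleton)
          then show "AE \<sigma> in lborel. ennreal (\<sigma> powr (1 - real n)) * indicator {max r 0<..} \<sigma> * (ennreal (heat_profile n a \<rho> * \<rho> ^ (n - 1)) * indicator {0..\<sigma>} \<rho>)
             = ennreal (heat_profile n a \<rho> * \<rho> ^ (n - 1)) * (ennreal (\<sigma> powr (- (real n - 1))) * indicator {max r \<rho>..} \<sigma>)"
            by eventually_elim (use True assms in \<open>auto simp: mult_ac split: split_indicator\<close>)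
        qed
        also have "\<dots> = ennreal (heat_profile n a \<rho> * \<rho> ^ (n - 1)) * ennreal (max r \<rho> powr (1 - (real n - 1)) / ((real n - 1) - 1))"
          using True assms by (subst nn_integral_cmult, simp) (subst nn_integral_powr_tail, auto)
        finally show ?thesis
          using True assms by (simp add: ennreal_mult'[symmetric] mult_ac)
      qed (use elim in auto)
    qed
  qed
  also have "\<dots> = (\<integral>\<^sup>+\<sigma>. \<integral>\<^sup>+\<rho>. ennreal (\<sigma> powr (1 - real n)) * indicator {max r 0<..} \<sigma> * (ennreal (heat_profile n a \<rho> * \<rho> ^ (n - 1)) * indicator {0..\<sigma>} \<rho>) \<partial>lborel \<partial>lborel)"
  proof (rule lborel_pair.Fubini')
    have S: "{p. 0 \<le> snd p \<and> snd p \<le> fst p} \<in> sets (borel \<Otimes>\<^sub>M (borel :: real measure))"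
      "{p. 0 \<le> fst p \<and> fst p \<le> snd p} \<in> sets (borel \<Otimes>\<^sub>M (borel :: real measure))"
      unfolding borel_prod by (intro borel_closed closed_Collect_conj closed_Collect_le continuous_intros)+
    have "(\<lambda>p. indicator {0..fst p} (snd p)) = (indicator {p. 0 \<le> snd p \<and> snd p \<le> fst p} :: real \<times> real \<Rightarrow> ennreal)"
      "(\<lambda>p. indicator {0..snd p} (fst p)) = (indicator {p. 0 \<le> fst p \<and> fst p \<le> snd p} :: real \<times> real \<Rightarrow> ennreal)"
      by (auto simp: fun_eq_iff split: split_indicator)
    then have [measurable]: "(\<lambda>p. indicator {0..fst p} (snd p) :: ennreal) \<in> borel_measurable (borel \<Otimes>\<^sub>M (borel :: real measure))"
      "(\<lambda>p. indicator {0..snd p} (fst p) :: ennreal) \<in> borel_measurable (borel \<Otimes>\<^sub>M (borel :: real measure))"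
      using S by simp_all
    show "(\<lambda>(x, y). ennreal (x powr (1 - real n)) * indicator {max r 0<..} x * (ennreal (heat_profile n a y * y ^ (n - 1)) * indicator {0..x} y)) \<in> borel_measurable (lborel \<Otimes>\<^sub>M lborel)"
      unfolding case_prod_beta by measurable
  qed
  also have "\<dots> = (\<integral>\<^sup>+\<sigma>. \<integral>\<^sup>+t. ennreal (\<sigma> / (2 * t) * heat_profile n t \<sigma>) * indicator {r<..} \<sigma> * indicator {a..} t \<partial>lborel \<partial>lborel)"
  proof (rule nn_integral_cong)
    fix \<sigma> :: real
    show "(\<integral>\<^sup>+\<rho>. ennreal (\<sigma> powr (1 - real n)) * indicator {max r 0<..} \<sigma> * (ennreal (heat_profile n a \<rho> * \<rho> ^ (n - 1)) * indicator {0..\<sigma>} \<rho>) \<partial>lborel)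
       = (\<integral>\<^sup>+t. ennreal (\<sigma> / (2 * t) * heat_profile n t \<sigma>) * indicator {r<..} \<sigma> * indicator {a..} t \<partial>lborel)"
    proof (cases "\<sigma> > r")
      case True
      then have "\<sigma> > 0" using assms by simp
      then show ?thesis using True assms heat_content_eq_flux[of a \<sigma> n]
        by (subst nn_integral_cmult) auto
    qed (use assms in auto)
  qed
  also have "\<dots> = (\<integral>\<^sup>+t. \<integral>\<^sup>+\<sigma>. ennreal (\<sigma> / (2 * t) * heat_profile n t \<sigma>) * indicator {r<..} \<sigma> * indicator {a..} t \<partial>lborel \<partial>lborel)"
    by (rule lborel_pair.Fubini') auto
  also have "\<dots> = (\<integral>\<^sup>+t. ennreal (heat_profile n t r) * indicator {a..} t \<partial>lborel)"
  proof (rule nn_integral_cong)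
    fix t :: real
    have "(\<integral>\<^sup>+\<sigma>. ennreal (\<sigma> / (2 * t) * heat_profile n t \<sigma>) * indicator {r<..} \<sigma> * indicator {a..} t \<partial>lborel)
      = (\<integral>\<^sup>+\<sigma>. ennreal (\<sigma> / (2 * t) * heat_profile n t \<sigma>) * indicator {r..} \<sigma> * indicator {a..} t \<partial>lborel)"
    proof (rule nn_integral_cong_AE)
      have "AE \<sigma> in lborel. \<sigma> \<noteq> r" by (rule AE_lborel_singleton)
      then show "AE \<sigma> in lborel. ennreal (\<sigma> / (2 * t) * heat_profile n t \<sigma>) * indicator {r<..} \<sigma> * indicator {a..} t =
        ennreal (\<sigma> / (2 * t) * heat_profile n t \<sigma>) * indicator {r..} \<sigma> * indicator {a..} t"
        by eventually_elim (auto split: split_indicator)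
    qed
    also have "\<dots> = ennreal (heat_profile n t r) * indicator {a..} t"
      by (subst nn_integral_multc) (use assms heat_profile_eq_tail_flux[of t r n] in \<open>auto split: split_indicator\<close>)
    finally show "(\<integral>\<^sup>+\<sigma>. ennreal (\<sigma> / (2 * t) * heat_profile n t \<sigma>) * indicator {r<..} \<sigma> * indicator {a..} t \<partial>lborel)
       = ennreal (heat_profile n t r) * indicator {a..} t" .
  qed
  finally show ?thesis .
qed

text \<open>
  By Weierstrass' theorem the moments determine the integrals of continuous functions, and the indicator of
  a half-line is a bounded pointwise limit of such functions.
\<close>
lemma finite_measure_eqI_moments:
  fixes M N :: "real measure"
  assumes "finite_measure M" "finite_measure N"
    and [measurable_cong]: "sets M = sets borel" "sets N = sets borel"
    and M01: "AE u in M. u \<in> {0..1}" and N01: "AE u in N. u \<in> {0..1}"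
    and moments: "\<And>k. (LINT u|M. u ^ k) = (LINT u|N. u ^ k)"
  shows "M = N"
proof -
  interpret M: finite_measure M by fact
  interpret N: finite_measure N by fact
  have integrable: "integrable K f" if "finite_measure K" "sets K = sets borel" "AE u in K. u \<in> {0..1}" "continuous_on UNIV f"
    for K and f :: "real \<Rightarrow> real"
  proof -
    interpret K: finite_measure K by fact
    have "compact (f ` {0..1})"
      by (intro compact_continuous_image continuous_on_subset[OF that(4)]) auto
    then obtain B where B: "\<And>u. u \<in> {0..1} \<Longrightarrow> \<bar>f u\<bar> \<le> B"
      using compact_imp_bounded[of "f ` {0..1}"] unfolding bounded_iff by fastforce
    have "f \<in> borel_measurable K"
      using borel_measurable_continuous_onI[OF that(4)] measurable_cong_sets[OF that(2) refl] by blast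
    then show ?thesis
      
    proof (intro K.integrable_const_bound)
      show "AE u in K. norm (f u) \<le> B" by (rule eventually_mono[OF that(3)]) (use B in auto)
    qed
  qed
  have poly: "(LINT u|M. (\<Sum>i\<le>n. a i * u ^ i)) = (LINT u|N. (\<Sum>i\<le>n. a i * u ^ i))" for n and a :: "nat \<Rightarrow> real"
  proof -
    have c: "continuous_on UNIV (\<lambda>u. a i * u ^ i)" for i by (intro continuous_intros)
    have int: "integrable M (\<lambda>u. a i * u ^ i)" "integrable N (\<lambda>u. a i * u ^ i)" for i
      by (rule integrable[OF assms(1,3) M01 c], rule integrable[OF assms(2,4) N01 c])
    show ?thesis
      using int moments by (simp add: Bochner_Integration.integral_sum)
  qed
  have cont: "(LINT u|M. f u) = (LINT u|N. f u)" if f: "continuous_on UNIV f" for f :: "real \<Rightarrow> real"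
  proof (rule ccontr)
    let ?D = "\<bar>(LINT u|M. f u) - (LINT u|N. f u)\<bar>"
    define e where "e = ?D / (measure M (space M) + measure N (space N) + 1)"
    assume "(LINT u|M. f u) \<noteq> (LINT u|N. f u)"
    then have e: "e > 0"
      unfolding e_def by (intro divide_pos_pos add_nonneg_pos) auto
    obtain g where g: "real_polynomial_function g" "\<And>x. x \<in> {0..1} \<Longrightarrow> \<bar>f x - g x\<bar> < e"
      using Stone_Weierstrass_real_polynomial_function[of "{0..1}" f e] e continuous_on_subset[OF f] by auto
    obtain a n where gs: "g = (\<lambda>x. \<Sum>i\<le>n. a i * x ^ i)"
      using g(1) unfolding real_polynomial_function_iff_sum by auto
    have cg: "continuous_on UNIV g" unfolding gs by (intro continuous_intros)
    have bound: "\<bar>(LINT u|K. f u) - (LINT u|K. g u)\<bar> \<le> e * measure K (space K)"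
      if "finite_measure K" "sets K = sets borel" "AE u in K. u \<in> {0..1}" for K
    proof -
      interpret K: finite_measure K by fact
      have "\<bar>(LINT u|K. f u) - (LINT u|K. g u)\<bar> = \<bar>LINT u|K. f u - g u\<bar>"
        by (rule arg_cong[where f = abs], rule Bochner_Integration.integral_diff[symmetric]) (rule integrable[OF that f], rule integrable[OF that cg])
      also have "\<dots> \<le> (LINT u|K. \<bar>f u - g u\<bar>)" by (rule integral_abs_bound)
      also have "\<dots> \<le> (LINT u|K. e)"
      proof (rule integral_mono_AE)
        have "continuous_on UNIV (\<lambda>u. \<bar>f u - g u\<bar>)" by (intro continuous_intros f cg)
        then show "integrable K (\<lambda>u. \<bar>f u - g u\<bar>)" by (rule integrable[OF that])
        show "AE u in K. \<bar>f u - g u\<bar> \<le> e"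
          by (rule eventually_mono[OF that(3)]) (use g(2) in \<open>auto intro: less_imp_le\<close>)
      qed simp
      also have "\<dots> = e * measure K (space K)" by simp
      finally show ?thesis .
    qed
    have "?D \<le> e * measure M (space M) + e * measure N (space N)"
    proof -
      have "(LINT u|M. g u) = (LINT u|N. g u)" unfolding gs by (rule poly)
      then show ?thesis using bound[OF assms(1,3) M01] bound[OF assms(2,4) N01] by linarith
    qed
    also have "\<dots> < e * (measure M (space M) + measure N (space N) + 1)"
      using e by (simp add: algebra_simps)
    also have "\<dots> = ?D" unfolding e_def by (simp add: add_nonneg_eq_0_iff)
    finally show False by simp
  qed
  have Iic: "measure M {..b} = measure N {..b}" for b
  proof -
    define f where "f k u = max 0 (min 1 (1 - real k * (u - b)))" for k u
    have lim: "(\<lambda>k. f k u) \<longlonglongrightarrow> indicator {..b} u" for u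
    proof (cases "u \<le> b")
      case True
      then have "f k u = 1" for k by (auto simp: f_def mult_nonneg_nonpos)
      then show ?thesis using True by simp
    next
      case False
      then obtain k0 where k0: "1 < real k0 * (u - b)"
        using reals_Archimedean3[of "u - b"] by auto
      have "f k u = 0" if "k \<ge> k0" for k
      proof -
        have "real k0 * (u - b) \<le> real k * (u - b)" using that False by (intro mult_right_mono) auto
        then show ?thesis using k0 by (auto simp: f_def)
      qed
      then show ?thesis using False by (auto intro!: tendsto_eventually eventually_sequentiallyI[of k0])
    qed
    have meas: "f k \<in> borel_measurable borel" for k unfolding f_def by measurable
    have lim_int: "(\<lambda>k. LINT u|K. f k u) \<longlonglongrightarrow> (LINT u|K. indicator {..b} u)"
      if "finite_measure K" and [measurable_cong]: "sets K = sets borel" for K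
    proof (rule integral_dominated_convergence[where w = "\<lambda>_. 1"])
      interpret K: finite_measure K by fact
      show "integrable K (\<lambda>_. 1 :: real)" by simp
      show "AE u in K. norm (f k u) \<le> 1" for k by (auto simp: f_def)
      show "AE u in K. (\<lambda>k. f k u) \<longlonglongrightarrow> indicator {..b} u" using lim by simp
    qed (use meas in simp_all)
    have "(LINT u|M. f k u) = (LINT u|N. f k u)" for k
      by (rule cont) (auto simp: f_def intro!: continuous_intros)
    then have "(\<lambda>k. LINT u|N. f k u) \<longlonglongrightarrow> (LINT u|M. indicator {..b} u)"
      using lim_int[OF assms(1,3)] by simp
    then have "(LINT u|M. indicator {..b} u :: real) = (LINT u|N. indicator {..b} u)"
      using lim_int[OF assms(2,4)] by (rule LIMSEQ_unique)
    then show ?thesis using sets_eq_imp_space_eq[OF assms(3)] sets_eq_imp_space_eq[OF assms(4)] by simp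
  qed
  show ?thesis
  proof (rule measure_eqI_generator_eq[where \<Omega> = UNIV and E = "range atMost" and A = "\<lambda>i. {..real i}"])
    show "emeasure M X = emeasure N X" if "X \<in> range atMost" for X
      using that Iic by (auto simp: M.emeasure_eq_measure N.emeasure_eq_measure)
    show "(\<Union>i. {..real i}) = UNIV" by (auto intro: real_arch_simple)
    show "sets M = sigma_sets UNIV (range atMost)" "sets N = sigma_sets UNIV (range atMost)"
      using arg_cong[OF borel_eq_atMost, where f=sets] assms(3,4) by (simp_all)
  qed (auto simp: Int_stable_def)
qed

text \<open>
  The map \<open>r \<mapsto> exp (- r\<^sup>2)\<close> turns \<open>exp (- r\<^sup>2) M\<close> into a finite measure on the unit interval whose \<open>k\<close>-th moment is
  the integral of \<open>exp (- (k + 1) r\<^sup>2)\<close>.  On the half-line the map is injective and the density can be divided out.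
\<close>
lemma measure_eqI_gaussian_moments:
  fixes M N :: "real measure"
  assumes [measurable_cong]: "sets M = sets borel" "sets N = sets borel"
    and M0: "AE r in M. 0 \<le> r" and N0: "AE r in N. 0 \<le> r"
    and finite: "\<And>l. l > 0 \<Longrightarrow> (\<integral>\<^sup>+r. ennreal (exp (- (l * r\<^sup>2))) \<partial>M) < \<infinity>"
    and eq: "\<And>l. l > 0 \<Longrightarrow> (\<integral>\<^sup>+r. ennreal (exp (- (l * r\<^sup>2))) \<partial>M) = (\<integral>\<^sup>+r. ennreal (exp (- (l * r\<^sup>2))) \<partial>N)"
  shows "M = N"
proof -
  define T where "T K = distr (density K (\<lambda>r. ennreal (exp (- r\<^sup>2)))) borel (\<lambda>r. exp (- r\<^sup>2))" for K :: "real measure"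
  have sets_T: "sets (T K) = sets borel" for K by (simp add: T_def)
  have T_nn: "(\<integral>\<^sup>+u. f u \<partial>T K) = (\<integral>\<^sup>+r. ennreal (exp (- r\<^sup>2)) * f (exp (- r\<^sup>2)) \<partial>K)"
    if [measurable_cong]: "sets K = sets borel" and [measurable]: "f \<in> borel_measurable borel" for K and f :: "real \<Rightarrow> ennreal"
    unfolding T_def by (subst nn_integral_distr, simp, simp, subst nn_integral_density) auto
  have T01: "AE u in T K. u \<in> {0..1}" if [measurable_cong]: "sets K = sets borel" for K
    unfolding T_def by (subst AE_distr_iff) auto
  have T_pow: "(\<integral>\<^sup>+u. ennreal (u ^ k) \<partial>T K) = (\<integral>\<^sup>+r. ennreal (exp (- (real (Suc k) * r\<^sup>2))) \<partial>K)"
    if "sets K = sets borel" for K k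
    by (subst T_nn[OF that]) (auto intro!: nn_integral_cong simp: ennreal_mult'[symmetric] exp_of_nat_mult[symmetric] exp_add[symmetric] algebra_simps)
  have T_eq: "T M = T N"
  proof (rule finite_measure_eqI_moments)
    have "emeasure (T K) (space (T K)) = (\<integral>\<^sup>+r. ennreal (exp (- (1 * r\<^sup>2))) \<partial>K)" if "sets K = sets borel" for K
      using T_pow[OF that, of 0] by simp
    then show "finite_measure (T M)" "finite_measure (T N)"
      using assms(1,2) finite[of 1] eq[of 1] by (auto intro!: finite_measureI simp: less_top)
    show "(LINT u|T M. u ^ k) = (LINT u|T N. u ^ k)" for k
    proof -
      have "(LINT u|T K. u ^ k) = enn2real (\<integral>\<^sup>+u. ennreal (u ^ k) \<partial>T K)" if "sets K = sets borel" for K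
        
      proof (rule integral_eq_nn_integral)
        show "AE u in T K. 0 \<le> u ^ k" by (rule eventually_mono[OF T01[OF that]]) auto
      qed (simp add: measurable_cong_sets[OF sets_T refl])
      then show ?thesis using assms(1,2) T_pow eq[of "real (Suc k)"] by simp
    qed
  qed (use sets_T T01 assms(1,2) in auto)
  have recover: "emeasure K A = (\<integral>\<^sup>+u. ennreal (inverse u) * indicator A (sqrt (- ln u)) \<partial>T K)"
    if [measurable_cong]: "sets K = sets borel" and "AE r in K. 0 \<le> r" and [measurable]: "A \<in> sets borel" for K A
  proof -
    have "(\<integral>\<^sup>+u. ennreal (inverse u) * indicator A (sqrt (- ln u)) \<partial>T K) =
      (\<integral>\<^sup>+r. ennreal (exp (- r\<^sup>2)) * (ennreal (inverse (exp (- r\<^sup>2))) * indicator A (sqrt (- ln (exp (- r\<^sup>2))))) \<partial>K)"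
      by (rule T_nn[OF that(1)]) simp
    also have "\<dots> = (\<integral>\<^sup>+r. indicator A r \<partial>K)"
      by (rule nn_integral_cong_AE, rule eventually_mono[OF that(2)])
         (simp add: ennreal_mult'[symmetric] mult.assoc[symmetric])
    finally show ?thesis using that by simp
  qed
  show ?thesis
    by (rule measure_eqI) (use assms recover T_eq in auto)
qed

text \<open>
  The resolvent kernel with values in the extended half-line, infinite at the origin; with it Tonelli's theorem
  applies without integrability conditions.
\<close>
definition resolvent_nn :: "real \<Rightarrow> real^'n \<Rightarrow> ennreal" where
  "resolvent_nn s z = (\<integral>\<^sup>+t. ennreal (heat t z * exp (- (s * t))) * indicator {0<..} t \<partial>lborel)"

lemma resolvent_nn_measurable [measurable]: "resolvent_nn s \<in> borel_measurable borel"
  unfolding resolvent_nn_def by measurable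

text \<open>
  The Newton kernel averaged over the sphere of radius \<open>norm y\<close> about the origin.  The denominator is \<open>d - 2\<close>
  times the area of the unit sphere.
\<close>
definition shell_kernel :: "real^'n \<Rightarrow> real^'n \<Rightarrow> real" where
  "shell_kernel x y = max (norm x) (norm y) powr (2 - real CARD('n)) /
     ((real CARD('n) - 2) * (real CARD('n) * unit_ball_vol CARD('n)))"

lemma shell_kernel_measurable [measurable (raw)]:
  assumes "f \<in> borel_measurable M" "g \<in> borel_measurable M"
  shows "(\<lambda>x. shell_kernel (f x) (g x)) \<in> borel_measurable M"
  using assms unfolding shell_kernel_def by measurable

lemma resolvent_convolve_heat:
  fixes x :: "real^'n"
  assumes "a > 0"
  shows "(\<integral>\<^sup>+y. resolvent_nn s (x - y) * ennreal (heat a y) \<partial>lborel)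
    = (\<integral>\<^sup>+t. ennreal (heat t x * exp (- (s * (t - a)))) * indicator {a..} t \<partial>lborel)"
proof -
  have "(\<integral>\<^sup>+y. resolvent_nn s (x - y) * ennreal (heat a y) \<partial>lborel)
    = (\<integral>\<^sup>+y. \<integral>\<^sup>+t. ennreal (heat t (x - y) * exp (- (s * t))) * indicator {0<..} t * ennreal (heat a y) \<partial>lborel \<partial>lborel)"
    unfolding resolvent_nn_def by (intro nn_integral_cong nn_integral_multc[symmetric]) simp
  also have "\<dots> = (\<integral>\<^sup>+t. \<integral>\<^sup>+y. ennreal (heat t (x - y) * exp (- (s * t))) * indicator {0<..} t * ennreal (heat a y) \<partial>lborel \<partial>lborel)"
    by (rule lborel_pair.Fubini'[symmetric]) measurable
  also have "\<dots> = (\<integral>\<^sup>+t. ennreal (heat (t + a) x * exp (- (s * t))) * indicator {0<..} t \<partial>lborel)"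
  proof (rule nn_integral_cong)
    fix t :: real
    have "(\<integral>\<^sup>+y. ennreal (heat t (x - y) * exp (- (s * t))) * indicator {0<..} t * ennreal (heat a y) \<partial>lborel)
      = (\<integral>\<^sup>+y. ennreal (exp (- (s * t))) * indicator {0<..} t * ennreal (heat t (x - y) * heat a y) \<partial>lborel)"
      by (simp add: ennreal_mult' mult_ac)
    also have "\<dots> = ennreal (exp (- (s * t))) * indicator {0<..} t * (\<integral>\<^sup>+y. ennreal (heat t (x - y) * heat a y) \<partial>lborel)"
      by (rule nn_integral_cmult) simp
    also have "\<dots> = ennreal (heat (t + a) x * exp (- (s * t))) * indicator {0<..} t"
      using heat_convolution[of t a x] assms by (auto simp: ennreal_mult' mult_ac split: split_indicator)
    finally show "(\<integral>\<^sup>+y. ennreal (heat t (x - y) * exp (- (s * t))) * indicator {0<..} t * ennreal (heat a y) \<partial>lborel)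
      = ennreal (heat (t + a) x * exp (- (s * t))) * indicator {0<..} t" .
  qed
  also have "\<dots> = (\<integral>\<^sup>+t. ennreal (heat t x * exp (- (s * (t - a)))) * indicator {a<..} t \<partial>lborel)"
    by (subst nn_integral_real_affine[where c = 1 and t = "- a" and f = "\<lambda>t. ennreal (heat (t + a) x * exp (- (s * t))) * indicator {0<..} t"])
       (auto intro!: nn_integral_cong split: split_indicator)
  also have "\<dots> = (\<integral>\<^sup>+t. ennreal (heat t x * exp (- (s * (t - a)))) * indicator {a..} t \<partial>lborel)"
    by (rule nn_integral_cong_AE, rule eventually_mono[OF AE_lborel_singleton[of a]]) (auto split: split_indicator)
  finally show ?thesis .
qed

lemma shell_convolve_heat:
  fixes x :: "real^'n"
  assumes "a > 0" "CARD('n) \<ge> 3"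
  shows "(\<integral>\<^sup>+y. ennreal (shell_kernel x y) * ennreal (heat a y) \<partial>lborel) = (\<integral>\<^sup>+t. ennreal (heat t x) * indicator {a..} t \<partial>lborel)"
proof -
  let ?n = "CARD('n)" and ?c = "real CARD('n) * unit_ball_vol CARD('n)"
  have c: "?c > 0" by simp
  have "(\<integral>\<^sup>+y. ennreal (shell_kernel x y) * ennreal (heat a y) \<partial>lborel) =
    (\<integral>\<^sup>+y. ennreal (max (norm x) (norm y) powr (2 - real ?n) / ((real ?n - 2) * ?c) * heat_profile ?n a (norm y)) \<partial>(lborel :: (real^'n) measure))"
    using assms by (intro nn_integral_cong) (simp add: shell_kernel_def heat_eq_profile ennreal_mult'[symmetric])
  also have "\<dots> = (\<integral>\<^sup>+r. ennreal (?c * r ^ (?n - 1)) * indicator {0..} r * ennreal (max (norm x) r powr (2 - real ?n) / ((real ?n - 2) * ?c) * heat_profile ?n a r) \<partial>lborel)"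
    using nn_integral_radial[where 'a = "real^'n", of "\<lambda>r. ennreal (max (norm x) r powr (2 - real ?n) / ((real ?n - 2) * ?c) * heat_profile ?n a r)"]
    by simp
  also have "\<dots> = (\<integral>\<^sup>+\<rho>. ennreal (\<rho> ^ (?n - 1) * (max (norm x) \<rho> powr (2 - real ?n) / (real ?n - 2)) * heat_profile ?n a \<rho>) * indicator {0..} \<rho> \<partial>lborel)"
    
  proof (rule nn_integral_cong)
    fix r :: real
    have u: "unit_ball_vol (real ?n) \<noteq> 0" using unit_ball_vol_pos[of "real ?n"] by linarith
    have "?c * r ^ (?n - 1) * (max (norm x) r powr (2 - real ?n) / ((real ?n - 2) * ?c) * heat_profile ?n a r)
      = r ^ (?n - 1) * (max (norm x) r powr (2 - real ?n) / (real ?n - 2)) * heat_profile ?n a r"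
      using u by (simp del: unit_ball_vol_pos)
    then show "ennreal (?c * r ^ (?n - 1)) * indicator {0..} r * ennreal (max (norm x) r powr (2 - real ?n) / ((real ?n - 2) * ?c) * heat_profile ?n a r)
      = ennreal (r ^ (?n - 1) * (max (norm x) r powr (2 - real ?n) / (real ?n - 2)) * heat_profile ?n a r) * indicator {0..} r"
      using c by (cases "r \<ge> 0") (auto simp: ennreal_mult'[symmetric])
  qed
  also have "\<dots> = (\<integral>\<^sup>+t. ennreal (heat_profile ?n t (norm x)) * indicator {a..} t \<partial>lborel)"
    using assms by (intro newton_heat_profile) auto
  finally show ?thesis by (simp add: heat_eq_profile)
qed

lemma heat_tail_finite:
  fixes x :: "real^'n"
  assumes "a > 0" "CARD('n) \<ge> 3"
  shows "(\<integral>\<^sup>+t. ennreal (heat t x) * indicator {a..} t \<partial>lborel) < \<infinity>"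
proof -
  have "(\<integral>\<^sup>+t. ennreal (heat t x) * indicator {a..} t \<partial>lborel)
    \<le> (\<integral>\<^sup>+t. ennreal ((4 * pi) powr (- (real CARD('n) / 2))) * (ennreal (t powr (- (real CARD('n) / 2))) * indicator {a..} t) \<partial>lborel)"
    using assms
    by (intro nn_integral_mono)
       (auto simp: heat_def powr_mult ennreal_mult'[symmetric] split: split_indicator intro!: ennreal_leI mult_left_le)
  also have "\<dots> = ennreal ((4 * pi) powr (- (real CARD('n) / 2))) * ennreal (a powr (1 - real CARD('n) / 2) / (real CARD('n) / 2 - 1))"
    using assms by (subst nn_integral_cmult) (auto simp: nn_integral_powr_tail)
  also have "\<dots> < \<infinity>" by (simp add: ennreal_mult_less_top)
  finally show ?thesis .
qed

text \<open>
  Heat kernels are multiples of the Gaussians in the norm, and these separate measures on the half-line.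
\<close>
lemma distr_norm_density_eqI:
  fixes k k' :: "real^'n \<Rightarrow> ennreal"
  assumes [measurable]: "k \<in> borel_measurable borel" "k' \<in> borel_measurable borel"
    and finite: "\<And>a. a > 0 \<Longrightarrow> (\<integral>\<^sup>+y. k y * ennreal (heat a y) \<partial>lborel) < \<infinity>"
    and eq: "\<And>a. a > 0 \<Longrightarrow> (\<integral>\<^sup>+y. k y * ennreal (heat a y) \<partial>lborel) = (\<integral>\<^sup>+y. k' y * ennreal (heat a y) \<partial>lborel)"
  shows "distr (density lborel k) borel norm = distr (density lborel k') borel norm"
proof (rule measure_eqI_gaussian_moments)
  have M: "(\<integral>\<^sup>+r. ennreal (exp (- (l * r\<^sup>2))) \<partial>distr (density lborel k) borel norm) = ennreal (((pi / l) powr (real CARD('n) / 2))) * (\<integral>\<^sup>+y. k y * ennreal (heat (1 / (4 * l)) y) \<partial>lborel)"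
    if l: "l > 0" and [measurable]: "k \<in> borel_measurable borel" for l and k :: "real^'n \<Rightarrow> ennreal"
  proof -
    have heat: "exp (- (l * (norm y)\<^sup>2)) = (pi / l) powr (real CARD('n) / 2) * heat (1 / (4 * l)) y" for y :: "real^'n"
      using l by (simp add: heat_def powr_minus field_simps)
    have "(\<integral>\<^sup>+r. ennreal (exp (- (l * r\<^sup>2))) \<partial>distr (density lborel k) borel norm) = (\<integral>\<^sup>+y. k y * ennreal (exp (- (l * (norm y)\<^sup>2))) \<partial>lborel)"
      by (subst nn_integral_distr, simp, simp, subst nn_integral_density) auto
    also have "\<dots> = (\<integral>\<^sup>+y. ennreal (((pi / l) powr (real CARD('n) / 2))) * (k y * ennreal (heat (1 / (4 * l)) y)) \<partial>lborel)"
      unfolding heat by (simp add: ennreal_mult' mult_ac)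
    finally show ?thesis by (simp add: nn_integral_cmult)
  qed
  fix l :: real assume l: "l > 0"
  have a: "1 / (4 * l) > 0" using l by simp
  show "(\<integral>\<^sup>+r. ennreal (exp (- (l * r\<^sup>2))) \<partial>distr (density lborel k) borel norm) < \<infinity>"
    using finite[OF a] by (subst M[OF l]) (simp_all add: ennreal_mult_less_top)
  show "(\<integral>\<^sup>+r. ennreal (exp (- (l * r\<^sup>2))) \<partial>distr (density lborel k) borel norm)
    = (\<integral>\<^sup>+r. ennreal (exp (- (l * r\<^sup>2))) \<partial>distr (density lborel k') borel norm)"
    by (subst M[OF l], simp, subst M[OF l], simp) (simp add: eq[OF a])
qed (auto simp: AE_distr_iff)

text \<open>
  Newton's shell theorem.  Against a Gaussian both sides give the heat kernel at \<open>x\<close>, integrated over all times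
  from the parameter of the Gaussian on.
\<close>
theorem newton_shell_measure:
  fixes x :: "real^'n"
  assumes n: "CARD('n) \<ge> 3"
  shows "distr (density lborel (\<lambda>y. resolvent_nn 0 (x - y))) borel norm = distr (density lborel (\<lambda>y. ennreal (shell_kernel x y))) borel norm"
  by (rule distr_norm_density_eqI)
     (use heat_tail_finite[OF _ n] resolvent_convolve_heat[of _ 0 x] shell_convolve_heat[OF _ n] in auto)

lemma resolvent_convolve_heat_finite:
  fixes x :: "real^'n"
  assumes "a > 0" "s \<ge> 0" "CARD('n) \<ge> 3"
  shows "(\<integral>\<^sup>+y. resolvent_nn s (x - y) * ennreal (heat a y) \<partial>lborel) < \<infinity>"
proof -
  have "(\<integral>\<^sup>+t. ennreal (heat t x * exp (- (s * (t - a)))) * indicator {a..} t \<partial>lborel) \<le> (\<integral>\<^sup>+t. ennreal (heat t x) * indicator {a..} t \<partial>lborel)"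
    using assms by (intro nn_integral_mono) (auto split: split_indicator intro!: ennreal_leI mult_left_le)
  then show ?thesis
    using heat_tail_finite[OF assms(1,3), of x] resolvent_convolve_heat[OF assms(1), of s x] by (simp add: le_less_trans)
qed

text \<open>
  Against a Gaussian the left-hand side depends on \<open>x\<close> through the heat kernel at \<open>x\<close> only.  Hence the
  resolvent maps radial functions to radial functions.
\<close>
lemma resolvent_shell_measure_cong:
  fixes x x' :: "real^'n"
  assumes n: "CARD('n) \<ge> 3" and s: "s \<ge> 0" and x: "norm x = norm x'"
  shows "distr (density lborel (\<lambda>y. resolvent_nn s (x - y))) borel norm = distr (density lborel (\<lambda>y. resolvent_nn s (x' - y))) borel norm"
proof (rule distr_norm_density_eqI)
  fix a :: real assume a: "a > 0"
  show "(\<integral>\<^sup>+y. resolvent_nn s (x - y) * ennreal (heat a y) \<partial>lborel) < \<infinity>"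
    by (rule resolvent_convolve_heat_finite[OF a s n])
  show "(\<integral>\<^sup>+y. resolvent_nn s (x - y) * ennreal (heat a y) \<partial>lborel) = (\<integral>\<^sup>+y. resolvent_nn s (x' - y) * ennreal (heat a y) \<partial>lborel)"
    unfolding resolvent_convolve_heat[OF a] using x by (simp add: heat_eq_profile)
qed auto

section \<open>The resolvent kernel and its gap to the Newton kernel\<close>

text \<open>
  Radial at every point, in contrast to \<open>radial\<close>, which allows an exceptional null set.
\<close>
definition radial_fun :: "(real^'n \<Rightarrow> 'b) \<Rightarrow> bool" where
  "radial_fun f \<longleftrightarrow> (\<forall>x y. norm x = norm y \<longrightarrow> f x = f y)"

lemma radial_funD: "radial_fun f \<Longrightarrow> norm x = norm y \<Longrightarrow> f x = f y"
  unfolding radial_fun_def by blast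

lemma radial_fun_profile:
  fixes f :: "real^'n \<Rightarrow> 'b::topological_space"
  assumes "radial_fun f" "f \<in> borel_measurable borel"
  obtains g where "g \<in> borel_measurable borel" "\<And>x. f x = g (norm x)"
proof -
  define e where "e = (axis (SOME i. True) 1 :: real^'n)"
  have e: "norm e = 1" by (simp add: e_def)
  have "(\<lambda>r. f (r *\<^sub>R e)) \<in> borel_measurable borel"
    by (rule measurable_compose[OF _ assms(2)]) simp
  moreover have "f x = f (norm x *\<^sub>R e)" for x
    by (rule radial_funD[OF assms(1)]) (simp add: e)
  ultimately show thesis by (rule that)
qed

lemma newton_nn_antimono: "norm (x::real^'n) \<le> norm (y::real^'n) \<Longrightarrow> resolvent_nn 0 y \<le> resolvent_nn 0 x"
  unfolding resolvent_nn_def heat_def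
  by (intro nn_integral_mono) (auto split: split_indicator intro!: ennreal_leI mult_left_mono divide_right_mono power_mono)

text \<open>
  A finite convolution with a Gaussian shows that the kernel is finite almost everywhere, hence at points
  arbitrarily close to the origin; elsewhere it is smaller.
\<close>
lemma newton_nn_finite:
  fixes z :: "real^'n"
  assumes n: "CARD('n) \<ge> 3" and "z \<noteq> 0"
  shows "resolvent_nn 0 z < \<infinity>"
proof -
  have "AE y in lborel. resolvent_nn 0 (0 - y :: real^'n) * ennreal (heat 1 y) \<noteq> \<infinity>"
    using resolvent_convolve_heat_finite[OF _ _ n, of 1 0 0]
    by (intro nn_integral_PInf_AE) auto
  then have ae: "AE y in lborel. resolvent_nn 0 (- y :: real^'n) < \<infinity>"
  proof eventually_elim
    case (elim y)
    have "heat 1 y > 0" by (simp add: heat_def)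
    then show ?case using elim by (auto simp: ennreal_mult_eq_top_iff less_top)
  qed
  have "\<exists>y\<in>ball (0::real^'n) (norm z). resolvent_nn 0 (- y) < \<infinity>"
  proof (rule ccontr)
    assume "\<not> ?thesis"
    then have "AE y in lborel. y \<notin> ball (0::real^'n) (norm z)"
      using ae by (auto elim!: eventually_mono)
    then have "emeasure lborel (ball (0::real^'n) (norm z)) = 0"
      by (subst (asm) AE_iff_measurable[where N = "ball (0::real^'n) (norm z)"]) auto
    then show False using assms less_imp_neq[OF unit_ball_vol_pos[of "real CARD('n)"]] by (simp add: emeasure_ball)
  qed
  then obtain y :: "real^'n" where y: "norm y < norm z" "resolvent_nn 0 (- y) < \<infinity>" by auto
  have "resolvent_nn 0 z \<le> resolvent_nn 0 (- y)" by (rule newton_nn_antimono) (use y in simp)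
  then show ?thesis using y(2) by (rule le_less_trans)
qed

lemma resolvent_kernel_heat:
  "resolvent_kernel s z = (LINT t|lborel. heat t z * exp (- (s * t)) * indicator {0<..} t)"
  unfolding resolvent_kernel_def set_lebesgue_integral_def heat_def
  by (intro Bochner_Integration.integral_cong) auto

lemma resolvent_kernel_measurable [measurable]: "resolvent_kernel s \<in> borel_measurable borel"
  unfolding resolvent_kernel_heat by measurable

lemma resolvent_kernel_radial: "norm (x::real^'n) = norm (y::real^'n) \<Longrightarrow> resolvent_kernel s x = resolvent_kernel s y"
  by (simp add: resolvent_kernel_def)

lemma resolvent_kernel_minus: "resolvent_kernel s (x - y) = resolvent_kernel s (y - x)"
  by (rule resolvent_kernel_radial) (rule norm_minus_commute)

lemma resolvent_kernel_nonneg: "0 \<le> resolvent_kernel s z"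
  unfolding resolvent_kernel_heat by (rule Bochner_Integration.integral_nonneg) auto

lemma heat_integrable:
  fixes z :: "real^'n"
  assumes "CARD('n) \<ge> 3" "z \<noteq> 0"
  shows "integrable lborel (\<lambda>t. heat t z * indicator {0<..} t)"
proof (rule integrableI_nonneg)
  show "(\<integral>\<^sup>+t. ennreal (heat t z * indicator {0<..} t) \<partial>lborel) < \<infinity>"
    using newton_nn_finite[OF assms] unfolding resolvent_nn_def by (simp add: ennreal_mult' ennreal_indicator)
qed auto

lemma heat_exp_integrable:
  fixes z :: "real^'n"
  assumes "CARD('n) \<ge> 3" "z \<noteq> 0" "s \<ge> 0"
  shows "integrable lborel (\<lambda>t. heat t z * exp (- (s * t)) * indicator {0<..} t)"
  by (rule Bochner_Integration.integrable_bound[OF heat_integrable[OF assms(1,2)]])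
     (use assms(3) in \<open>auto split: split_indicator intro!: mult_left_le\<close>)

lemma ennreal_resolvent_kernel:
  fixes z :: "real^'n"
  assumes "CARD('n) \<ge> 3" "z \<noteq> 0" "s \<ge> 0"
  shows "ennreal (resolvent_kernel s z) = resolvent_nn s z"
  unfolding resolvent_kernel_heat resolvent_nn_def
  using heat_exp_integrable[OF assms]
  by (subst nn_integral_eq_integral[symmetric]) (auto simp: ennreal_mult' ennreal_indicator)

text \<open>
  The difference of the Newton kernel and the resolvent kernel.  As an integral of heat kernels with
  nonnegative weights it is a decreasing function of the norm.
\<close>
definition resolvent_gap :: "real \<Rightarrow> real^'n \<Rightarrow> real" where
  "resolvent_gap s z = (LINT t|lborel. heat t z * (1 - exp (- (s * t))) * indicator {0<..} t)"

lemma resolvent_gap_measurable [measurable]: "resolvent_gap s \<in> borel_measurable borel"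
  unfolding resolvent_gap_def by measurable

lemma gap_integrable:
  fixes z :: "real^'n"
  assumes "CARD('n) \<ge> 3" "z \<noteq> 0" "s \<ge> 0"
  shows "integrable lborel (\<lambda>t. heat t z * (1 - exp (- (s * t))) * indicator {0<..} t)"
  by (rule Bochner_Integration.integrable_bound[OF heat_integrable[OF assms(1,2)]])
     (use assms(3) in \<open>auto split: split_indicator simp: abs_mult intro!: mult_left_le\<close>)

lemma resolvent_kernel_eq_gap:
  fixes z :: "real^'n"
  assumes "CARD('n) \<ge> 3" "z \<noteq> 0" "s \<ge> 0"
  shows "resolvent_kernel s z = resolvent_kernel 0 z - resolvent_gap s z"
proof -
  have "resolvent_kernel 0 z - resolvent_gap s z =
     (LINT t|lborel. heat t z * exp (- (0 * t)) * indicator {0<..} t - heat t z * (1 - exp (- (s * t))) * indicator {0<..} t)"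
    unfolding resolvent_kernel_heat resolvent_gap_def
    by (rule Bochner_Integration.integral_diff[symmetric]) (rule heat_exp_integrable[OF assms(1,2) order_refl], rule gap_integrable[OF assms])
  also have "\<dots> = resolvent_kernel s z"
    unfolding resolvent_kernel_heat by (intro Bochner_Integration.integral_cong) (auto simp: algebra_simps)
  finally show ?thesis ..
qed

lemma resolvent_gap_nonneg: "s \<ge> 0 \<Longrightarrow> 0 \<le> resolvent_gap s z"
  unfolding resolvent_gap_def by (rule Bochner_Integration.integral_nonneg) (auto split: split_indicator)

lemma resolvent_gap_antimono:
  fixes x y :: "real^'n"
  assumes "CARD('n) \<ge> 3" "x \<noteq> 0" "norm x \<le> norm y" "s \<ge> 0"
  shows "resolvent_gap s y \<le> resolvent_gap s x"
  unfolding resolvent_gap_def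
proof (rule integral_mono)
  show "heat t y * (1 - exp (- (s * t))) * indicator {0<..} t \<le> heat t x * (1 - exp (- (s * t))) * indicator {0<..} t" for t
    using assms unfolding heat_def
    by (auto split: split_indicator intro!: mult_right_mono mult_left_mono divide_right_mono power_mono)
qed (use assms in \<open>auto intro!: gap_integrable\<close>)

lemma resolvent_gap_le:
  fixes z :: "real^'n"
  assumes "CARD('n) \<ge> 3" "z \<noteq> 0" "s \<ge> 0"
  shows "resolvent_gap s z \<le> resolvent_kernel 0 z"
  using resolvent_kernel_eq_gap[OF assms] resolvent_kernel_nonneg[of s z] by simp

lemma resolvent_kernel_le:
  fixes z :: "real^'n"
  assumes "CARD('n) \<ge> 3" "z \<noteq> 0" "s \<ge> 0"
  shows "resolvent_kernel s z \<le> resolvent_kernel 0 z"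
  using resolvent_kernel_eq_gap[OF assms] resolvent_gap_nonneg[of s z] assms by simp

lemma resolvent_gap_tendsto_0:
  fixes z :: "real^'n"
  assumes "CARD('n) \<ge> 3" "z \<noteq> 0" "s \<longlonglongrightarrow> 0" "\<And>i. s i \<ge> 0"
  shows "(\<lambda>i. resolvent_gap (s i) z) \<longlonglongrightarrow> 0"
proof -
  have "(\<lambda>i. resolvent_gap (s i) z) \<longlonglongrightarrow> (LINT t|(lborel :: real measure). 0)"
    unfolding resolvent_gap_def
  proof (rule integral_dominated_convergence[where w = "\<lambda>t. heat t z * indicator {0<..} t"])
    show "integrable lborel (\<lambda>t. heat t z * indicator {0<..} t)" by (rule heat_integrable[OF assms(1,2)])
    show "AE t in lborel. (\<lambda>i. heat t z * (1 - exp (- (s i * t))) * indicator {0<..} t) \<longlonglongrightarrow> 0"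
      using assms(3) by (auto intro!: tendsto_eq_intros)
    show "AE t in lborel. norm (heat t z * (1 - exp (- (s i * t))) * indicator {0<..} t) \<le> heat t z * indicator {0<..} t" for i
      using assms(4)[of i] by (auto split: split_indicator simp: abs_mult intro!: mult_left_le)
  qed auto
  then show ?thesis by simp
qed

section \<open>Convolutions of radially decreasing functions\<close>

text \<open>
  At each \<open>y\<close> the larger of the two arguments \<open>x - y\<close> and \<open>y\<close> is replaced by the smaller one; this leaves
  \<open>k y * w y\<close> or \<open>k (x - y) * w (x - y)\<close>, and the two have the same integral.
\<close>
lemma convolution_decreasing_le:
  fixes k w :: "real^'n \<Rightarrow> ennreal"
  assumes [measurable]: "k \<in> borel_measurable borel" "w \<in> borel_measurable borel"
    and k: "\<And>x y. x \<noteq> 0 \<Longrightarrow> norm x \<le> norm y \<Longrightarrow> k y \<le> k x"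
    and w: "\<And>x y. x \<noteq> 0 \<Longrightarrow> norm x \<le> norm y \<Longrightarrow> w y \<le> w x"
  shows "(\<integral>\<^sup>+y. k (x - y) * w y \<partial>lborel) \<le> 2 * (\<integral>\<^sup>+y. k y * w y \<partial>lborel)"
proof -
  have "AE y in lborel. k (x - y) * w y \<le> k y * w y + k (x - y) * w (x - y)"
    using AE_lborel_singleton[of "0::real^'n"] AE_lborel_singleton[of x]
  proof eventually_elim
    case (elim y)
    show ?case
    proof (cases "norm y \<le> norm (x - y)")
      case True
      then have "k (x - y) * w y \<le> k y * w y" using elim by (intro mult_right_mono k) auto
      then show ?thesis by (simp add: add_increasing2)
    next
      case False
      then have "k (x - y) * w y \<le> k (x - y) * w (x - y)" using elim by (intro mult_left_mono w) auto
      then show ?thesis by (simp add: add_increasing)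
    qed
  qed
  then have "(\<integral>\<^sup>+y. k (x - y) * w y \<partial>lborel) \<le> (\<integral>\<^sup>+y. k y * w y + k (x - y) * w (x - y) \<partial>lborel)"
    by (rule nn_integral_mono_AE)
  also have "\<dots> = (\<integral>\<^sup>+y. k y * w y \<partial>lborel) + (\<integral>\<^sup>+y. k (x - y) * w (x - y) \<partial>lborel)"
    by (rule nn_integral_add) auto
  also have "(\<integral>\<^sup>+y. k (x - y) * w (x - y) \<partial>lborel) = (\<integral>\<^sup>+y. k y * w y \<partial>lborel)"
  proof -
    have "(\<integral>\<^sup>+y. k y * w y \<partial>lborel) = (\<integral>\<^sup>+y. k y * w y \<partial>distr lborel borel (\<lambda>y. x + (- 1) *\<^sub>R y))"
      using lborel_affine[of "-1" x] by (simp add: density_1)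
    also have "\<dots> = (\<integral>\<^sup>+y. k (x - y) * w (x - y) \<partial>lborel)"
      by (subst nn_integral_distr) auto
    finally show ?thesis ..
  qed
  finally show ?thesis by (simp add: mult_2)
qed

section \<open>Integration against the Newton kernel\<close>

lemma newton_shell_nn:
  fixes g :: "real^'n \<Rightarrow> ennreal"
  assumes n: "CARD('n) \<ge> 3" and g: "radial_fun g" "g \<in> borel_measurable borel"
  shows "(\<integral>\<^sup>+y. ennreal (resolvent_kernel 0 (x - y)) * g y \<partial>lborel) = (\<integral>\<^sup>+y. ennreal (shell_kernel x y) * g y \<partial>lborel)"
proof -
  obtain g' where [measurable]: "g' \<in> borel_measurable borel" and g': "\<And>y. g y = g' (norm y)"
    using radial_fun_profile[OF g] by blast
  have *: "(\<integral>\<^sup>+r. g' r \<partial>distr (density lborel k) borel norm) = (\<integral>\<^sup>+y. k y * g y \<partial>lborel)"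
    if [measurable]: "k \<in> borel_measurable borel" for k :: "real^'n \<Rightarrow> ennreal"
    unfolding g' by (subst nn_integral_distr, simp, simp, subst nn_integral_density) auto
  have "(\<integral>\<^sup>+y. ennreal (resolvent_kernel 0 (x - y)) * g y \<partial>lborel) = (\<integral>\<^sup>+y. resolvent_nn 0 (x - y) * g y \<partial>lborel)"
    by (rule nn_integral_cong_AE, rule eventually_mono[OF AE_lborel_singleton[of x]]) (simp add: ennreal_resolvent_kernel n)
  also have "\<dots> = (\<integral>\<^sup>+y. ennreal (shell_kernel x y) * g y \<partial>lborel)"
    using arg_cong[OF newton_shell_measure[OF n, of x], of "\<lambda>M. nn_integral M g'"] by (simp add: *)
  finally show ?thesis .
qed

lemma shell_kernel_nonneg: "CARD('n) \<ge> 3 \<Longrightarrow> 0 \<le> shell_kernel x (y :: real^'n)"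
  by (simp add: shell_kernel_def)

lemma newton_shell_integral:
  fixes h :: "real^'n \<Rightarrow> complex"
  assumes n: "CARD('n) \<ge> 3" and h: "radial_fun h" "h \<in> borel_measurable borel"
  shows "(LINT y|lborel. complex_of_real (resolvent_kernel 0 (x - y)) * h y) = (LINT y|lborel. complex_of_real (shell_kernel x y) * h y)"
proof -
  obtain g where [measurable]: "g \<in> borel_measurable borel" and g: "\<And>y. h y = g (norm y)"
    using radial_fun_profile[OF h] by blast
  have *: "(LINT r|distr (density lborel (\<lambda>y. ennreal (k y))) borel norm. g r) = (LINT y|lborel. complex_of_real (k y) * h y)"
    if [measurable]: "k \<in> borel_measurable borel" and "\<And>y. 0 \<le> k y" for k :: "real^'n \<Rightarrow> real"
    unfolding g using that(2) by (subst integral_distr, simp, simp, subst integral_density) (auto simp: scaleR_conv_of_real)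
  have "density lborel (\<lambda>y. resolvent_nn 0 (x - y)) = density lborel (\<lambda>y. ennreal (resolvent_kernel 0 (x - y)))"
    by (rule density_cong, simp, simp, rule eventually_mono[OF AE_lborel_singleton[of x]]) (simp add: ennreal_resolvent_kernel n)
  then show ?thesis
    using arg_cong[OF newton_shell_measure[OF n, of x], of "\<lambda>M. integral\<^sup>L M g"] n
    by (simp add: * resolvent_kernel_nonneg shell_kernel_nonneg)
qed

section \<open>The resolvent on radial functions\<close>

lemma resolvent_measurable:
  assumes [measurable]: "h \<in> borel_measurable borel"
  shows "resolvent s h \<in> borel_measurable borel"
  unfolding resolvent_def by measurable

lemma resolvent_radial:
  fixes h :: "real^'n \<Rightarrow> complex"
  assumes n: "CARD('n) \<ge> 3" and s: "s \<ge> 0" and h: "radial_fun h" "h \<in> borel_measurable borel"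
  shows "radial_fun (resolvent s h)"
  unfolding radial_fun_def
proof (intro allI impI)
  fix x x' :: "real^'n" assume x: "norm x = norm x'"
  obtain g where [measurable]: "g \<in> borel_measurable borel" and g: "\<And>y. h y = g (norm y)"
    using radial_fun_profile[OF h] by blast
  have *: "resolvent s h x = (LINT r|distr (density lborel (\<lambda>y. resolvent_nn s (x - y))) borel norm. g r)" for x
  proof -
    have "density lborel (\<lambda>y. resolvent_nn s (x - y)) = density lborel (\<lambda>y. ennreal (resolvent_kernel s (x - y)))"
      by (rule density_cong, simp, simp, rule eventually_mono[OF AE_lborel_singleton[of x]]) (simp add: ennreal_resolvent_kernel n s)
    then show ?thesis unfolding g resolvent_def
      by (simp, subst integral_distr, simp, simp, subst integral_density) (auto simp: scaleR_conv_of_real resolvent_kernel_nonneg)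
  qed
  show "resolvent s h x = resolvent s h x'"
    unfolding * resolvent_shell_measure_cong[OF n s x] ..
qed

section \<open>Integrability of radial powers\<close>

lemma nn_integral_powr_ball:
  assumes "p < 1"
  shows "(\<integral>\<^sup>+r. ennreal (r powr (- p)) * indicator {0<..1} r \<partial>lborel) < \<infinity>"
proof -
  have "((\<lambda>r. r powr (- p)) has_integral (1 / (1 - p))) {0..1}"
    using has_integral_powr_from_0[of "- p" 1] assms by (simp add: add.commute)
  then have "((\<lambda>r. r powr (- p) * indicator {0..1} r) has_integral (1 / (1 - p))) UNIV"
    unfolding indicator_def of_bool_def if_distrib[where f="\<lambda>x. a * x" for a]
    by (simp cong del: if_weak_cong del: atLeastAtMost_iff)
  then have "(\<integral>\<^sup>+r. ennreal (r powr (- p) * indicator {0..1} r) \<partial>lborel) = ennreal (1 / (1 - p))"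
    by (intro nn_integral_has_integral_lborel) auto
  moreover have "(\<integral>\<^sup>+r. ennreal (r powr (- p)) * indicator {0<..1} r \<partial>lborel) \<le> (\<integral>\<^sup>+r. ennreal (r powr (- p) * indicator {0..1} r) \<partial>lborel)"
    by (intro nn_integral_mono) (auto split: split_indicator)
  ultimately show ?thesis by (simp add: le_less_trans)
qed

lemma integrable_powr_bound:
  fixes f :: "real^'n \<Rightarrow> real"
  assumes [measurable]: "f \<in> borel_measurable borel"
    and small: "\<And>y. 0 < norm y \<Longrightarrow> norm y \<le> 1 \<Longrightarrow> \<bar>f y\<bar> \<le> C * norm y powr (- \<alpha>)" and "\<alpha> < real CARD('n)"
    and large: "\<And>y. 1 \<le> norm y \<Longrightarrow> \<bar>f y\<bar> \<le> C * norm y powr (- \<beta>)" and "real CARD('n) < \<beta>"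
  shows "integrable lborel f"
proof (rule integrableI_bounded)
  let ?n = "CARD('n)" and ?c = "real CARD('n) * unit_ball_vol CARD('n)"
  let ?g = "\<lambda>r. ennreal \<bar>C\<bar> * (ennreal (r powr (- \<alpha>)) * indicator {0<..1} r + ennreal (r powr (- \<beta>)) * indicator {1..} r)"
  have "(\<integral>\<^sup>+y. ennreal (norm (f y)) \<partial>lborel) \<le> (\<integral>\<^sup>+y. ?g (norm (y::real^'n)) \<partial>lborel)"
  proof (rule nn_integral_mono_AE, rule eventually_mono[OF AE_lborel_singleton[of 0]])
    fix y :: "real^'n" assume "y \<noteq> 0"
    show "ennreal (norm (f y)) \<le> ?g (norm y)"
    proof (cases "norm y \<le> 1")
      case True
      have "\<bar>f y\<bar> \<le> \<bar>C\<bar> * norm y powr (- \<alpha>)"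
        using order_trans[OF small[of y] mult_right_mono[OF abs_ge_self powr_ge_zero]] \<open>y \<noteq> 0\<close> True by simp
      then have "ennreal (norm (f y)) \<le> ennreal \<bar>C\<bar> * (ennreal (norm y powr (- \<alpha>)) * indicator {0<..1} (norm y))"
        using True \<open>y \<noteq> 0\<close> by (simp add: ennreal_mult'[symmetric] ennreal_leI)
      then show ?thesis by (rule order_trans) (intro mult_left_mono, auto)
    next
      case False
      have "\<bar>f y\<bar> \<le> \<bar>C\<bar> * norm y powr (- \<beta>)"
        using order_trans[OF large[of y] mult_right_mono[OF abs_ge_self powr_ge_zero]] False by simp
      then have "ennreal (norm (f y)) \<le> ennreal \<bar>C\<bar> * (ennreal (norm y powr (- \<beta>)) * indicator {1..} (norm y))"
        using False by (simp add: ennreal_mult'[symmetric] ennreal_leI)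
      then show ?thesis by (rule order_trans) (intro mult_left_mono, auto)
    qed
  qed
  also have "\<dots> = (\<integral>\<^sup>+r. ennreal (?c * r ^ (?n - 1)) * indicator {0..} r * ?g r \<partial>lborel)"
    using nn_integral_radial[where 'a = "real^'n", of ?g] by simp
  also have "\<dots> = (\<integral>\<^sup>+r. ennreal (?c * \<bar>C\<bar>) * (ennreal (r powr (- (\<alpha> - real ?n + 1))) * indicator {0<..1} r) +
       ennreal (?c * \<bar>C\<bar>) * (ennreal (r powr (- (\<beta> - real ?n + 1))) * indicator {1..} r) \<partial>lborel)"
  proof (rule nn_integral_cong)
    fix r :: real
    have pw: "r ^ (?n - 1) * r powr (- p) = r powr (- (p - real ?n + 1))" if "r > 0" for p
    proof -
      have "r ^ (?n - 1) = r powr (real ?n - 1)" using that powr_realpow[of r "?n - 1"] by (simp add: of_nat_diff)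
      then show ?thesis using that by (simp add: powr_add[symmetric] algebra_simps)
    qed
    have "ennreal (?c * r ^ (?n - 1)) * (ennreal \<bar>C\<bar> * ennreal (r powr (- p))) = ennreal (?c * \<bar>C\<bar>) * ennreal (r powr (- (p - real ?n + 1)))" if "r > 0" for p
      using that pw[OF that, of p] by (simp add: ennreal_mult'[symmetric] mult_ac)
    then show "ennreal (?c * r ^ (?n - 1)) * indicator {0..} r * ?g r = ennreal (?c * \<bar>C\<bar>) * (ennreal (r powr (- (\<alpha> - real ?n + 1))) * indicator {0<..1} r) +
       ennreal (?c * \<bar>C\<bar>) * (ennreal (r powr (- (\<beta> - real ?n + 1))) * indicator {1..} r)"
      by (cases "r > 0") (auto simp: distrib_left mult.assoc split: split_indicator)
  qed
  also have "\<dots> = ennreal (?c * \<bar>C\<bar>) * (\<integral>\<^sup>+r. ennreal (r powr (- (\<alpha> - real ?n + 1))) * indicator {0<..1} r \<partial>lborel) +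
       ennreal (?c * \<bar>C\<bar>) * (\<integral>\<^sup>+r. ennreal (r powr (- (\<beta> - real ?n + 1))) * indicator {1..} r \<partial>lborel)"
    by (simp add: nn_integral_add nn_integral_cmult)
  also have "\<dots> < \<infinity>"
    using nn_integral_powr_ball[of "\<alpha> - real ?n + 1"] nn_integral_powr_tail[of 1 "\<beta> - real ?n + 1"] assms(3,5)
    by (simp add: ennreal_mult_less_top)
  finally show "(\<integral>\<^sup>+y. ennreal (norm (f y)) \<partial>lborel) < \<infinity>" .
qed simp

section \<open>The gap between the resolvent and the Newton kernel for small spectral parameter\<close>

text \<open>
  What remains of the gap after the substitution \<open>t / s\<close> for the time: the gap at \<open>z\<close> is the profile at
  \<open>s |z|\<^sup>2 / 4\<close> times a power of \<open>s\<close>.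
\<close>
definition gap_profile :: "nat \<Rightarrow> real \<Rightarrow> real" where
  "gap_profile n \<eta> = (LINT t|lborel. t powr (- (real n / 2)) * exp (- (\<eta> / t)) * (1 - exp (- t)) * indicator {0<..} t)"

lemma resolvent_gap_scaling:
  fixes z :: "real^'n"
  assumes "s > 0"
  shows "resolvent_gap s z = s powr (real CARD('n) / 2 - 1) * (4 * pi) powr (- (real CARD('n) / 2)) * gap_profile CARD('n) (s * (norm z)\<^sup>2 / 4)"
proof -
  let ?n = "CARD('n)"
  have "resolvent_gap s z = (1 / s) * (LINT t|lborel. heat (t / s) z * (1 - exp (- (s * (t / s)))) * indicator {0<..} (t / s))"
    unfolding resolvent_gap_def using assms
    by (subst lborel_integral_real_affine[where c = "1 / s" and t = 0]) auto
  also have "(LINT t|lborel. heat (t / s) z * (1 - exp (- (s * (t / s)))) * indicator {0<..} (t / s)) =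
     (LINT t|lborel. s powr (real ?n / 2) * (4 * pi) powr (- (real ?n / 2)) * (t powr (- (real ?n / 2)) * exp (- ((s * (norm z)\<^sup>2 / 4) / t)) * (1 - exp (- t)) * indicator {0<..} t))"
  proof (rule Bochner_Integration.integral_cong[OF refl])
    fix t :: real
    have "(4 * pi * (t / s)) powr (- (real ?n / 2)) = s powr (real ?n / 2) * (4 * pi) powr (- (real ?n / 2)) * t powr (- (real ?n / 2))" if "t > 0"
      using that assms by (simp add: powr_mult powr_divide powr_minus field_simps)
    then show "heat (t / s) z * (1 - exp (- (s * (t / s)))) * indicator {0<..} (t / s) =
      s powr (real ?n / 2) * (4 * pi) powr (- (real ?n / 2)) * (t powr (- (real ?n / 2)) * exp (- ((s * (norm z)\<^sup>2 / 4) / t)) * (1 - exp (- t)) * indicator {0<..} t)"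
      using assms by (auto simp: heat_def mult_ac zero_less_divide_iff split: split_indicator)
  qed
  also have "\<dots> = s powr (real ?n / 2) * (4 * pi) powr (- (real ?n / 2)) * gap_profile ?n (s * (norm z)\<^sup>2 / 4)"
    by (simp add: gap_profile_def)
  finally show ?thesis
    using assms powr_diff[of s "real ?n / 2" 1] by simp
qed

lemma one_minus_exp_bounds:
  fixes t :: real
  assumes "t \<ge> 0"
  shows "0 \<le> 1 - exp (- t)" "1 - exp (- t) \<le> t" "1 - exp (- t) \<le> 1" "t - t\<^sup>2 \<le> 1 - exp (- t)"
proof -
  show "0 \<le> 1 - exp (- t)" "1 - exp (- t) \<le> 1" using assms by auto
  show "1 - exp (- t) \<le> t" using exp_ge_add_one_self[of "- t"] by simp
  have "exp (- t) \<le> 1 / (1 + t)"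
    using exp_ge_add_one_self[of t] assms by (simp add: exp_minus field_simps)
  moreover have "t - t\<^sup>2 \<le> 1 - 1 / (1 + t)"
    using assms by (simp add: field_simps power2_eq_square) (simp add: algebra_simps)?
  ultimately show "t - t\<^sup>2 \<le> 1 - exp (- t)" by linarith
qed

lemma gap_profile_3_integrable:
  assumes "\<eta> \<ge> 0"
  shows "integrable lborel (\<lambda>t. t powr (- (real 3 / 2)) * exp (- (\<eta> / t)) * (1 - exp (- t)) * indicator {0<..} t)"
proof (rule integrableI_nonneg)
  have "(\<integral>\<^sup>+t. ennreal (t powr (- (real 3 / 2)) * exp (- (\<eta> / t)) * (1 - exp (- t)) * indicator {0<..} t) \<partial>lborel)
     \<le> (\<integral>\<^sup>+t. ennreal (t powr (- (1 / 2))) * indicator {0<..1} t + ennreal (t powr (- (3 / 2))) * indicator {1..} t \<partial>lborel)"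
  proof (rule nn_integral_mono)
    fix t :: real
    have a: "t powr (- (3 / 2)) * exp (- (\<eta> / t)) * (1 - exp (- t)) \<le> t powr (- (3 / 2)) * 1 * t" if "t > 0"
      using that assms one_minus_exp_bounds[of t] by (intro mult_mono) auto
    have b: "t powr (- (3 / 2)) * t = t powr (- (1 / 2))" if "t > 0"
      using that powr_add[of t "- (3 / 2)" 1] by simp
    have c: "t powr (- (3 / 2)) * exp (- (\<eta> / t)) * (1 - exp (- t)) \<le> t powr (- (3 / 2)) * 1 * 1" if "t > 0"
      using that assms one_minus_exp_bounds[of t] by (intro mult_mono) auto
    show "ennreal (t powr (- (real 3 / 2)) * exp (- (\<eta> / t)) * (1 - exp (- t)) * indicator {0<..} t)
      \<le> ennreal (t powr (- (1 / 2))) * indicator {0<..1} t + ennreal (t powr (- (3 / 2))) * indicator {1..} t"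
    proof (cases "t > 0"; cases "t \<le> 1")
      assume t: "t > 0" "t \<le> 1"
      then have "ennreal (t powr (- (real 3 / 2)) * exp (- (\<eta> / t)) * (1 - exp (- t)) * indicator {0<..} t) \<le> ennreal (t powr (- (1 / 2))) * indicator {0<..1} t"
        using a b by (auto intro!: ennreal_leI)
      then show ?thesis by (rule order_trans) simp
    next
      assume t: "t > 0" "\<not> t \<le> 1"
      then have "ennreal (t powr (- (real 3 / 2)) * exp (- (\<eta> / t)) * (1 - exp (- t)) * indicator {0<..} t) \<le> ennreal (t powr (- (3 / 2))) * indicator {1..} t"
        using c by (auto intro!: ennreal_leI)
      then show ?thesis by (rule order_trans) simp
    qed auto
  qed
  also have "\<dots> = (\<integral>\<^sup>+t. ennreal (t powr (- (1 / 2))) * indicator {0<..1} t \<partial>lborel) + (\<integral>\<^sup>+t. ennreal (t powr (- (3 / 2))) * indicator {1..} t \<partial>lborel)"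
    by (rule nn_integral_add) auto
  also have "\<dots> < \<infinity>"
    using nn_integral_powr_ball[of "1 / 2"] nn_integral_powr_tail[of 1 "3 / 2"] by simp
  finally show "(\<integral>\<^sup>+t. ennreal (t powr (- (real 3 / 2)) * exp (- (\<eta> / t)) * (1 - exp (- t)) * indicator {0<..} t) \<partial>lborel) < \<infinity>" .
qed (auto split: split_indicator)

lemma gap_profile_3_le:
  assumes "\<eta> \<ge> 0"
  shows "gap_profile 3 \<eta> \<le> gap_profile 3 0"
  unfolding gap_profile_def
proof (rule integral_mono[OF gap_profile_3_integrable gap_profile_3_integrable])
  show "t powr (- (real 3 / 2)) * exp (- (\<eta> / t)) * (1 - exp (- t)) * indicator {0<..} t
    \<le> t powr (- (real 3 / 2)) * exp (- (0 / t)) * (1 - exp (- t)) * indicator {0<..} t" for t :: real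
    using assms one_minus_exp_bounds[of t] by (auto split: split_indicator intro!: mult_right_mono mult_left_le)
qed (use assms in auto)

lemma gap_profile_3_pos: "gap_profile 3 0 > 0"
proof -
  let ?f = "\<lambda>t. t powr (- (real 3 / 2)) * exp (- (0 / t)) * (1 - exp (- t)) * indicator {0<..} t :: real"
  have nn: "0 \<le> ?f t" for t by (auto split: split_indicator)
  have "gap_profile 3 0 \<noteq> 0"
  proof
    assume "gap_profile 3 0 = 0"
    then have "AE t in lborel. ?f t = 0"
      using integral_nonneg_eq_0_iff_AE[OF gap_profile_3_integrable[OF order_refl]] nn unfolding gap_profile_def by auto
    then have "AE t in lborel. t \<notin> {0<..<1::real}"
      by eventually_elim (auto split: split_indicator_asm)
    then have "emeasure lborel {0<..<1::real} = 0"
      by (subst (asm) AE_iff_measurable[where N = "{0<..<1::real}"]) auto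
    then show False by simp
  qed
  moreover have "gap_profile 3 0 \<ge> 0"
    unfolding gap_profile_def by (rule Bochner_Integration.integral_nonneg) (rule nn)
  ultimately show ?thesis by simp
qed

lemma gap_profile_3_tendsto:
  assumes "\<eta> \<longlonglongrightarrow> 0" "\<And>i. \<eta> i \<ge> 0"
  shows "(\<lambda>i. gap_profile 3 (\<eta> i)) \<longlonglongrightarrow> gap_profile 3 0"
  unfolding gap_profile_def
proof (rule integral_dominated_convergence[OF _ _ gap_profile_3_integrable[OF order_refl]])
  show "AE t in lborel. (\<lambda>i. t powr (- (real 3 / 2)) * exp (- (\<eta> i / t)) * (1 - exp (- t)) * indicator {0<..} t)
     \<longlonglongrightarrow> t powr (- (real 3 / 2)) * exp (- (0 / t)) * (1 - exp (- t)) * indicator {0<..} t"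
  proof (rule AE_I2)
    fix t :: real
    show "(\<lambda>i. t powr (- (real 3 / 2)) * exp (- (\<eta> i / t)) * (1 - exp (- t)) * indicator {0<..} t)
     \<longlonglongrightarrow> t powr (- (real 3 / 2)) * exp (- (0 / t)) * (1 - exp (- t)) * indicator {0<..} t"
    proof (cases "t > 0")
      case True
      then have "(\<lambda>i. \<eta> i / t) \<longlonglongrightarrow> 0 / t" by (intro tendsto_intros assms) auto
      then show ?thesis by (intro tendsto_mult tendsto_const tendsto_exp tendsto_minus)
    qed simp
  qed
  show "AE t in lborel. norm (t powr (- (real 3 / 2)) * exp (- (\<eta> i / t)) * (1 - exp (- t)) * indicator {0<..} t)
     \<le> t powr (- (real 3 / 2)) * exp (- (0 / t)) * (1 - exp (- t)) * indicator {0<..} t" for i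
    using assms(2)[of i] by (auto simp: abs_mult split: split_indicator intro!: mult_right_mono mult_left_le)
qed auto

text \<open>
  In dimension four the profile diverges logarithmically at 0.  The integrand is at most \<open>1 / \<eta>\<close> up to \<open>\<eta>\<close>, at most
  \<open>1 / t\<close> between \<open>\<eta>\<close> and 1, and at most \<open>1 / t\<^sup>2\<close> beyond; the three integrals are 1, \<open>ln (1 / \<eta>)\<close> and 1.
\<close>
lemma gap_profile_4_upper:
  assumes "0 < \<eta>" "\<eta> < 1"
  shows "gap_profile 4 \<eta> \<le> ln (1 / \<eta>) + 2"
    and "integrable lborel (\<lambda>t. t powr (- (real 4 / 2)) * exp (- (\<eta> / t)) * (1 - exp (- t)) * indicator {0<..} t)"
proof -
  let ?f = "\<lambda>t. t powr (- (real 4 / 2)) * exp (- (\<eta> / t)) * (1 - exp (- t)) * indicator {0<..} t"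
  have nn: "0 \<le> ?f t" for t using one_minus_exp_bounds(1)[of t] by (auto split: split_indicator)
  have "(\<integral>\<^sup>+t. ennreal (?f t) \<partial>lborel)
     \<le> (\<integral>\<^sup>+t. ennreal (1 / \<eta>) * indicator {0..\<eta>} t + (ennreal (1 / t) * indicator {\<eta>..1} t + ennreal (t powr (- 2)) * indicator {1..} t) \<partial>lborel)"
  proof (rule nn_integral_mono)
    fix t :: real
    show "ennreal (?f t) \<le> ennreal (1 / \<eta>) * indicator {0..\<eta>} t + (ennreal (1 / t) * indicator {\<eta>..1} t + ennreal (t powr (- 2)) * indicator {1..} t)"
    proof (cases "t > 0")
      case True
      have p: "t powr (- 2) = 1 / (t * t)" using True by (simp add: powr_minus powr_numeral power2_eq_square field_simps)
      have e1: "exp (- (\<eta> / t)) \<le> t / \<eta>"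
        using exp_ge_add_one_self[of "\<eta> / t"] True assms by (simp add: exp_minus field_simps)
      have f: "?f t = 1 / (t * t) * exp (- (\<eta> / t)) * (1 - exp (- t))" using True p by simp
      have a: "?f t \<le> 1 / (t * t) * (t / \<eta>) * t"
        unfolding f using True e1 one_minus_exp_bounds[of t] assms by (intro mult_mono) auto
      have b: "?f t \<le> 1 / (t * t) * 1 * t"
        unfolding f using True one_minus_exp_bounds[of t] assms by (intro mult_mono) auto
      have c: "?f t \<le> 1 / (t * t) * 1 * 1"
        unfolding f using True one_minus_exp_bounds[of t] assms by (intro mult_mono) auto
      consider "t \<le> \<eta>" | "\<eta> \<le> t" "t \<le> 1" | "1 \<le> t" by linarith
      then show ?thesis
      proof cases
        case 1
        then have "ennreal (?f t) \<le> ennreal (1 / \<eta>) * indicator {0..\<eta>} t"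
          using a True by (auto intro!: ennreal_leI)
        then show ?thesis by (rule order_trans) simp
      next
        case 2
        then have "ennreal (?f t) \<le> ennreal (1 / t) * indicator {\<eta>..1} t"
          using b True by (auto intro!: ennreal_leI)
        then show ?thesis by (rule order_trans) (simp add: add_increasing)
      next
        case 3
        then have "ennreal (?f t) \<le> ennreal (t powr (- 2)) * indicator {1..} t"
          using c True p by (auto intro!: ennreal_leI)
        then show ?thesis by (rule order_trans) (simp add: add_increasing)
      qed
    qed simp
  qed
  also have "\<dots> = (\<integral>\<^sup>+t. ennreal (1 / \<eta>) * indicator {0..\<eta>} t \<partial>lborel) + ((\<integral>\<^sup>+t. ennreal (1 / t) * indicator {\<eta>..1} t \<partial>lborel) + (\<integral>\<^sup>+t. ennreal (t powr (- 2)) * indicator {1..} t \<partial>lborel))"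
    by (subst nn_integral_add, simp, simp, subst nn_integral_add) auto
  also have "(\<integral>\<^sup>+t. ennreal (1 / \<eta>) * indicator {0..\<eta>} t \<partial>lborel) = ennreal 1"
    using assms by (simp add: nn_integral_cmult ennreal_mult'[symmetric])
  also have "(\<integral>\<^sup>+t. ennreal (1 / t) * indicator {\<eta>..1} t \<partial>lborel) = ennreal (ln 1 - ln \<eta>)"
    by (rule nn_integral_FTC_Icc) (use assms in \<open>auto intro!: derivative_eq_intros\<close>)
  also have "(\<integral>\<^sup>+t. ennreal (t powr (- 2)) * indicator {1..} t \<partial>lborel) = ennreal 1"
    using nn_integral_powr_tail[of 1 2] by simp
  also have "ennreal 1 + (ennreal (ln 1 - ln \<eta>) + ennreal 1) = ennreal (ln (1 / \<eta>) + 2)"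
  proof -
    have "ln \<eta> \<le> 1" using ln_less_zero[OF assms] by linarith
    then show ?thesis
      using assms by (subst ennreal_plus[symmetric], simp, simp, subst ennreal_plus[symmetric]) (auto simp: ln_div)
  qed
  finally have *: "(\<integral>\<^sup>+t. ennreal (?f t) \<partial>lborel) \<le> ennreal (ln (1 / \<eta>) + 2)" .
  show int: "integrable lborel ?f"
    by (rule integrableI_nonneg) (use nn * in \<open>auto intro: le_less_trans\<close>)
  have "ennreal (gap_profile 4 \<eta>) \<le> ennreal (ln (1 / \<eta>) + 2)"
    using * nn_integral_eq_integral[OF int] nn unfolding gap_profile_def by auto
  show "gap_profile 4 \<eta> \<le> ln (1 / \<eta>) + 2"
    proof -
    have "ln \<eta> \<le> 1" using ln_less_zero[OF assms] by linarith
    then have "0 \<le> ln (1 / \<eta>) + 2" using assms by (simp add: ln_div)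
    then show ?thesis using \<open>ennreal (gap_profile 4 \<eta>) \<le> _\<close> by (simp add: ennreal_le_iff)
  qed
qed

text \<open>
  Between \<open>\<eta>\<close> and 1 the integrand is at least \<open>(1 - t) (1 - \<eta> / t) / t\<close>, since \<open>1 - exp (- t) \<ge> t - t\<^sup>2\<close>.
\<close>
lemma gap_profile_4_lower:
  assumes "0 < \<eta>" "\<eta> < 1"
  shows "ln (1 / \<eta>) - 2 \<le> gap_profile 4 \<eta>"
proof -
  have h: "has_bochner_integral lborel (\<lambda>t. (1 / t - 1 - \<eta> / t\<^sup>2) * indicator {\<eta>..1} t) ((ln 1 - 1 + \<eta> / 1) - (ln \<eta> - \<eta> + \<eta> / \<eta>))"
  proof (rule has_bochner_integral_FTC_Icc_real)
    show "((\<lambda>t. ln t - t + \<eta> / t) has_real_derivative 1 / t - 1 - \<eta> / t\<^sup>2) (at t)" if "\<eta> \<le> t" for t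
      using that assms by (auto intro!: derivative_eq_intros simp: power2_eq_square)
    show "isCont (\<lambda>t. 1 / t - 1 - \<eta> / t\<^sup>2) t" if "\<eta> \<le> t" for t
      using that assms by (auto intro!: continuous_intros)
  qed (use assms in auto)
  have "(LINT t|lborel. (1 / t - 1 - \<eta> / t\<^sup>2) * indicator {\<eta>..1} t) \<le> gap_profile 4 \<eta>"
    unfolding gap_profile_def
  proof (rule integral_mono[OF _ gap_profile_4_upper(2)[OF assms]])
    show "integrable lborel (\<lambda>t. (1 / t - 1 - \<eta> / t\<^sup>2) * indicator {\<eta>..1} t)"
      using h by (rule integrable.intros)
    fix t :: real
    show "(1 / t - 1 - \<eta> / t\<^sup>2) * indicator {\<eta>..1} t \<le> t powr (- (real 4 / 2)) * exp (- (\<eta> / t)) * (1 - exp (- t)) * indicator {0<..} t"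
    proof (cases "\<eta> \<le> t \<and> t \<le> 1")
      case True
      then have t: "t > 0" using assms by auto
      have p: "t powr (- 2) = 1 / (t * t)" using t by (simp add: powr_minus powr_numeral power2_eq_square field_simps)
      have "1 / t - 1 - \<eta> / t\<^sup>2 \<le> 1 / (t * t) * ((1 - \<eta> / t) * (t - t\<^sup>2))"
        using t assms by (simp add: field_simps power2_eq_square)
      also have "\<dots> \<le> 1 / (t * t) * (exp (- (\<eta> / t)) * (1 - exp (- t)))"
        using t True assms exp_ge_add_one_self[of "- (\<eta> / t)"] one_minus_exp_bounds[of t]
        by (intro mult_left_mono mult_mono) (auto simp: power2_eq_square mult_left_le)
      finally show ?thesis using True t p by simp
    next
      case False
      then show ?thesis using one_minus_exp_bounds(1)[of t] by (auto split: split_indicator)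
    qed
  qed
  moreover have "(LINT t|lborel. (1 / t - 1 - \<eta> / t\<^sup>2) * indicator {\<eta>..1} t) = ln (1 / \<eta>) - 2 + 2 * \<eta>"
    using has_bochner_integral_integral_eq[OF h] assms by (simp add: ln_div)
  ultimately show ?thesis using assms by linarith
qed

lemma gap_profile_4_antimono:
  assumes "0 < a" "a < 1" "a \<le> b"
  shows "gap_profile 4 b \<le> gap_profile 4 a"
proof -
  have *: "t powr (- (real 4 / 2)) * exp (- (b / t)) * (1 - exp (- t)) * indicator {0<..} t
     \<le> t powr (- (real 4 / 2)) * exp (- (a / t)) * (1 - exp (- t)) * indicator {0<..} t" for t :: real
    using assms one_minus_exp_bounds[of t] by (auto split: split_indicator intro!: mult_right_mono mult_left_mono divide_right_mono)
  have "integrable lborel (\<lambda>t. t powr (- (real 4 / 2)) * exp (- (b / t)) * (1 - exp (- t)) * indicator {0<..} t)"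
  proof (rule Bochner_Integration.integrable_bound[OF gap_profile_4_upper(2)[OF assms(1,2)]])
    show "AE t in lborel. norm (t powr (- (real 4 / 2)) * exp (- (b / t)) * (1 - exp (- t)) * indicator {0<..} t)
      \<le> norm (t powr (- (real 4 / 2)) * exp (- (a / t)) * (1 - exp (- t)) * indicator {0<..} t)"
    proof (rule AE_I2)
      fix t :: real
      show "norm (t powr (- (real 4 / 2)) * exp (- (b / t)) * (1 - exp (- t)) * indicator {0<..} t)
        \<le> norm (t powr (- (real 4 / 2)) * exp (- (a / t)) * (1 - exp (- t)) * indicator {0<..} t)"
        using *[of t] one_minus_exp_bounds(1)[of t] by (cases "t > 0") (simp_all add: abs_mult)
    qed
  qed simp
  then show ?thesis
    unfolding gap_profile_def using gap_profile_4_upper(2)[OF assms(1,2)] * by (rule integral_mono)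
qed

text \<open>
  The rate \<open>s / \<delta>(s)\<close>: at any fixed position other than the origin the gap between the two kernels is, to leading
  order as \<open>s\<close> tends to 0, the same multiple of it.
\<close>
definition gap_rate :: "nat \<Rightarrow> real \<Rightarrow> real" where
  "gap_rate n s = s / delta n s"

lemma gap_rate_3: "s > 0 \<Longrightarrow> gap_rate 3 s = s powr (1 / 2)"
  using powr_diff[of s 1 "1 / 2"] by (simp add: gap_rate_def delta_def)

lemma gap_rate_4: "gap_rate 4 s = s * ln (1 + 1 / s)"
  by (simp add: gap_rate_def delta_def)

lemma gap_rate_pos:
  assumes "s > 0" "n = 3 \<or> n = 4"
  shows "gap_rate n s > 0"
proof -
  have "ln (1 + 1 / s) > 0" using assms(1) by (intro ln_gt_zero) simp
  then show ?thesis using assms gap_rate_3[of s] gap_rate_4[of s] by auto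
qed

text \<open>
  In dimension three the profile is bounded.  In dimension four it is at most \<open>ln (1 / \<eta>) + 2\<close> at
  \<open>\<eta> = s |z|\<^sup>2 / 4\<close>; the part \<open>ln (1 / s)\<close> of the logarithm is the rate and the part \<open>2 ln (2 / |z|)\<close> is absorbed by
  \<open>1 / |z|\<close>.
\<close>
lemma resolvent_gap_le_rate:
  assumes "CARD('n::finite) = 3 \<or> CARD('n) = 4"
  obtains C where "C > 0" "\<And>(s::real) (z::real^'n). 0 < s \<Longrightarrow> s < 1 \<Longrightarrow> z \<noteq> 0 \<Longrightarrow> resolvent_gap s z \<le> C * gap_rate CARD('n) s * (1 + 1 / norm z)"
  using assms
proof
  assume n: "CARD('n) = 3"
  let ?C = "(4 * pi) powr (- (3 / 2)) * gap_profile 3 0"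
  show thesis
  proof (rule that)
    show C: "?C > 0" using gap_profile_3_pos by simp
    fix s :: real and z :: "real^'n" assume s: "0 < s" "s < 1" and z: "z \<noteq> 0"
    have "resolvent_gap s z \<le> s powr (1 / 2) * (4 * pi) powr (- (3 / 2)) * gap_profile 3 0"
      unfolding resolvent_gap_scaling[OF s(1)] n using s by (auto intro!: mult_left_mono gap_profile_3_le)
    also have "\<dots> = ?C * gap_rate CARD('n) s * 1" using s n gap_rate_3[of s] by simp
    also have "\<dots> \<le> ?C * gap_rate CARD('n) s * (1 + 1 / norm z)"
      using C gap_rate_pos[OF s(1), of "CARD('n)"] n by (intro mult_left_mono) auto
    finally show "resolvent_gap s z \<le> ?C * gap_rate CARD('n) s * (1 + 1 / norm z)" .
  qed
next
  assume n: "CARD('n) = 4"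
  let ?C = "(4 * pi) powr (- 2) * 16"
  show thesis
  proof (rule that)
    show C: "?C > 0" by simp
    fix s :: real and z :: "real^'n" assume s: "0 < s" "s < 1" and z: "z \<noteq> 0"
    define \<eta> where "\<eta> = s * (norm z)\<^sup>2 / 4"
    have \<eta>: "\<eta> > 0" using s z by (simp add: \<eta>_def)
    let ?l = "ln (1 + 1 / s)"
    have "ln 2 \<le> ?l" using s by (subst ln_le_cancel_iff) (auto simp: field_simps add_pos_pos)
    then have l: "1 / 2 \<le> ?l" using ln2_ge_two_thirds by linarith
    have "gap_profile 4 \<eta> \<le> 4 + ?l + 4 / norm z"
    proof (cases "\<eta> < 1")
      case True
      have "ln (1 / \<eta>) = ln (1 / s) + 2 * ln (2 / norm z)"
        using s z by (simp add: \<eta>_def ln_div ln_mult ln_realpow) (simp add: ln_realpow[of 2 2, simplified])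
      moreover have "ln (1 / s) \<le> ?l" using s by (subst ln_le_cancel_iff) (auto simp: add_pos_pos)
      moreover have "ln (2 / norm z) \<le> 2 / norm z" using z by (intro less_imp_le ln_less_self) auto
      ultimately show ?thesis using gap_profile_4_upper(1)[OF \<eta> True] by auto
    next
      case False
      have "gap_profile 4 \<eta> \<le> gap_profile 4 (1 / 2)" using False by (intro gap_profile_4_antimono) auto
      also have "\<dots> \<le> ln (1 / (1 / 2)) + 2" by (rule gap_profile_4_upper) auto
      also have "\<dots> \<le> 4" using ln_add_one_self_le_self[of "1 :: real"] by simp
      finally show ?thesis using l z by (simp add: add_increasing2)
    qed
    also have "\<dots> \<le> 16 * ?l * (1 + 1 / norm z)"
    proof -
      have "(1 / 2) * (1 / norm z) \<le> ?l * (1 / norm z)" using l by (intro mult_right_mono) auto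
      moreover have "16 * ?l * (1 + 1 / norm z) = 16 * ?l + 16 * (?l * (1 / norm z))" by (simp add: distrib_left)
      moreover have "4 / norm z = 8 * ((1 / 2) * (1 / norm z))" by simp
      moreover have "0 \<le> 1 / norm z" by simp
      ultimately show ?thesis using l by linarith
    qed
    finally have g: "gap_profile 4 \<eta> \<le> 16 * ?l * (1 + 1 / norm z)" .
    have "resolvent_gap s z = s * (4 * pi) powr (- 2) * gap_profile 4 \<eta>"
      using resolvent_gap_scaling[OF s(1), of z] s n by (simp add: \<eta>_def)
    also have "\<dots> \<le> s * (4 * pi) powr (- 2) * (16 * ?l * (1 + 1 / norm z))"
      using s by (intro mult_left_mono g) auto
    also have "\<dots> = ?C * gap_rate CARD('n) s * (1 + 1 / norm z)"
      by (simp add: n gap_rate_4)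
    finally show "resolvent_gap s z \<le> ?C * gap_rate CARD('n) s * (1 + 1 / norm z)" .
  qed
qed

lemma resolvent_gap_asymptotics:
  assumes "CARD('n::finite) = 3 \<or> CARD('n) = 4"
  obtains \<kappa> where "\<kappa> > 0"
    "\<And>(s::nat \<Rightarrow> real) (z::real^'n). s \<longlonglongrightarrow> 0 \<Longrightarrow> (\<And>i. 0 < s i) \<Longrightarrow> z \<noteq> 0 \<Longrightarrow> (\<lambda>i. resolvent_gap (s i) z / gap_rate CARD('n) (s i)) \<longlonglongrightarrow> \<kappa>"
  using assms
proof
  assume n: "CARD('n) = 3"
  let ?C = "(4 * pi) powr (- (3 / 2)) * gap_profile 3 0"
  show thesis
  proof (rule that)
    show C: "?C > 0" using gap_profile_3_pos by simp
    fix s :: "nat \<Rightarrow> real" and z :: "real^'n" assume s: "s \<longlonglongrightarrow> 0" "\<And>i. 0 < s i" and z: "z \<noteq> 0"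
    have "(\<lambda>i. s i * (norm z)\<^sup>2 / 4) \<longlonglongrightarrow> 0 * (norm z)\<^sup>2 / 4" by (intro tendsto_intros s) auto
    then have "(\<lambda>i. (4 * pi) powr (- (3 / 2)) * gap_profile 3 (s i * (norm z)\<^sup>2 / 4)) \<longlonglongrightarrow> ?C"
      using s(2) by (intro tendsto_mult tendsto_const gap_profile_3_tendsto) (auto intro!: mult_nonneg_nonneg less_imp_le[OF s(2)])
    moreover have "resolvent_gap (s i) z / gap_rate CARD('n) (s i) = (4 * pi) powr (- (3 / 2)) * gap_profile 3 (s i * (norm z)\<^sup>2 / 4)" for i
      using resolvent_gap_scaling[OF s(2), of i z] s(2)[of i] n gap_rate_3[OF s(2), of i] by simp
    ultimately show "(\<lambda>i. resolvent_gap (s i) z / gap_rate CARD('n) (s i)) \<longlonglongrightarrow> ?C" by simp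
  qed
next
  assume n: "CARD('n) = 4"
  let ?C = "(4 * pi) powr (- 2)"
  show thesis
  proof (rule that)
    show C: "?C > 0" by simp
    fix s :: "nat \<Rightarrow> real" and z :: "real^'n" assume s: "s \<longlonglongrightarrow> 0" "\<And>i. 0 < s i" and z: "z \<noteq> 0"
    define c where "c = (norm z)\<^sup>2 / 4"
    have c: "c > 0" using z by (simp add: c_def)
    have s': "filterlim s (at_right 0) sequentially"
      using s by (auto simp: filterlim_at less_imp_neq[OF s(2), symmetric])
    have up: "((\<lambda>s. (ln (1 / (s * c)) + 2) / ln (1 + 1 / s)) \<longlongrightarrow> 1) (at_right 0)"
      using c by real_asymp
    have lo: "((\<lambda>s. (ln (1 / (s * c)) - 2) / ln (1 + 1 / s)) \<longlongrightarrow> 1) (at_right 0)"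
      using c by real_asymp
    have "(\<lambda>i. s i * c) \<longlonglongrightarrow> 0 * c" by (intro tendsto_intros s)
    then have small: "eventually (\<lambda>i. s i * c < 1) sequentially"
      by (intro order_tendstoD(2)[where y = "0 * c"]) auto
    have l: "0 \<le> ln (1 + 1 / s i)" for i using s(2)[of i] by (intro ln_ge_zero) simp
    have "(\<lambda>i. gap_profile 4 (s i * c) / ln (1 + 1 / s i)) \<longlonglongrightarrow> 1"
    proof (rule tendsto_sandwich[OF _ _ filterlim_compose[OF lo s'] filterlim_compose[OF up s']])
      show "\<forall>\<^sub>F i in sequentially. (ln (1 / (s i * c)) - 2) / ln (1 + 1 / s i) \<le> gap_profile 4 (s i * c) / ln (1 + 1 / s i)"
        using small by eventually_elim (use gap_profile_4_lower s(2) c l in \<open>auto intro!: divide_right_mono\<close>)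
      show "\<forall>\<^sub>F i in sequentially. gap_profile 4 (s i * c) / ln (1 + 1 / s i) \<le> (ln (1 / (s i * c)) + 2) / ln (1 + 1 / s i)"
        using small by eventually_elim (use gap_profile_4_upper(1) s(2) c l in \<open>auto intro!: divide_right_mono\<close>)
    qed
    then have "(\<lambda>i. ?C * (gap_profile 4 (s i * c) / ln (1 + 1 / s i))) \<longlonglongrightarrow> ?C * 1"
      by (intro tendsto_mult tendsto_const)
    moreover have "resolvent_gap (s i) z / gap_rate CARD('n) (s i) = ?C * (gap_profile 4 (s i * c) / ln (1 + 1 / s i))" for i
      using resolvent_gap_scaling[OF s(2), of i z] s(2)[of i] n by (simp add: c_def gap_rate_4)
    ultimately show "(\<lambda>i. resolvent_gap (s i) z / gap_rate CARD('n) (s i)) \<longlonglongrightarrow> ?C" by simp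
  qed
qed

section \<open>Radial profiles of the ground state, the potential and the zero mode\<close>

definition bubble :: "nat \<Rightarrow> real \<Rightarrow> real" where
  "bubble n r = 1 + r\<^sup>2 / (real n * (real n - 2))"

definition V_profile :: "nat \<Rightarrow> real \<Rightarrow> real" where
  "V_profile n r = - ((real n + 2) / (real n - 2)) * bubble n r powr (- 2)"

definition zero_mode :: "nat \<Rightarrow> real \<Rightarrow> real" where
  "zero_mode n r = (real n - 2) / 2 * (2 * bubble n r powr (- (real n / 2)) - bubble n r powr (1 - real n / 2))"

definition zero_mode' :: "nat \<Rightarrow> real \<Rightarrow> real" where
  "zero_mode' n r = r / real n * ((real n / 2 - 1) * bubble n r powr (- (real n / 2)) - real n * bubble n r powr (- (real n / 2) - 1))"

lemma bubble_ge_1: "n \<ge> 3 \<Longrightarrow> 1 \<le> bubble n r"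
  by (simp add: bubble_def)

lemma bubble_pos [simp]: "n \<ge> 3 \<Longrightarrow> 0 < bubble n r"
  using bubble_ge_1[of n r] by simp

lemma bubble_deriv [derivative_intros]:
  "(bubble n has_real_derivative 2 * r / (real n * (real n - 2))) (at r)"
  unfolding bubble_def[abs_def]
  by (rule DERIV_cong[OF DERIV_add[OF DERIV_const DERIV_cdivide[OF DERIV_power[OF DERIV_ident, where n = 2]]]]) simp

lemma bubble_powr_deriv:
  assumes "n \<ge> 3"
  shows "((\<lambda>r. bubble n r powr p) has_real_derivative p * bubble n r powr (p - 1) * (2 * r / (real n * (real n - 2)))) (at r)"
  by (rule DERIV_cong, rule DERIV_fun_powr[OF bubble_deriv]) (use assms in auto)

lemma bubble_measurable [measurable]: "bubble n \<in> borel_measurable borel"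
  unfolding bubble_def by measurable

lemma V_profile_measurable [measurable]: "V_profile n \<in> borel_measurable borel"
  unfolding V_profile_def by measurable

lemma zero_mode_measurable [measurable]: "zero_mode n \<in> borel_measurable borel"
  unfolding zero_mode_def by measurable

lemma W_eq_bubble: "W (x :: real^'n) = bubble CARD('n) (norm x) powr (- (real CARD('n) - 2) / 2)"
  by (simp add: W_def bubble_def Let_def)

lemma V_eq_profile:
  assumes "CARD('n) \<ge> 3"
  shows "V (x :: real^'n) = V_profile CARD('n) (norm x)"
proof -
  have "- (real CARD('n) - 2) / 2 * (4 / (real CARD('n) - 2)) = - 2"
    using assms by (simp add: field_simps)
  then show ?thesis
    by (simp add: V_def V_profile_def W_eq_bubble Let_def powr_powr del: minus_diff_eq)
qed

lemma gradient_W: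
  fixes x :: "real^'n"
  assumes n: "CARD('n) \<ge> 3"
  shows "gradient W x = (- (1 / real CARD('n)) * bubble CARD('n) (norm x) powr (- (real CARD('n) / 2))) *\<^sub>R x"
proof -
  let ?n = "real CARD('n)" and ?b = "bubble CARD('n)"
  let ?D = "(- (1 / ?n) * ?b (norm x) powr (- (?n / 2))) *\<^sub>R x"
  have sq: "GDERIV (\<lambda>x::real^'n. 1 + (x \<bullet> x) / (?n * (?n - 2))) x :> (2 / (?n * (?n - 2))) *\<^sub>R x"
    unfolding gderiv_def
    by (rule has_derivative_eq_rhs, (rule derivative_intros)+) (use n in \<open>auto simp: inner_commute fun_eq_iff field_simps\<close>)
  have b: "?b (norm x) = 1 + (x \<bullet> x) / (?n * (?n - 2))" for x :: "real^'n"
    by (simp add: bubble_def power2_norm_eq_inner)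
  have pos: "0 < 1 + (x \<bullet> x) / (?n * (?n - 2))"
    using n b[of x] bubble_pos[of "CARD('n)" "norm x"] by simp
  have "GDERIV (\<lambda>x::real^'n. (1 + (x \<bullet> x) / (?n * (?n - 2))) powr (- (?n - 2) / 2)) x :>
     ((- (?n - 2) / 2) * (1 + (x \<bullet> x) / (?n * (?n - 2))) powr (- (?n - 2) / 2 - 1)) *\<^sub>R (2 / (?n * (?n - 2))) *\<^sub>R x"
    by (rule GDERIV_DERIV_compose[OF sq]) (rule has_real_derivative_powr[OF pos])
  moreover have "- (?n - 2) / 2 - 1 = - (?n / 2)" by (simp add: field_simps)
  moreover have "(- (?n - 2) / 2 * B) * (2 / (?n * (?n - 2))) = - (1 / ?n) * B" for B :: real
    using n by (auto simp: field_simps)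
  ultimately have "GDERIV W x :> ?D"
    unfolding W_eq_bubble[abs_def] b scaleR_scaleR by simp
  moreover have "D = ?D" if "GDERIV W x :> D" for D
  proof -
    have "(\<lambda>h. h \<bullet> D) = (\<lambda>h. h \<bullet> ?D)"
      using that \<open>GDERIV W x :> ?D\<close> unfolding gderiv_def by (rule has_derivative_unique)
    then show ?thesis by (metis inner_commute vector_eq_rdot)
  qed
  ultimately show ?thesis unfolding gradient_def by (rule the_equality)
qed

lemma LambdaW_eq_zero_mode:
  fixes x :: "real^'n"
  assumes n: "CARD('n) \<ge> 3"
  shows "LambdaW x = zero_mode CARD('n) (norm x)"
proof -
  let ?n = "real CARD('n)" and ?b = "bubble CARD('n) (norm x)"
  have b: "?b > 0" using n by simp
  have sq: "(norm x)\<^sup>2 = ?n * (?n - 2) * (?b - 1)"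
    using n by (simp add: bubble_def)
  have p: "?b powr (1 - ?n / 2) = ?b * ?b powr (- (?n / 2))"
    using b powr_add[of ?b 1 "- (?n / 2)"] by simp
  have e: "- (?n - 2) / 2 = 1 - ?n / 2" by (simp add: field_simps)
  have w: "W x = ?b * ?b powr (- (?n / 2))" unfolding W_eq_bubble e p ..
  have "LambdaW x = (?n - 2) / 2 * (?b * ?b powr (- (?n / 2))) - (1 / ?n) * ?b powr (- (?n / 2)) * (norm x)\<^sup>2"
    unfolding LambdaW_def w gradient_W[OF n] by (simp add: power2_norm_eq_inner)
  also have "\<dots> = zero_mode CARD('n) (norm x)"
    unfolding zero_mode_def p sq using n by (simp add: field_simps)
  finally show ?thesis .
qed

lemma zero_mode_deriv:
  assumes "n \<ge> 3"
  shows "(zero_mode n has_real_derivative zero_mode' n r) (at r)"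
proof -
  have p: "bubble n r powr (1 - real n / 2 - 1) = bubble n r powr (- (real n / 2))" by simp
  have alg: "(m - 2) / 2 * (2 * (- (m / 2) * X * (2 * r / (m * (m - 2)))) - (1 - m / 2) * Y * (2 * r / (m * (m - 2))))
    = r / m * ((m / 2 - 1) * Y - m * X)" if "m \<noteq> 0" "m \<noteq> 2" for m X Y :: real
  proof -
    define Q where "Q = 2 * r / (m * (m - 2))"
    have Q: "r / m = Q * ((m - 2) / 2)" using that by (simp add: Q_def)
    show ?thesis unfolding Q_def[symmetric] Q by (simp add: field_simps)
  qed
  have "(zero_mode n has_real_derivative (real n - 2) / 2 *
      (2 * (- (real n / 2) * bubble n r powr (- (real n / 2) - 1) * (2 * r / (real n * (real n - 2))))
       - (1 - real n / 2) * bubble n r powr (1 - real n / 2 - 1) * (2 * r / (real n * (real n - 2))))) (at r)"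
    unfolding zero_mode_def[abs_def] by (intro DERIV_cmult DERIV_diff bubble_powr_deriv assms)
  then show ?thesis
    by (rule DERIV_cong) (unfold p zero_mode'_def, rule alg, use assms in auto)
qed

text \<open>
  The radial form of \<open>\<Delta>\<Lambda>W = V \<Lambda>W\<close>.  Every term is a polynomial in \<open>b = bubble n r\<close> times \<open>P = b powr (- n / 2 - 2)\<close>,
  with \<open>r\<^sup>2 = n (n - 2) (b - 1)\<close>.
\<close>
lemma zero_mode'_deriv:
  assumes "n \<ge> 3"
  obtains z'' where "(zero_mode' n has_real_derivative z'') (at r)"
    "r * z'' + (real n - 1) * zero_mode' n r = r * V_profile n r * zero_mode n r"
proof
  let ?b = "bubble n r" and ?n = "real n"
  define P where "P = ?b powr (- (?n / 2) - 2)"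
  have b: "?b > 0" using assms by simp
  have p: "?b powr (- (?n / 2)) = ?b\<^sup>2 * P" "?b powr (- (?n / 2) - 1) = ?b * P" "?b powr (1 - ?n / 2) = ?b ^ 3 * P"
    "?b powr (- 2) * ?b\<^sup>2 = 1"
  proof -
    have e: "2 + (- (?n / 2) - 2) = - (?n / 2)" "1 + (- (?n / 2) - 2) = - (?n / 2) - 1" "3 + (- (?n / 2) - 2) = 1 - ?n / 2"
      by simp_all
    have "?b powr (- (?n / 2)) = ?b powr 2 * P" "?b powr (- (?n / 2) - 1) = ?b powr 1 * P" "?b powr (1 - ?n / 2) = ?b powr 3 * P"
      "?b powr (- 2) * ?b powr 2 = 1"
      using b unfolding P_def powr_add[symmetric] e by simp_all
    then show "?b powr (- (?n / 2)) = ?b\<^sup>2 * P" "?b powr (- (?n / 2) - 1) = ?b * P" "?b powr (1 - ?n / 2) = ?b ^ 3 * P"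
      "?b powr (- 2) * ?b\<^sup>2 = 1"
      using b by (simp_all add: powr_numeral)
  qed
  have sq: "r\<^sup>2 = ?n * (?n - 2) * (?b - 1)" using assms by (simp add: bubble_def)
  let ?G = "(?n / 2 - 1) * ?b powr (- (?n / 2)) - ?n * ?b powr (- (?n / 2) - 1)"
  let ?G' = "(?n / 2 - 1) * ((- (?n / 2)) * ?b powr (- (?n / 2) - 1) * (2 * r / (?n * (?n - 2)))) - ?n * ((- (?n / 2) - 1) * ?b powr (- (?n / 2) - 1 - 1) * (2 * r / (?n * (?n - 2))))"
  show "(zero_mode' n has_real_derivative 1 / ?n * ?G + r / ?n * ?G') (at r)"
    unfolding zero_mode'_def[abs_def]
    by (rule DERIV_cong[OF DERIV_mult[OF DERIV_cdivide[OF DERIV_ident] DERIV_diff[OF DERIV_cmult[OF bubble_powr_deriv[OF assms]] DERIV_cmult[OF bubble_powr_deriv[OF assms]]]]]) simp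
  have alg: "r * (A * ((- B) * Y * (2 * r / c)) - N * ((- B - 1) * Z * (2 * r / c))) = 2 * (r\<^sup>2 / c) * (N * (B + 1) * Z - B * A * Y)" for A B Y c N Z
    by (cases "c = 0") (simp_all add: field_simps power2_eq_square)
  have rG': "r * ?G' = 2 * (?b - 1) * P * (?n * (?n / 2 + 1) - ?n / 2 * (?n / 2 - 1) * ?b)"
  proof -
    have "r * ?G' = 2 * (r\<^sup>2 / (?n * (?n - 2))) * (?n * (?n / 2 + 1) * ?b powr (- (?n / 2) - 1 - 1) - ?n / 2 * (?n / 2 - 1) * ?b powr (- (?n / 2) - 1))"
      using alg[of "?n / 2 - 1" "?n / 2" "?b powr (- (?n / 2) - 1)" "?n * (?n - 2)" ?n "?b powr (- (?n / 2) - 1 - 1)"] by (simp only:)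
    also have "r\<^sup>2 / (?n * (?n - 2)) = ?b - 1" by (simp add: bubble_def)
    finally have h: "r * ?G' = 2 * (?b - 1) * (?n * (?n / 2 + 1) * ?b powr (- (?n / 2) - 1 - 1) - ?n / 2 * (?n / 2 - 1) * ?b powr (- (?n / 2) - 1))" .
    have pe: "?b powr (- (?n / 2) - 1 - 1) = P" unfolding P_def by (rule arg_cong[where f = "\<lambda>p. ?b powr p"]) simp
    show ?thesis unfolding h unfolding pe p(2) by (simp add: field_simps)
  qed
  have alg4: "r * (- ((N + 2) / (N - 2)) * u) * ((N - 2) / 2 * (2 * (b\<^sup>2 * Q) - b ^ 3 * Q)) = r * ((N + 2) / 2 * (b - 2) * (u * b\<^sup>2 * Q))"
    if "N \<noteq> 2" for N u b Q :: real
  proof -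
    define t where "t = N - 2"
    have N: "N = t + 2" "t \<noteq> 0" using that by (auto simp: t_def)
    show ?thesis unfolding N(1) using N(2) by (simp add: field_simps power2_eq_square power3_eq_cube)
  qed
  have alg2: "r * (1 / N * G + r / N * G') + (N - 1) * (r / N * G) = r / N * (N * G + r * G')" if "N \<noteq> 0" for N G G' :: real
    using that by (simp add: field_simps)
  have alg3: "N * ((N / 2 - 1) * (b\<^sup>2 * Q) - N * (b * Q)) + 2 * (b - 1) * Q * (N * (N / 2 + 1) - N / 2 * (N / 2 - 1) * b) = N * (N + 2) / 2 * (b - 2) * Q" for N b Q :: real
    by (simp add: field_simps power2_eq_square)
  have "r * (1 / ?n * ?G + r / ?n * ?G') + (?n - 1) * zero_mode' n r = r / ?n * (?n * ?G + r * ?G')"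
    unfolding zero_mode'_def by (rule alg2) (use assms in simp)
  also have "?n * ?G + r * ?G' = ?n * (?n + 2) / 2 * (?b - 2) * P"
    unfolding rG' unfolding p by (rule alg3)
  also have "r / ?n * \<dots> = r * ((?n + 2) / 2 * (?b - 2) * P)"
    using assms b by simp
  also have "\<dots> = r * ((?n + 2) / 2 * (?b - 2) * (?b powr (- 2) * ?b\<^sup>2 * P))" unfolding p by simp
  also have "\<dots> = r * V_profile n r * zero_mode n r"
    unfolding V_profile_def zero_mode_def p(1,3) by (rule alg4[symmetric]) (use assms in simp)
  finally show "r * (1 / ?n * ?G + r / ?n * ?G') + (?n - 1) * zero_mode' n r = r * V_profile n r * zero_mode n r" .
qed

text \<open>
  Both antiderivatives come from the radial equation: multiplied by \<open>r\<close> to the power \<open>n - 2\<close> it is the divergence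
  form, and as it stands it is a total derivative.
\<close>
lemma flux_deriv:
  assumes "n \<ge> 3"
  shows "((\<lambda>r. r ^ (n - 1) * zero_mode' n r) has_real_derivative r ^ (n - 1) * (V_profile n r * zero_mode n r)) (at r)"
    and "((\<lambda>r. r * zero_mode' n r + (real n - 2) * zero_mode n r) has_real_derivative r * (V_profile n r * zero_mode n r)) (at r)"
proof -
  obtain z'' where z: "(zero_mode' n has_real_derivative z'') (at r)"
    "r * z'' + (real n - 1) * zero_mode' n r = r * V_profile n r * zero_mode n r"
    using zero_mode'_deriv[OF assms] by blast
  have n: "r ^ (n - 1) = r ^ (n - 2) * r" "n - 1 - 1 = n - 2" "real (n - 1) = real n - 1"
    using assms by (auto simp: of_nat_diff power_Suc2[symmetric] Suc_diff_le numeral_2_eq_2 simp del: power_Suc) (simp add: Suc_diff_Suc)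
  have "((\<lambda>r. r ^ (n - 1) * zero_mode' n r) has_real_derivative real (n - 1) * r ^ (n - 1 - 1) * zero_mode' n r + z'' * r ^ (n - 1)) (at r)"
    by (rule DERIV_cong, (rule derivative_intros z)+) simp
  also have "real (n - 1) * r ^ (n - 1 - 1) * zero_mode' n r + z'' * r ^ (n - 1) = r ^ (n - 2) * (r * z'' + (real n - 1) * zero_mode' n r)"
    unfolding n by (simp add: algebra_simps)
  also have "\<dots> = r ^ (n - 1) * (V_profile n r * zero_mode n r)" unfolding z(2) n by (simp add: mult_ac)
  finally show "((\<lambda>r. r ^ (n - 1) * zero_mode' n r) has_real_derivative r ^ (n - 1) * (V_profile n r * zero_mode n r)) (at r)" .
  have "((\<lambda>r. r * zero_mode' n r + (real n - 2) * zero_mode n r) has_real_derivative (1 * zero_mode' n r + z'' * r) + (real n - 2) * zero_mode' n r) (at r)"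
    by (rule DERIV_cong, (rule derivative_intros z zero_mode_deriv[OF assms])+) simp
  also have "(1 * zero_mode' n r + z'' * r) + (real n - 2) * zero_mode' n r = r * z'' + (real n - 1) * zero_mode' n r"
    by (simp add: algebra_simps)
  also have "\<dots> = r * (V_profile n r * zero_mode n r)" unfolding z(2) by (simp add: mult_ac)
  finally show "((\<lambda>r. r * zero_mode' n r + (real n - 2) * zero_mode n r) has_real_derivative r * (V_profile n r * zero_mode n r)) (at r)" .
qed

lemma bubble_powr_le:
  assumes "n \<ge> 3" "p \<ge> 0"
  shows "bubble n r powr (- p) \<le> (real n * (real n - 2)) powr p * (max 1 \<bar>r\<bar>) powr (- (2 * p))"
proof -
  let ?k = "real n * (real n - 2)" and ?m = "max 1 \<bar>r\<bar>"
  have "1 * 1 \<le> ?k" using assms by (intro mult_mono) auto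
  then have k: "?k \<ge> 1" by simp
  have "?m\<^sup>2 / ?k \<le> bubble n r"
  proof (cases "\<bar>r\<bar> \<le> 1")
    case True
    then have "?m\<^sup>2 / ?k \<le> 1" using k by simp
    then show ?thesis using bubble_ge_1[OF assms(1), of r] by linarith
  next
    case False
    then show ?thesis by (simp add: bubble_def)
  qed
  moreover have "0 < ?m\<^sup>2 / ?k" using k by (intro divide_pos_pos) auto
  ultimately have "bubble n r powr (- p) \<le> (?m\<^sup>2 / ?k) powr (- p)"
    using assms by (intro powr_mono2') auto
  also have "\<dots> = ?k powr p * ?m powr (- (2 * p))"
  proof -
    have "?m\<^sup>2 = ?m powr 2" by simp
    then show ?thesis using k by (simp add: powr_divide powr_powr powr_minus field_simps del: powr_numeral)
  qed
  finally show ?thesis .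
qed

lemma V_profile_bound:
  assumes "n \<ge> 3"
  obtains C where "C > 0" "\<And>r. \<bar>V_profile n r\<bar> \<le> C * (max 1 \<bar>r\<bar>) powr (- 4)"
proof
  let ?k = "real n * (real n - 2)"
  let ?C = "(real n + 2) / (real n - 2) * ?k powr 2"
  show "?C > 0" using assms by (intro mult_pos_pos divide_pos_pos) auto
  fix r
  have "\<bar>V_profile n r\<bar> = (real n + 2) / (real n - 2) * bubble n r powr (- 2)"
    using assms by (simp add: V_profile_def abs_mult)
  also have "\<dots> \<le> (real n + 2) / (real n - 2) * (?k powr 2 * (max 1 \<bar>r\<bar>) powr (- (2 * 2)))"
    using assms by (intro mult_left_mono bubble_powr_le) auto
  finally show "\<bar>V_profile n r\<bar> \<le> ?C * (max 1 \<bar>r\<bar>) powr (- 4)" by (simp add: mult_ac)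
qed

lemma zero_mode_bound:
  assumes "n \<ge> 3"
  obtains C where "C > 0" "\<And>r. \<bar>zero_mode n r\<bar> \<le> C * (max 1 \<bar>r\<bar>) powr (- (real n - 2))"
proof
  let ?k = "real n * (real n - 2)"
  let ?C = "(real n - 2) / 2 * ?k powr (real n / 2 - 1)"
  show "?C > 0" using assms by (intro mult_pos_pos divide_pos_pos) auto
  fix r
  let ?b = "bubble n r"
  have b: "?b \<ge> 1" using bubble_ge_1[OF assms] .
  have p: "?b powr (1 - real n / 2) = ?b * ?b powr (- (real n / 2))"
    using b powr_add[of ?b 1 "- (real n / 2)"] by simp
  have "\<bar>zero_mode n r\<bar> = (real n - 2) / 2 * (\<bar>2 - ?b\<bar> * ?b powr (- (real n / 2)))"
    using assms unfolding zero_mode_def p by (simp add: abs_mult left_diff_distrib[symmetric])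
  also have "\<dots> \<le> (real n - 2) / 2 * (?b * ?b powr (- (real n / 2)))"
    using assms b by (intro mult_left_mono mult_right_mono) auto
  also have "\<dots> = (real n - 2) / 2 * ?b powr (- (real n / 2 - 1))" unfolding p[symmetric] by simp
  also have "\<dots> \<le> (real n - 2) / 2 * (?k powr (real n / 2 - 1) * (max 1 \<bar>r\<bar>) powr (- (2 * (real n / 2 - 1))))"
    using assms by (intro mult_left_mono bubble_powr_le) auto
  finally show "\<bar>zero_mode n r\<bar> \<le> ?C * (max 1 \<bar>r\<bar>) powr (- (real n - 2))" by (simp add: mult_ac right_diff_distrib)
qed

lemma zero_mode_at_0: "n \<ge> 3 \<Longrightarrow> zero_mode n 0 = (real n - 2) / 2"
  by (simp add: zero_mode_def bubble_def)

text \<open>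
  The flux of the gradient of \<open>\<Lambda>W\<close> through large spheres tends to a positive limit, as \<open>\<Lambda>W\<close> behaves like a negative
  multiple of \<open>r\<close> to the power \<open>2 - n\<close>.
\<close>
lemma flux_at_infinity:
  assumes "n = 3 \<or> n = 4"
  obtains L where "L > 0" "((\<lambda>r. r ^ (n - 1) * zero_mode' n r) \<longlongrightarrow> L) at_top"
    "((\<lambda>r. r * zero_mode' n r + (real n - 2) * zero_mode n r) \<longlongrightarrow> 0) at_top"
  using assms
proof
  assume n: "n = 3"
  have "((\<lambda>r. r ^ (n - 1) * zero_mode' n r) \<longlongrightarrow> (1 / 3) powr (- (3 / 2)) / 6) at_top"
    unfolding n zero_mode'_def bubble_def by simp real_asymp
  moreover have "((\<lambda>r. r * zero_mode' n r + (real n - 2) * zero_mode n r) \<longlongrightarrow> 0) at_top"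
    unfolding n zero_mode'_def zero_mode_def bubble_def by simp real_asymp
  ultimately show thesis by (intro that) auto
next
  assume n: "n = 4"
  have "((\<lambda>r. r ^ (n - 1) * zero_mode' n r) \<longlongrightarrow> (1 / 8) powr (- 2) / 4) at_top"
    unfolding n zero_mode'_def bubble_def by simp real_asymp
  moreover have "((\<lambda>r. r * zero_mode' n r + (real n - 2) * zero_mode n r) \<longlongrightarrow> 0) at_top"
    unfolding n zero_mode'_def zero_mode_def bubble_def by simp real_asymp
  ultimately show thesis by (intro that) auto
qed

section \<open>Radial integrals\<close>

lemma radial_integrable_iff:
  fixes g :: "real \<Rightarrow> real"
  assumes [measurable]: "g \<in> borel_measurable borel"
  shows "integrable lborel (\<lambda>x::real^'n. g (norm x)) \<longleftrightarrow>
    integrable lborel (\<lambda>r. real CARD('n) * unit_ball_vol CARD('n) * r ^ (CARD('n) - 1) * indicator {0..} r * g r)"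
proof -
  let ?w = "\<lambda>r. real CARD('n) * unit_ball_vol CARD('n) * r ^ (CARD('n) - 1) * indicator {0..} r"
  have w: "0 \<le> ?w r" for r by (simp split: split_indicator)
  have "integrable lborel (\<lambda>x::real^'n. g (norm x)) \<longleftrightarrow> integrable (distr lborel borel (norm :: real^'n \<Rightarrow> real)) g"
    by (subst integrable_distr_eq) auto
  also have "distr lborel borel (norm :: real^'n \<Rightarrow> real) = density lborel (\<lambda>r. ennreal (?w r))"
    unfolding distr_norm_lborel by (rule density_cong) (auto simp: ennreal_mult' ennreal_indicator split: split_indicator)
  also have "integrable \<dots> g \<longleftrightarrow> integrable lborel (\<lambda>r. ?w r * g r)"
    using w by (subst integrable_density) auto
  finally show ?thesis .
qed

lemma radial_integral:
  fixes g :: "real \<Rightarrow> real"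
  assumes [measurable]: "g \<in> borel_measurable borel"
  shows "(LINT x|lborel. g (norm (x::real^'n))) =
    (LINT r|lborel. real CARD('n) * unit_ball_vol CARD('n) * r ^ (CARD('n) - 1) * indicator {0..} r * g r)"
proof -
  let ?w = "\<lambda>r. real CARD('n) * unit_ball_vol CARD('n) * r ^ (CARD('n) - 1) * indicator {0..} r"
  have w: "0 \<le> ?w r" for r by (simp split: split_indicator)
  have "(LINT x|lborel. g (norm (x::real^'n))) = (LINT r|distr lborel borel (norm :: real^'n \<Rightarrow> real). g r)"
    by (subst integral_distr) auto
  also have "distr lborel borel (norm :: real^'n \<Rightarrow> real) = density lborel (\<lambda>r. ennreal (?w r))"
    unfolding distr_norm_lborel by (rule density_cong) (auto simp: ennreal_mult' ennreal_indicator split: split_indicator)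
  also have "integral\<^sup>L \<dots> g = (LINT r|lborel. ?w r * g r)"
    using w by (subst integral_density) auto
  finally show ?thesis .
qed

lemma integral_FTC_atLeast:
  fixes f F :: "real \<Rightarrow> real"
  assumes F: "\<And>x. a \<le> x \<Longrightarrow> (F has_real_derivative f x) (at x)"
    and cont: "\<And>x. a \<le> x \<Longrightarrow> isCont f x"
    and int: "integrable lborel (\<lambda>x. f x * indicator {a..} x)"
    and lim: "(F \<longlongrightarrow> T) at_top"
  shows "(LINT x|lborel. f x * indicator {a..} x) = T - F a"
proof -
  have "((\<lambda>b. LINT x|lborel. indicator {..b} x *\<^sub>R (f x * indicator {a..} x)) \<longlongrightarrow> (LINT x|lborel. f x * indicator {a..} x)) at_top"
    by (rule tendsto_integral_at_top[OF _ int]) simp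
  moreover have "eventually (\<lambda>b. (LINT x|lborel. indicator {..b} x *\<^sub>R (f x * indicator {a..} x)) = F b - F a) at_top"
    using eventually_ge_at_top[of a]
  proof eventually_elim
    case (elim b)
    have "(LINT x|lborel. indicator {..b} x *\<^sub>R (f x * indicator {a..} x)) = (LINT x|lborel. f x * indicator {a..b} x)"
      by (rule Bochner_Integration.integral_cong) (auto split: split_indicator)
    also have "\<dots> = F b - F a"
      using elim F cont by (intro integral_FTC_Icc_real) auto
    finally show ?case .
  qed
  ultimately have "((\<lambda>b. F b - F a) \<longlongrightarrow> (LINT x|lborel. f x * indicator {a..} x)) at_top"
    by (rule Lim_transform_eventually)
  moreover have "((\<lambda>b. F b - F a) \<longlongrightarrow> T - F a) at_top" by (intro tendsto_intros lim)
  ultimately show ?thesis by (intro tendsto_unique[of at_top]) auto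
qed

section \<open>The zero mode\<close>

lemma bubble_powr_isCont: "n \<ge> 3 \<Longrightarrow> isCont (\<lambda>r. bubble n r powr p) r"
  using DERIV_isCont[OF bubble_powr_deriv[of n p r]] by simp

lemma V_zero_mode_isCont:
  assumes n: "n \<ge> 3"
  shows "isCont (\<lambda>r. V_profile n r * zero_mode n r) r"
proof (rule isCont_mult)
  show "isCont (V_profile n) r"
    unfolding V_profile_def[abs_def] by (rule isCont_mult[OF continuous_const bubble_powr_isCont[OF n]])
  show "isCont (zero_mode n) r" by (rule DERIV_isCont[OF zero_mode_deriv[OF n]])
qed

lemma V_zero_mode_bound:
  assumes "n \<ge> 3"
  obtains C where "C > 0" "\<And>r. \<bar>V_profile n r * zero_mode n r\<bar> \<le> C * (max 1 \<bar>r\<bar>) powr (- (real n + 2))"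
proof -
  obtain A where A: "A > 0" "\<And>r. \<bar>V_profile n r\<bar> \<le> A * (max 1 \<bar>r\<bar>) powr (- 4)"
    using V_profile_bound[OF assms] by blast
  obtain B where B: "B > 0" "\<And>r. \<bar>zero_mode n r\<bar> \<le> B * (max 1 \<bar>r\<bar>) powr (- (real n - 2))"
    using zero_mode_bound[OF assms] by blast
  show thesis
  proof (rule that)
    show "A * B > 0" using A B by simp
    fix r
    have "\<bar>V_profile n r * zero_mode n r\<bar> \<le> (A * (max 1 \<bar>r\<bar>) powr (- 4)) * (B * (max 1 \<bar>r\<bar>) powr (- (real n - 2)))"
      unfolding abs_mult by (intro mult_mono A B) (use A in auto)
    also have "\<dots> = A * B * ((max 1 \<bar>r\<bar>) powr (- 4) * (max 1 \<bar>r\<bar>) powr (- (real n - 2)))"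
      by (simp add: mult_ac)
    also have "(max 1 \<bar>r\<bar>) powr (- 4) * (max 1 \<bar>r\<bar>) powr (- (real n - 2)) = (max 1 \<bar>r\<bar>) powr (- (real n + 2))"
      by (subst powr_add[symmetric]) (rule arg_cong[where f = "\<lambda>p. max 1 \<bar>r\<bar> powr p"], simp)
    finally show "\<bar>V_profile n r * zero_mode n r\<bar> \<le> A * B * (max 1 \<bar>r\<bar>) powr (- (real n + 2))" .
  qed
qed

lemma V_zero_mode_integrable:
  assumes "CARD('n) \<ge> 3"
  shows "integrable lborel (\<lambda>x::real^'n. V_profile CARD('n) (norm x) * zero_mode CARD('n) (norm x))"
proof -
  obtain C where C: "C > 0" "\<And>r. \<bar>V_profile CARD('n) r * zero_mode CARD('n) r\<bar> \<le> C * (max 1 \<bar>r\<bar>) powr (- (real CARD('n) + 2))"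
    using V_zero_mode_bound[OF assms] by blast
  show ?thesis
  proof (rule integrable_powr_bound[where C = C and \<alpha> = 0 and \<beta> = "real CARD('n) + 2"])
    fix y :: "real^'n"
    show "\<bar>V_profile CARD('n) (norm y) * zero_mode CARD('n) (norm y)\<bar> \<le> C * norm y powr (- 0)" if "0 < norm y" "norm y \<le> 1"
      using C(2)[of "norm y"] that by (simp add: max_def split: if_splits)
    show "\<bar>V_profile CARD('n) (norm y) * zero_mode CARD('n) (norm y)\<bar> \<le> C * norm y powr (- (real CARD('n) + 2))" if "1 \<le> norm y"
      using C(2)[of "norm y"] that by (simp add: max_absorb2)
  qed auto
qed

lemma V_zero_mode_tail_integrable:
  assumes "n \<ge> 3" "a \<ge> 0"
  shows "integrable lborel (\<lambda>r. r * (V_profile n r * zero_mode n r) * indicator {a..} r)"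
proof (rule integrableI_bounded)
  obtain C where C: "C > 0" "\<And>r. \<bar>V_profile n r * zero_mode n r\<bar> \<le> C * (max 1 \<bar>r\<bar>) powr (- (real n + 2))"
    using V_zero_mode_bound[OF assms(1)] by blast
  have "(\<integral>\<^sup>+r. ennreal (norm (r * (V_profile n r * zero_mode n r) * indicator {a..} r)) \<partial>lborel) \<le>
    (\<integral>\<^sup>+r. ennreal C * indicator {0..1} r + ennreal C * (ennreal (r powr (- 2)) * indicator {1..} r) \<partial>lborel)"
  proof (rule nn_integral_mono)
    fix r :: real
    show "ennreal (norm (r * (V_profile n r * zero_mode n r) * indicator {a..} r)) \<le> ennreal C * indicator {0..1} r + ennreal C * (ennreal (r powr (- 2)) * indicator {1..} r)"
    proof (cases "a \<le> r")
      case True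
      then have r: "r \<ge> 0" using assms by simp
      show ?thesis
      proof (cases "r \<le> 1")
        case True
        have "r * \<bar>V_profile n r * zero_mode n r\<bar> \<le> 1 * C"
          using C(2)[of r] True r by (intro mult_mono) (auto simp: max_def split: if_splits)
        then have "ennreal (norm (r * (V_profile n r * zero_mode n r) * indicator {a..} r)) \<le> ennreal C * indicator {0..1} r"
          using True r \<open>a \<le> r\<close> by (auto simp: abs_mult intro!: ennreal_leI)
        then show ?thesis by (rule order_trans) simp
      next
        case False
        have "\<bar>V_profile n r * zero_mode n r\<bar> \<le> C * r powr (- (real n + 2))"
          using C(2)[of r] False by (simp add: max_absorb2)
        also have "\<dots> \<le> C * r powr (- 3)"
          using False assms C(1) by (intro mult_left_mono powr_mono) auto
        finally have "r * \<bar>V_profile n r * zero_mode n r\<bar> \<le> r * (C * r powr (- 3))"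
          using r by (rule mult_left_mono)
        also have "\<dots> = C * (r powr 1 * r powr (- 3))" using r by simp
        also have "r powr 1 * r powr (- 3) = r powr (- 2)" by (subst powr_add[symmetric]) simp
        finally have "ennreal (norm (r * (V_profile n r * zero_mode n r) * indicator {a..} r)) \<le> ennreal C * (ennreal (r powr (- 2)) * indicator {1..} r)"
          using False r \<open>a \<le> r\<close> C(1) by (auto simp: abs_mult ennreal_mult'[symmetric] intro!: ennreal_leI)
        then show ?thesis by (rule order_trans) (simp add: add_increasing)
      qed
    qed simp
  qed
  also have "\<dots> = (\<integral>\<^sup>+(r::real). ennreal C * indicator {0..1} r \<partial>lborel) + (\<integral>\<^sup>+r. ennreal C * (ennreal (r powr (- 2)) * indicator {1..} r) \<partial>lborel)"
    by (rule nn_integral_add) auto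
  also have "\<dots> < \<infinity>"
    using nn_integral_powr_tail[of 1 2] by (simp add: nn_integral_cmult ennreal_mult_less_top)
  finally show "(\<integral>\<^sup>+r. ennreal (norm (r * (V_profile n r * zero_mode n r) * indicator {a..} r)) \<partial>lborel) < \<infinity>" .
qed measurable

text \<open>
  The zero mode is minus the Newton potential of \<open>V \<Lambda>W\<close>: after Newton's theorem the two halves of the
  radial integral are evaluated by the antiderivatives \<open>r\<^sup>d\<^sup>-\<^sup>1 \<partial>\<^sub>r\<Lambda>W\<close> and \<open>r \<partial>\<^sub>r\<Lambda>W + (d - 2) \<Lambda>W\<close>.
\<close>
lemma shell_potential_zero_mode:
  fixes x :: "real^'n"
  assumes d: "CARD('n) = 3 \<or> CARD('n) = 4"
  shows "(LINT y|lborel. shell_kernel x y * (V_profile CARD('n) (norm y) * zero_mode CARD('n) (norm y))) = - zero_mode CARD('n) (norm x)"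
proof -
  let ?n = "CARD('n)" and ?c = "real CARD('n) * unit_ball_vol CARD('n)" and ?R = "norm x"
  let ?F = "\<lambda>r. V_profile CARD('n) r * zero_mode CARD('n) r"
  have n: "?n \<ge> 3" using d by auto
  have u: "unit_ball_vol (real ?n) \<noteq> 0" using unit_ball_vol_pos[of "real ?n"] by linarith
  obtain L where L: "((\<lambda>r. r * zero_mode' ?n r + (real ?n - 2) * zero_mode ?n r) \<longlongrightarrow> 0) at_top"
    using flux_at_infinity[OF d] by blast
  have A: "has_bochner_integral lborel (\<lambda>r. r ^ (?n - 1) * ?F r * indicator {0..?R} r) (?R ^ (?n - 1) * zero_mode' ?n ?R - 0 ^ (?n - 1) * zero_mode' ?n 0)"
    by (rule has_bochner_integral_FTC_Icc_real[OF norm_ge_zero flux_deriv(1)[OF n] isCont_mult[OF _ V_zero_mode_isCont[OF n]]]) simp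
  have B: "has_bochner_integral lborel (\<lambda>r. r * ?F r * indicator {?R..} r) (0 - (?R * zero_mode' ?n ?R + (real ?n - 2) * zero_mode ?n ?R))"
    unfolding has_bochner_integral_iff
    by (rule conjI[OF V_zero_mode_tail_integrable[OF n norm_ge_zero]
          integral_FTC_atLeast[OF flux_deriv(2)[OF n] isCont_mult[OF _ V_zero_mode_isCont[OF n]] V_zero_mode_tail_integrable[OF n norm_ge_zero] L]]) simp
  have "(LINT y|lborel. shell_kernel x y * ?F (norm y)) =
    (LINT r|lborel. ?c * r ^ (?n - 1) * indicator {0..} r * ((max ?R r powr (2 - real ?n) / ((real ?n - 2) * ?c)) * ?F r))"
    unfolding shell_kernel_def by (rule radial_integral[where 'n = 'n and g = "\<lambda>r. (max ?R r powr (2 - real ?n) / ((real ?n - 2) * ?c)) * ?F r"]) measurable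
  also have "\<dots> = (LINT r|lborel. (?R powr (2 - real ?n) / (real ?n - 2)) * (r ^ (?n - 1) * ?F r * indicator {0..?R} r) + 1 / (real ?n - 2) * (r * ?F r * indicator {?R..} r))"
  proof (rule integral_cong_AE)
    show "AE r in lborel. ?c * r ^ (?n - 1) * indicator {0..} r * ((max ?R r powr (2 - real ?n) / ((real ?n - 2) * ?c)) * ?F r) =
      (?R powr (2 - real ?n) / (real ?n - 2)) * (r ^ (?n - 1) * ?F r * indicator {0..?R} r) + 1 / (real ?n - 2) * (r * ?F r * indicator {?R..} r)"
      using AE_lborel_singleton[of ?R]
    proof eventually_elim
      case (elim r)
      have *: "?c * r ^ (?n - 1) * ((max ?R r powr (2 - real ?n) / ((real ?n - 2) * ?c)) * ?F r) = r ^ (?n - 1) * max ?R r powr (2 - real ?n) / (real ?n - 2) * ?F r"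
        using u by simp
      consider "r < 0" | "0 \<le> r" "r < ?R" | "?R < r" using elim by linarith
      then show ?case
      proof cases
        case 1
        then have "\<not> ?R \<le> r" using norm_ge_zero[of x] by linarith
        then show ?thesis using 1 by simp
      next
        case 2
        then show ?thesis using * by (simp add: max_absorb1)
      next
        case 3
        then have r: "r > 0" using norm_ge_zero[of x] by linarith
        have "r ^ (?n - 1) = r powr (real ?n - 1)" using r n powr_realpow[of r "?n - 1"] by (simp add: of_nat_diff)
        then have "r ^ (?n - 1) * r powr (2 - real ?n) = r" using r by (simp add: powr_add[symmetric])
        then show ?thesis using * 3 r by (simp add: max_absorb2)
      qed
    qed
  qed measurable
  also have "\<dots> = (?R powr (2 - real ?n) / (real ?n - 2)) * (?R ^ (?n - 1) * zero_mode' ?n ?R) + 1 / (real ?n - 2) * (- (?R * zero_mode' ?n ?R + (real ?n - 2) * zero_mode ?n ?R))"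
  proof -
    have "integrable lborel (\<lambda>r. (?R powr (2 - real ?n) / (real ?n - 2)) * (r ^ (?n - 1) * ?F r * indicator {0..?R} r))"
      "integrable lborel (\<lambda>r. 1 / (real ?n - 2) * (r * ?F r * indicator {?R..} r))"
      using integrable.intros[OF A] integrable.intros[OF B] by (auto simp del: times_divide_eq_left)
    then show ?thesis
      using has_bochner_integral_integral_eq[OF A] has_bochner_integral_integral_eq[OF B] n
      by (simp add: zero_power del: times_divide_eq_left)
  qed
  also have "?R powr (2 - real ?n) / (real ?n - 2) * (?R ^ (?n - 1) * zero_mode' ?n ?R) = ?R * zero_mode' ?n ?R / (real ?n - 2)"
  proof (cases "?R = 0")
    case False
    then have r: "?R > 0" by simp
    have "?R ^ (?n - 1) = ?R powr (real ?n - 1)" using r n powr_realpow[of ?R "?n - 1"] by (simp add: of_nat_diff)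
    then have "?R powr (2 - real ?n) * ?R ^ (?n - 1) = ?R" using r by (simp add: powr_add[symmetric])
    then show ?thesis by (metis mult.assoc times_divide_eq_left)
  qed simp
  also have "?R * zero_mode' ?n ?R / (real ?n - 2) + 1 / (real ?n - 2) * (- (?R * zero_mode' ?n ?R + (real ?n - 2) * zero_mode ?n ?R)) = - zero_mode ?n ?R"
  proof -
    have "a / t + 1 / t * (- (a + t * z)) = - z" if "t \<noteq> 0" for a t z :: real
      using that by (simp add: field_simps)
    then show ?thesis using n by simp
  qed
  finally show ?thesis .
qed

lemma V_zero_mode_integral_pos:
  assumes d: "CARD('n) = 3 \<or> CARD('n) = 4"
  shows "(LINT y|lborel. V_profile CARD('n) (norm (y::real^'n)) * zero_mode CARD('n) (norm y)) > 0"
proof -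
  let ?n = "CARD('n)" and ?c = "real CARD('n) * unit_ball_vol CARD('n)"
  let ?F = "\<lambda>r. V_profile CARD('n) r * zero_mode CARD('n) r"
  have n: "?n \<ge> 3" using d by auto
  obtain L where L: "L > 0" "((\<lambda>r. r ^ (?n - 1) * zero_mode' ?n r) \<longlongrightarrow> L) at_top"
    using flux_at_infinity[OF d] by blast
  have eq: "(\<lambda>r. ?c * r ^ (?n - 1) * indicator {0..} r * ?F r) = (\<lambda>r. ?c * (r ^ (?n - 1) * ?F r) * indicator {0..} r)"
    by (simp add: fun_eq_iff mult_ac)
  have "integrable lborel (\<lambda>r. ?c * r ^ (?n - 1) * indicator {0..} r * ?F r)"
    using V_zero_mode_integrable[where 'n = 'n, OF n] by (subst (asm) radial_integrable_iff) simp_all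
  then have "(LINT r|lborel. ?c * (r ^ (?n - 1) * ?F r) * indicator {0..} r) = ?c * L - ?c * (0 ^ (?n - 1) * zero_mode' ?n 0)"
    unfolding eq
    by (rule integral_FTC_atLeast[OF DERIV_cmult[OF flux_deriv(1)[OF n]] isCont_mult[OF continuous_const isCont_mult[OF _ V_zero_mode_isCont[OF n]]]
          _ tendsto_mult[OF tendsto_const L(2)], rotated]) simp
  then have "(LINT y|lborel. ?F (norm (y::real^'n))) = ?c * L"
    using n by (subst radial_integral) (simp, unfold eq, simp add: zero_power)
  also have "\<dots> > 0" using L by simp
  finally show ?thesis .
qed

section \<open>A weight that makes the inner half of the Newton potential contractive\<close>

text \<open>
  The logarithmic derivative of the weight is proportional to \<open>r |V|\<close>.  The constant makes \<open>r |V| weight / (n - 2)\<close>, the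
  integrand of the inner Newton potential, exactly half the derivative of the weight.
\<close>
definition weight :: "nat \<Rightarrow> real \<Rightarrow> real" where
  "weight n r = exp (- (real n * (real n + 2) / (real n - 2) / bubble n r))"

lemma weight_measurable [measurable]: "weight n \<in> borel_measurable borel"
  unfolding weight_def by measurable

lemma weight_pos [simp]: "0 < weight n r" by (simp add: weight_def)

lemma weight_le_1: "n \<ge> 3 \<Longrightarrow> weight n r \<le> 1"
  by (simp add: weight_def less_imp_le)

lemma weight_ge: "n \<ge> 3 \<Longrightarrow> exp (- (real n * (real n + 2) / (real n - 2))) \<le> weight n r"
proof -
  assume n: "n \<ge> 3"
  have "real n * (real n + 2) / (real n - 2) / bubble n r \<le> real n * (real n + 2) / (real n - 2) / 1"
    using n bubble_ge_1[OF n, of r] by (intro divide_left_mono) auto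
  then show ?thesis by (simp add: weight_def)
qed

lemma weight_deriv:
  assumes n: "n \<ge> 3"
  shows "((\<lambda>r. weight n r / 2) has_real_derivative r * - V_profile n r * weight n r / (real n - 2)) (at r)"
proof -
  let ?m = "real n * (real n + 2) / (real n - 2)"
  have b: "bubble n r > 0" using n by simp
  have "((\<lambda>r. ?m / bubble n r) has_real_derivative - (?m * (2 * r / (real n * (real n - 2))) / (bubble n r * bubble n r))) (at r)"
    by (rule DERIV_cong[OF DERIV_divide[OF DERIV_const bubble_deriv]]) (use b in auto)
  then have "((\<lambda>r. exp (- (?m / bubble n r)) / 2) has_real_derivative exp (- (?m / bubble n r)) * - (- (?m * (2 * r / (real n * (real n - 2))) / (bubble n r * bubble n r))) / 2) (at r)"
    by (intro DERIV_cdivide DERIV_fun_exp DERIV_minus)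
  moreover have "exp (- (?m / bubble n r)) * - (- (?m * (2 * r / (real n * (real n - 2))) / (bubble n r * bubble n r))) / 2 = r * - V_profile n r * weight n r / (real n - 2)"
  proof -
    have "bubble n r powr (- 2) = 1 / (bubble n r * bubble n r)" using b by (simp add: powr_minus powr_numeral power2_eq_square field_simps)
    moreover have "?m * (2 * r / (real n * (real n - 2))) / 2 = r * ((real n + 2) / (real n - 2)) / (real n - 2)"
    proof -
      have "N * (N + 2) / t * (2 * r / (N * t)) / 2 = r * ((N + 2) / t) / t" if "N \<noteq> 0" "t \<noteq> 0" for N t :: real
        using that by (simp add: field_simps)
      then show ?thesis using n by simp
    qed
    moreover have "E * - (- (X / B)) / 2 = X / 2 * E / B" "r * c / t * E / B = r * - (- c * (1 / B)) * E / t" for E X B c t :: real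
      by (simp_all add: mult.commute)
    ultimately show ?thesis unfolding V_profile_def weight_def by (simp only:)
  qed
  ultimately show ?thesis unfolding weight_def by (rule DERIV_cong)
qed

lemma inner_potential_weight:
  assumes n: "CARD('n) \<ge> 3" and R: "R \<ge> 0"
  shows "(\<integral>\<^sup>+y. ennreal (shell_kernel 0 y * \<bar>V_profile CARD('n) (norm y)\<bar> * weight CARD('n) (norm y)) * indicator {..<R} (norm (y::real^'n)) \<partial>lborel)
     \<le> ennreal (weight CARD('n) R / 2)"
proof -
  let ?n = "CARD('n)" and ?c = "real CARD('n) * unit_ball_vol CARD('n)"
  have u: "unit_ball_vol (real ?n) \<noteq> 0" using unit_ball_vol_pos[of "real ?n"] by linarith
  let ?g = "\<lambda>r. ennreal (r powr (2 - real ?n) / ((real ?n - 2) * ?c) * \<bar>V_profile ?n r\<bar> * weight ?n r) * indicator {..<R} r"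
  have "(\<integral>\<^sup>+y. ennreal (shell_kernel 0 y * \<bar>V_profile ?n (norm y)\<bar> * weight ?n (norm y)) * indicator {..<R} (norm (y::real^'n)) \<partial>lborel)
     = (\<integral>\<^sup>+y. ?g (norm (y::real^'n)) \<partial>lborel)"
    by (simp add: shell_kernel_def max_absorb2)
  also have "\<dots> = (\<integral>\<^sup>+r. ennreal (?c * r ^ (?n - 1)) * indicator {0..} r * ?g r \<partial>lborel)"
    using nn_integral_radial[where 'a = "real^'n", of ?g] by simp
  also have "\<dots> \<le> (\<integral>\<^sup>+r. ennreal (r * - V_profile ?n r * weight ?n r / (real ?n - 2)) * indicator {0..R} r \<partial>lborel)"
  proof (rule nn_integral_mono)
    fix r :: real
    have neg: "\<bar>V_profile ?n r\<bar> = - V_profile ?n r" using n by (simp add: V_profile_def abs_mult)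
    show "ennreal (?c * r ^ (?n - 1)) * indicator {0..} r * ?g r \<le> ennreal (r * - V_profile ?n r * weight ?n r / (real ?n - 2)) * indicator {0..R} r"
    proof (cases "0 < r \<and> r < R")
      case True
      then have r: "r > 0" by simp
      have "r ^ (?n - 1) = r powr (real ?n - 1)" using r n powr_realpow[of r "?n - 1"] by (simp add: of_nat_diff)
      then have "r ^ (?n - 1) * r powr (2 - real ?n) = r" using r by (simp add: powr_add[symmetric])
      then have "?c * r ^ (?n - 1) * (r powr (2 - real ?n) / ((real ?n - 2) * ?c) * \<bar>V_profile ?n r\<bar> * weight ?n r) = r * - V_profile ?n r * weight ?n r / (real ?n - 2)"
        using u unfolding neg by simp
      then show ?thesis using True n by (simp add: ennreal_mult'[symmetric])
    next
      case False
      then show ?thesis using n by (cases "r = 0") (auto split: split_indicator simp: zero_power)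
    qed
  qed
  also have "\<dots> = ennreal (weight ?n R / 2 - weight ?n 0 / 2)"
  proof (rule nn_integral_FTC_Icc[OF _ weight_deriv[OF n]])
    show "0 \<le> r * - V_profile ?n r * weight ?n r / (real ?n - 2)" if "r \<in> {0..R}" for r
      using that n by (auto simp: V_profile_def less_imp_le)
  qed (use R in auto)
  also have "\<dots> \<le> ennreal (weight ?n R / 2)" by (intro ennreal_leI) (simp add: less_imp_le)
  finally show ?thesis .
qed

section \<open>The operator \<open>(-\<Delta> + s)\<^sup>-\<^sup>1 V\<close> on radial functions\<close>

text \<open>
  The potential part of \<open>one_plus_RV\<close>.  The value \<open>s = 0\<close> is allowed and gives the Newton potential of \<open>V f\<close>.
\<close>
definition RV :: "real \<Rightarrow> (real^'n \<Rightarrow> complex) \<Rightarrow> real^'n \<Rightarrow> complex" where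
  "RV s f = resolvent s (\<lambda>y. complex_of_real (V y) * f y)"

lemma one_plus_RV_eq: "one_plus_RV s f x = f x + RV s f x"
  by (simp add: one_plus_RV_def RV_def)

text \<open>
  The decay rate \<open>\<gamma>\<close> lies strictly between \<open>d / q\<close>, so that \<open>|x|\<close> to the power \<open>- \<gamma>\<close> is in \<open>L\<^sup>q\<close> at infinity, and the rate
  \<open>d - 2\<close> of the Newton kernel.
\<close>
locale critical_dimension =
  fixes dim :: "'n::finite itself" and q \<gamma> :: real
  assumes dim34: "CARD('n) = 3 \<or> CARD('n) = 4"
    and q_gt: "real CARD('n) / (real CARD('n) - 2) < q"
    and \<gamma>_gt: "real CARD('n) < \<gamma> * q" and \<gamma>_less: "\<gamma> < real CARD('n) - 2"
begin

lemma dim3: "CARD('n) \<ge> 3" using dim34 by auto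

lemma d34: "3 \<le> real CARD('n)" "real CARD('n) \<le> 4" using dim34 by auto

lemma q_gt_1: "q > 1" and d_less_2q: "real CARD('n) < 2 * q"
proof -
  have "1 \<le> real CARD('n) / (real CARD('n) - 2)" using d34 by (simp add: field_simps)
  then show "q > 1" using q_gt by simp
  have "real CARD('n) / 2 \<le> real CARD('n) / (real CARD('n) - 2)" using d34 by (intro divide_left_mono) auto
  then have "real CARD('n) / 2 < q" using q_gt by (rule le_less_trans)
  then show "real CARD('n) < 2 * q" by simp
qed

lemma \<gamma>_pos: "\<gamma> > 0"
proof -
  have "0 < \<gamma> * q" using \<gamma>_gt d34 by linarith
  then show ?thesis using q_gt_1 by (simp add: zero_less_mult_iff)
qed

text \<open>
  The decay of all functions in the range of the operator.
\<close>
definition decay :: "real^'n \<Rightarrow> real" where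
  "decay x = (max 1 (norm x)) powr (- \<gamma>)"

text \<open>
  A bound for \<open>|V|\<close> times the shell kernel once the decay in \<open>x\<close> is split off.  It is integrable and lies in the dual
  of \<open>L\<^sup>q\<close>, so bounded functions and elements of \<open>L\<^sup>q\<close> can be treated alike.
\<close>
definition Vwt :: "real^'n \<Rightarrow> real" where
  "Vwt y = (norm y powr (- (real CARD('n) - 2 - \<gamma>)) + norm y powr (2 - real CARD('n))) / ((real CARD('n) - 2) * (real CARD('n) * unit_ball_vol (real CARD('n)))) * \<bar>V y\<bar>"

lemma decay_measurable [measurable]: "decay \<in> borel_measurable borel"
  unfolding decay_def by measurable

lemma V_measurable [measurable]: "(V :: real^'n \<Rightarrow> real) \<in> borel_measurable borel"
proof -
  have "(\<lambda>y::real^'n. V_profile CARD('n) (norm y)) \<in> borel_measurable borel" by measurable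
  then show ?thesis unfolding V_eq_profile[OF dim3, symmetric] .
qed

lemma Vwt_measurable [measurable]: "Vwt \<in> borel_measurable borel"
  unfolding Vwt_def by measurable

lemma radial_V: "norm (x :: real^'n) = norm y \<Longrightarrow> V x = V (y :: real^'n)"
  by (simp add: V_eq_profile[OF dim3])

lemma decay_pos [simp]: "0 < decay x" by (simp add: decay_def)

lemma abs_decay [simp]: "\<bar>decay x\<bar> = decay x" by (simp add: less_imp_le)

lemma decay_le_1: "decay x \<le> 1"
  using \<gamma>_pos powr_mono2'[of "- \<gamma>" 1 "max 1 (norm x)"] by (simp add: decay_def)

lemma area_pos: "0 < (real CARD('n) - 2) * (real CARD('n) * unit_ball_vol (real CARD('n)))"
  using d34 unit_ball_vol_pos[of "real CARD('n)"] by simp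

lemma Vwt_nonneg [simp]: "0 \<le> Vwt y"
  using area_pos by (simp add: Vwt_def)

lemma V_bound:
  obtains C where "C > 0" "\<And>y::real^'n. \<bar>V y\<bar> \<le> C * (max 1 (norm y)) powr (- 4)"
  using V_profile_bound[OF dim3] V_eq_profile[OF dim3] by (metis abs_norm_cancel)

lemma V_antimono: "norm (x :: real^'n) \<le> norm y \<Longrightarrow> \<bar>V (y::real^'n)\<bar> \<le> \<bar>V x\<bar>"
proof -
  assume xy: "norm x \<le> norm y"
  have "bubble CARD('n) (norm x) \<le> bubble CARD('n) (norm y)"
    using d34 xy unfolding bubble_def by (intro add_left_mono divide_right_mono power_mono) auto
  then have "bubble CARD('n) (norm y) powr (- 2) \<le> bubble CARD('n) (norm x) powr (- 2)"
    using bubble_pos[OF dim3] by (intro powr_mono2') auto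
  then show ?thesis
    using d34 unfolding V_eq_profile[OF dim3] V_profile_def by (auto simp: abs_mult intro!: mult_left_mono divide_right_mono)
qed

text \<open>
  For \<open>norm x > 1\<close> the power \<open>2 - d\<close> of the maximum is split into the powers \<open>- \<gamma>\<close> and \<open>- (d - 2 - \<gamma>)\<close>; the first is
  estimated by \<open>x\<close>, the second by \<open>y\<close>.
\<close>
lemma shell_kernel_V_le:
  assumes "y \<noteq> 0"
  shows "shell_kernel x y * \<bar>V y\<bar> \<le> decay x * Vwt y"
proof -
  let ?m = "max (norm x) (norm y)"
  have y: "norm y > 0" using assms by simp
  have "?m powr (2 - real CARD('n)) \<le> decay x * (norm y powr (- (real CARD('n) - 2 - \<gamma>)) + norm y powr (2 - real CARD('n)))"
  proof (cases "norm x \<le> 1")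
    case True
    then have "decay x = 1" by (simp add: decay_def max_absorb1)
    moreover have "?m powr (2 - real CARD('n)) \<le> norm y powr (2 - real CARD('n))" using y d34 by (intro powr_mono2') auto
    ultimately show ?thesis by (simp add: add_increasing)
  next
    case False
    have "?m powr (2 - real CARD('n)) = ?m powr (- \<gamma>) * ?m powr (- (real CARD('n) - 2 - \<gamma>))"
      by (simp add: powr_add[symmetric])
    also have "\<dots> \<le> norm x powr (- \<gamma>) * norm y powr (- (real CARD('n) - 2 - \<gamma>))"
      using False y \<gamma>_pos \<gamma>_less by (intro mult_mono powr_mono2') auto
    also have "\<dots> \<le> decay x * (norm y powr (- (real CARD('n) - 2 - \<gamma>)) + norm y powr (2 - real CARD('n)))"
      using False by (simp add: decay_def max_absorb2 distrib_left)
    finally show ?thesis .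
  qed
  then have "?m powr (2 - real CARD('n)) / ((real CARD('n) - 2) * (real CARD('n) * unit_ball_vol (real CARD('n)))) * \<bar>V y\<bar> \<le>
     decay x * (norm y powr (- (real CARD('n) - 2 - \<gamma>)) + norm y powr (2 - real CARD('n))) / ((real CARD('n) - 2) * (real CARD('n) * unit_ball_vol (real CARD('n)))) * \<bar>V y\<bar>"
    using area_pos by (intro mult_right_mono divide_right_mono) auto
  then show ?thesis by (simp add: shell_kernel_def Vwt_def)
qed

lemma Vwt_bounds:
  obtains C where "C > 0" "\<And>y. 0 < norm y \<Longrightarrow> norm y \<le> 1 \<Longrightarrow> Vwt y \<le> C * norm y powr (- (real CARD('n) - 2))"
    "\<And>y. 1 \<le> norm y \<Longrightarrow> Vwt y \<le> C * norm y powr (- (real CARD('n) + 2 - \<gamma>))"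
proof -
  obtain A where A: "A > 0" "\<And>y::real^'n. \<bar>V y\<bar> \<le> A * (max 1 (norm y)) powr (- 4)" using V_bound by blast
  define c where "c = (real CARD('n) - 2) * (real CARD('n) * unit_ball_vol (real CARD('n)))"
  have c: "c > 0" using area_pos by (simp add: c_def)
  show thesis
  proof (rule that)
    show "2 / c * A > 0" using A c by simp
    fix y :: "real^'n"
    show "Vwt y \<le> 2 / c * A * norm y powr (- (real CARD('n) - 2))" if y: "0 < norm y" "norm y \<le> 1"
    proof -
      have "norm y powr (- (real CARD('n) - 2 - \<gamma>)) \<le> norm y powr (2 - real CARD('n))"
        using y \<gamma>_pos by (intro powr_mono') auto
      then have "(norm y powr (- (real CARD('n) - 2 - \<gamma>)) + norm y powr (2 - real CARD('n))) / c * \<bar>V y\<bar> \<le> (2 * norm y powr (2 - real CARD('n))) / c * A"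
        using A(2)[of y] y c A(1) by (intro mult_mono divide_right_mono) (auto simp: max_absorb1)
      then show ?thesis by (simp add: Vwt_def c_def mult_ac)
    qed
    show "Vwt y \<le> 2 / c * A * norm y powr (- (real CARD('n) + 2 - \<gamma>))" if y: "1 \<le> norm y"
    proof -
      have "norm y powr (2 - real CARD('n)) \<le> norm y powr (- (real CARD('n) - 2 - \<gamma>))"
        using y \<gamma>_pos by (intro powr_mono) auto
      then have "(norm y powr (- (real CARD('n) - 2 - \<gamma>)) + norm y powr (2 - real CARD('n))) / c * \<bar>V y\<bar> \<le> (2 * norm y powr (- (real CARD('n) - 2 - \<gamma>))) / c * (A * norm y powr (- 4))"
        using A(2)[of y] y c A(1) by (intro mult_mono divide_right_mono) (auto simp: max_absorb2)
      also have "\<dots> = 2 / c * A * (norm y powr (- (real CARD('n) - 2 - \<gamma>)) * norm y powr (- 4))" by simp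
      also have "norm y powr (- (real CARD('n) - 2 - \<gamma>)) * norm y powr (- 4) = norm y powr (- (real CARD('n) + 2 - \<gamma>))"
        by (subst powr_add[symmetric]) (rule arg_cong[where f = "\<lambda>p. norm y powr p"], simp)
      finally show ?thesis by (simp add: Vwt_def c_def mult_ac)
    qed
  qed
qed

lemma Vwt_integrable: "integrable lborel Vwt"
proof -
  obtain C where C: "C > 0" "\<And>y. 0 < norm y \<Longrightarrow> norm y \<le> 1 \<Longrightarrow> Vwt y \<le> C * norm y powr (- (real CARD('n) - 2))"
    "\<And>y. 1 \<le> norm y \<Longrightarrow> Vwt y \<le> C * norm y powr (- (real CARD('n) + 2 - \<gamma>))"
    using Vwt_bounds by blast
  show ?thesis
    by (rule integrable_powr_bound[where C = C and \<alpha> = "real CARD('n) - 2" and \<beta> = "real CARD('n) + 2 - \<gamma>"])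
       (use C d34 \<gamma>_less in auto)
qed

lemma Vwt_powr_integrable: "integrable lborel (\<lambda>y. Vwt y powr (q / (q - 1)))"
proof -
  obtain C where C: "C > 0" "\<And>y. 0 < norm y \<Longrightarrow> norm y \<le> 1 \<Longrightarrow> Vwt y \<le> C * norm y powr (- (real CARD('n) - 2))"
    "\<And>y. 1 \<le> norm y \<Longrightarrow> Vwt y \<le> C * norm y powr (- (real CARD('n) + 2 - \<gamma>))"
    using Vwt_bounds by blast
  let ?p = "q / (q - 1)"
  have p: "?p > 1" using q_gt_1 by (simp add: field_simps)
  have *: "Vwt y powr ?p \<le> C powr ?p * norm y powr (- (a * ?p))" if "Vwt y \<le> C * norm y powr (- a)" for y a
  proof -
    have "Vwt y powr ?p \<le> (C * norm y powr (- a)) powr ?p"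
      using that p by (intro powr_mono2) auto
    then show ?thesis using C(1) by (simp add: powr_mult powr_powr)
  qed
  show ?thesis
  proof (rule integrable_powr_bound[where C = "C powr ?p" and \<alpha> = "(real CARD('n) - 2) * ?p" and \<beta> = "(real CARD('n) + 2 - \<gamma>) * ?p"])
    show "(real CARD('n) - 2) * ?p < real CARD('n)"
      using d_less_2q q_gt_1 by (simp add: field_simps)
    have a: "real CARD('n) \<le> (real CARD('n) + 2 - \<gamma>) * 1" using d34 \<gamma>_less by simp
    have "(real CARD('n) + 2 - \<gamma>) * 1 < (real CARD('n) + 2 - \<gamma>) * ?p" using p d34 \<gamma>_less by (intro mult_strict_left_mono) auto
    then show "real CARD('n) < (real CARD('n) + 2 - \<gamma>) * ?p" by (rule le_less_trans[OF a])
  qed (use * C in auto)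
qed

lemma V_powr_integrable: "integrable lborel (\<lambda>y::real^'n. \<bar>V y\<bar> powr (q / (q - 1)))"
proof -
  obtain A where A: "A > 0" "\<And>y::real^'n. \<bar>V y\<bar> \<le> A * (max 1 (norm y)) powr (- 4)" using V_bound by blast
  let ?p = "q / (q - 1)"
  have p: "?p > 1" using q_gt_1 by (simp add: field_simps)
  have *: "\<bar>V y\<bar> powr ?p \<le> A powr ?p * (max 1 (norm y)) powr (- (4 * ?p))" for y :: "real^'n"
  proof -
    have "\<bar>V y\<bar> powr ?p \<le> (A * (max 1 (norm y)) powr (- 4)) powr ?p"
      using A p by (intro powr_mono2) auto
    then show ?thesis using A(1) by (simp add: powr_mult powr_powr)
  qed
  show ?thesis
  proof (rule integrable_powr_bound[where C = "A powr ?p" and \<alpha> = 0 and \<beta> = "4 * ?p"])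
    show "real CARD('n) < 4 * ?p" using p d34 by simp
    show "\<bar>\<bar>V y\<bar> powr ?p\<bar> \<le> A powr ?p * norm y powr (- 0)" if "0 < norm y" "norm y \<le> 1" for y :: "real^'n"
      using *[of y] that by (simp add: max_absorb1)
    show "\<bar>\<bar>V y\<bar> powr ?p\<bar> \<le> A powr ?p * norm y powr (- (4 * ?p))" if "1 \<le> norm y" for y :: "real^'n"
      using *[of y] that by (simp add: max_absorb2)
  qed (use d34 in auto)
qed

lemma V_decay_integrable: "integrable lborel (\<lambda>y::real^'n. \<bar>V y\<bar> * decay y)"
proof -
  obtain A where A: "A > 0" "\<And>y::real^'n. \<bar>V y\<bar> \<le> A * (max 1 (norm y)) powr (- 4)" using V_bound by blast
  have *: "\<bar>V y\<bar> * decay y \<le> A * (max 1 (norm y)) powr (- (4 + \<gamma>))" for y :: "real^'n"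
  proof -
    have "\<bar>V y\<bar> * decay y \<le> (A * (max 1 (norm y)) powr (- 4)) * decay y"
      using A(2)[of y] less_imp_le[OF decay_pos[of y]] by (intro mult_right_mono) auto
    also have "\<dots> = A * ((max 1 (norm y)) powr (- 4) * (max 1 (norm y)) powr (- \<gamma>))" by (simp add: decay_def)
    also have "(max 1 (norm y)) powr (- 4) * (max 1 (norm y)) powr (- \<gamma>) = (max 1 (norm y)) powr (- (4 + \<gamma>))"
      by (subst powr_add[symmetric]) simp
    finally show ?thesis .
  qed
  show ?thesis
  proof (rule integrable_powr_bound[where C = A and \<alpha> = 0 and \<beta> = "4 + \<gamma>"])
    show "\<bar>\<bar>V y\<bar> * decay y\<bar> \<le> A * norm y powr (- 0)" if "0 < norm y" "norm y \<le> 1" for y :: "real^'n"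
      using *[of y] that decay_pos[of y] by (simp add: max_absorb1 abs_mult)
    show "\<bar>\<bar>V y\<bar> * decay y\<bar> \<le> A * norm y powr (- (4 + \<gamma>))" if "1 \<le> norm y" for y :: "real^'n"
      using *[of y] that decay_pos[of y] by (simp add: max_absorb2 abs_mult)
  qed (use d34 \<gamma>_pos in auto)
qed

lemma decay_powr_integrable: "integrable lborel (\<lambda>y. decay y powr q)"
proof (rule integrable_powr_bound[where C = 1 and \<alpha> = 0 and \<beta> = "\<gamma> * q"])
  show "\<bar>decay y powr q\<bar> \<le> 1 * norm y powr (- 0)" if "0 < norm y" "norm y \<le> 1" for y
    using that by (simp add: decay_def max_absorb1)
  show "\<bar>decay y powr q\<bar> \<le> 1 * norm y powr (- (\<gamma> * q))" if "1 \<le> norm y" for y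
    using that by (simp add: decay_def max_absorb2 powr_powr)
qed (use d34 \<gamma>_gt in auto)

section \<open>Admissible functions\<close>

text \<open>
  The functions whose product with \<open>V\<close> has a Newton potential controlled by \<open>decay\<close>.
\<close>
definition admissible :: "(real^'n \<Rightarrow> complex) set" where
  "admissible = {f. f \<in> borel_measurable borel \<and> radial_fun f \<and> integrable lborel (\<lambda>y. Vwt y * norm (f y))}"

lemma admissibleD:
  assumes "f \<in> admissible"
  shows "f \<in> borel_measurable borel" "radial_fun f" "integrable lborel (\<lambda>y. Vwt y * norm (f y))"
  using assms by (auto simp: admissible_def)

lemma newton_V_le:
  assumes f: "f \<in> admissible"
  shows "(\<integral>\<^sup>+y. ennreal (resolvent_kernel 0 (x - y)) * ennreal (\<bar>V y\<bar> * norm (f y)) \<partial>lborel) \<le> ennreal (decay x * (LINT y|lborel. Vwt y * norm (f y)))"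
proof -
  note [measurable] = admissibleD(1)[OF f]
  have "radial_fun (\<lambda>y. ennreal (\<bar>V y\<bar> * norm (f y)))"
    unfolding radial_fun_def using radial_V radial_funD[OF admissibleD(2)[OF f]] by metis
  then have "(\<integral>\<^sup>+y. ennreal (resolvent_kernel 0 (x - y)) * ennreal (\<bar>V y\<bar> * norm (f y)) \<partial>lborel) = (\<integral>\<^sup>+y. ennreal (shell_kernel x y) * ennreal (\<bar>V y\<bar> * norm (f y)) \<partial>lborel)"
    by (intro newton_shell_nn dim3) simp_all
  also have "\<dots> \<le> (\<integral>\<^sup>+y. ennreal (decay x * (Vwt y * norm (f y))) \<partial>lborel)"
  proof (rule nn_integral_mono_AE, rule eventually_mono[OF AE_lborel_singleton[of 0]])
    fix y :: "real^'n" assume "y \<noteq> 0"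
    then have "shell_kernel x y * \<bar>V y\<bar> * norm (f y) \<le> decay x * Vwt y * norm (f y)"
      by (intro mult_right_mono shell_kernel_V_le) auto
    then show "ennreal (shell_kernel x y) * ennreal (\<bar>V y\<bar> * norm (f y)) \<le> ennreal (decay x * (Vwt y * norm (f y)))"
      using shell_kernel_nonneg[OF dim3, of x y] by (simp add: ennreal_mult'[symmetric] mult.assoc ennreal_leI)
  qed
  also have "\<dots> = ennreal (LINT y|lborel. decay x * (Vwt y * norm (f y)))"
    using admissibleD(3)[OF f] by (intro nn_integral_eq_integral) (auto simp: less_imp_le)
  finally show ?thesis by simp
qed

text \<open>
  The resolvent kernel is below the Newton kernel, and for the latter Newton's theorem replaces the kernel by the
  shell kernel.
\<close>
lemma RV_integrable_and_bound:
  assumes f: "f \<in> admissible" and s: "s \<ge> 0"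
  shows "integrable lborel (\<lambda>y. complex_of_real (resolvent_kernel s (x - y)) * (complex_of_real (V y) * f y))"
    and "norm (RV s f x) \<le> decay x * (LINT y|lborel. Vwt y * norm (f y))"
    and "(LINT y|lborel. norm (complex_of_real (resolvent_kernel s (x - y)) * (complex_of_real (V y) * f y)))
       \<le> decay x * (LINT y|lborel. Vwt y * norm (f y))"
proof -
  note [measurable] = admissibleD(1)[OF f]
  let ?g = "\<lambda>y. complex_of_real (resolvent_kernel s (x - y)) * (complex_of_real (V y) * f y)"
  let ?B = "decay x * (LINT y|lborel. Vwt y * norm (f y))"
  have B: "0 \<le> ?B" by (intro mult_nonneg_nonneg Bochner_Integration.integral_nonneg) (auto simp: less_imp_le)
  have "(\<integral>\<^sup>+y. ennreal (norm (?g y)) \<partial>lborel) \<le> (\<integral>\<^sup>+y. ennreal (resolvent_kernel 0 (x - y)) * ennreal (\<bar>V y\<bar> * norm (f y)) \<partial>lborel)"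
  proof (rule nn_integral_mono_AE, rule eventually_mono[OF AE_lborel_singleton[of x]])
    fix y assume "y \<noteq> x"
    then have "resolvent_kernel s (x - y) \<le> resolvent_kernel 0 (x - y)" by (intro resolvent_kernel_le dim3 s) auto
    then have "resolvent_kernel s (x - y) * (\<bar>V y\<bar> * norm (f y)) \<le> resolvent_kernel 0 (x - y) * (\<bar>V y\<bar> * norm (f y))"
      by (intro mult_right_mono) auto
    then show "ennreal (norm (?g y)) \<le> ennreal (resolvent_kernel 0 (x - y)) * ennreal (\<bar>V y\<bar> * norm (f y))"
      using resolvent_kernel_nonneg[of s "x - y"] resolvent_kernel_nonneg[of 0 "x - y"]
      by (simp add: norm_mult ennreal_mult'[symmetric] ennreal_leI)
  qed
  also note newton_V_le[OF f]
  finally have *: "(\<integral>\<^sup>+y. ennreal (norm (?g y)) \<partial>lborel) \<le> ennreal ?B" .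
  show int: "integrable lborel ?g"
    by (rule integrableI_bounded) (use * in \<open>auto intro: le_less_trans\<close>)
  have "ennreal (norm (RV s f x)) \<le> (\<integral>\<^sup>+y. ennreal (norm (?g y)) \<partial>lborel)"
    unfolding RV_def resolvent_def by (rule integral_norm_bound_ennreal[OF int])
  also note *
  finally show "norm (RV s f x) \<le> ?B" using B by (simp add: ennreal_le_iff)
  have "ennreal (LINT y|lborel. norm (?g y)) \<le> ennreal ?B"
    using * nn_integral_eq_integral[OF integrable_norm[OF int]] by simp
  then show "(LINT y|lborel. norm (?g y)) \<le> ?B" using B by (simp only: ennreal_le_iff)
qed

lemma RV_measurable [measurable]:
  fixes f :: "real^'n \<Rightarrow> complex"
  assumes [measurable]: "f \<in> borel_measurable borel"
  shows "RV s f \<in> borel_measurable borel"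
  unfolding RV_def by (rule resolvent_measurable) measurable

lemma RV_radial:
  fixes f :: "real^'n \<Rightarrow> complex"
  assumes [measurable]: "f \<in> borel_measurable borel" and "radial_fun f" "s \<ge> 0"
  shows "radial_fun (RV s f)"
  unfolding RV_def
proof (rule resolvent_radial[OF dim3 assms(3)])
  show "radial_fun (\<lambda>y. complex_of_real (V y) * f y)"
    unfolding radial_fun_def using radial_V radial_funD[OF assms(2)] by metis
qed measurable

lemma RV_add:
  assumes "f \<in> admissible" "g \<in> admissible" "s \<ge> 0"
  shows "RV s (\<lambda>y. f y + g y) x = RV s f x + RV s g x"
  using RV_integrable_and_bound(1)[OF assms(1,3)] RV_integrable_and_bound(1)[OF assms(2,3)]
  by (simp add: RV_def resolvent_def distrib_left)

lemma RV_diff: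
  assumes "f \<in> admissible" "g \<in> admissible" "s \<ge> 0"
  shows "RV s (\<lambda>y. f y - g y) x = RV s f x - RV s g x"
  using RV_integrable_and_bound(1)[OF assms(1,3)] RV_integrable_and_bound(1)[OF assms(2,3)]
  by (simp add: RV_def resolvent_def right_diff_distrib)

lemma RV_cmult: "RV s (\<lambda>y. c * f y) x = c * RV s f x"
proof -
  have "(\<lambda>y. complex_of_real (resolvent_kernel s (x - y)) * (complex_of_real (V y) * (c * f y))) =
    (\<lambda>y. c * (complex_of_real (resolvent_kernel s (x - y)) * (complex_of_real (V y) * f y)))"
    by (simp add: mult_ac)
  then show ?thesis by (simp add: RV_def resolvent_def)
qed

text \<open>
  Pointwise limits stay measurable and radial, so this space is complete for the supremum norm.
\<close>
definition bounded_radial :: "(real^'n \<Rightarrow> complex) set" where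
  "bounded_radial = {f. f \<in> borel_measurable borel \<and> radial_fun f \<and> (\<exists>M. \<forall>x. norm (f x) \<le> M)}"

lemma bounded_radialI:
  "f \<in> borel_measurable borel \<Longrightarrow> radial_fun f \<Longrightarrow> (\<And>x. norm (f x) \<le> M) \<Longrightarrow> f \<in> bounded_radial"
  by (auto simp: bounded_radial_def)

lemma bounded_radial_Vwt_le:
  assumes [measurable]: "f \<in> borel_measurable borel" and M: "\<And>x. norm (f x) \<le> M"
  shows "integrable lborel (\<lambda>y. Vwt y * norm (f y))" "(LINT y|lborel. Vwt y * norm (f y)) \<le> (LINT y|lborel. Vwt y) * M"
proof -
  have int: "integrable lborel (\<lambda>y. Vwt y * M)" using Vwt_integrable by simp
  have le: "Vwt y * norm (f y) \<le> Vwt y * M" for y by (intro mult_left_mono M) simp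
  show *: "integrable lborel (\<lambda>y. Vwt y * norm (f y))"
    by (rule Bochner_Integration.integrable_bound[OF int]) (auto intro!: AE_I2 mult_left_mono order_trans[OF M abs_ge_self] simp: abs_mult)
  have "(LINT y|lborel. Vwt y * norm (f y)) \<le> (LINT y|lborel. Vwt y * M)"
    using * int le by (rule integral_mono)
  then show "(LINT y|lborel. Vwt y * norm (f y)) \<le> (LINT y|lborel. Vwt y) * M" by simp
qed

lemma bounded_radial_admissible: "f \<in> bounded_radial \<Longrightarrow> f \<in> admissible"
  using bounded_radial_Vwt_le(1) unfolding bounded_radial_def admissible_def by blast

lemma RV_bounded_radial:
  assumes f: "f \<in> admissible" and s: "s \<ge> 0"
  shows "RV s f \<in> bounded_radial"
proof (rule bounded_radialI)
  show "norm (RV s f x) \<le> (LINT y|lborel. Vwt y * norm (f y))" for x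
  proof -
    have "0 \<le> (LINT y|lborel. Vwt y * norm (f y))" by (intro Bochner_Integration.integral_nonneg) auto
    then have "decay x * (LINT y|lborel. Vwt y * norm (f y)) \<le> 1 * (LINT y|lborel. Vwt y * norm (f y))"
      by (intro mult_right_mono decay_le_1)
    then show ?thesis using RV_integrable_and_bound(2)[OF f s, of x] by simp
  qed
qed (use admissibleD[OF f] RV_radial s in auto)

lemma radial_fun_add: "radial_fun f \<Longrightarrow> radial_fun g \<Longrightarrow> radial_fun (\<lambda>x. f x + g x :: complex)"
  and radial_fun_diff: "radial_fun f \<Longrightarrow> radial_fun g \<Longrightarrow> radial_fun (\<lambda>x. f x - g x :: complex)"
  and radial_fun_cmult: "radial_fun f \<Longrightarrow> radial_fun (\<lambda>x. c * f x :: complex)"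
  and radial_fun_const: "radial_fun (\<lambda>x. c :: complex)"
  unfolding radial_fun_def by metis+

lemma bounded_radial_add: "f \<in> bounded_radial \<Longrightarrow> g \<in> bounded_radial \<Longrightarrow> (\<lambda>x. f x + g x) \<in> bounded_radial"
  and bounded_radial_diff: "f \<in> bounded_radial \<Longrightarrow> g \<in> bounded_radial \<Longrightarrow> (\<lambda>x. f x - g x) \<in> bounded_radial"
proof -
  assume "f \<in> bounded_radial" "g \<in> bounded_radial"
  then obtain M N where f: "f \<in> borel_measurable borel" "radial_fun f" "\<And>x. norm (f x) \<le> M"
    and g: "g \<in> borel_measurable borel" "radial_fun g" "\<And>x. norm (g x) \<le> N"
    unfolding bounded_radial_def by blast
  show "(\<lambda>x. f x + g x) \<in> bounded_radial"
    by (rule bounded_radialI[where M = "M + N"]) (use f g in \<open>auto intro: radial_fun_add norm_triangle_mono\<close>)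
  show "(\<lambda>x. f x - g x) \<in> bounded_radial"
    by (rule bounded_radialI[where M = "M + N"]) (use f g in \<open>auto intro: radial_fun_diff norm_triangle_le_diff add_mono\<close>)
qed

lemma bounded_radial_cmult: "f \<in> bounded_radial \<Longrightarrow> (\<lambda>x. c * f x) \<in> bounded_radial"
proof -
  assume "f \<in> bounded_radial"
  then obtain M where f: "f \<in> borel_measurable borel" "radial_fun f" "\<And>x. norm (f x) \<le> M"
    unfolding bounded_radial_def by blast
  show ?thesis
    by (rule bounded_radialI[where M = "norm c * M"]) (use f in \<open>auto intro: radial_fun_cmult simp: norm_mult mult_left_mono\<close>)
qed

lemma bounded_radial_const: "(\<lambda>x. c) \<in> bounded_radial"
  by (rule bounded_radialI[where M = "norm c"]) (auto intro: radial_fun_const)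

text \<open>
  By Newton's theorem the difference of the values of the Newton potential at the centre and at \<open>x\<close>
  only involves the charge inside the ball of radius \<open>norm x\<close>.
\<close>
lemma newton_difference_contracts:
  fixes f :: "real^'n \<Rightarrow> complex"
  assumes [measurable]: "f \<in> borel_measurable borel" and rf: "radial_fun f"
    and M: "\<And>y. norm (f y) \<le> M * weight CARD('n) (norm y)"
  shows "norm (RV 0 f 0 - RV 0 f x) \<le> M / 2 * weight CARD('n) (norm x)"
proof -
  let ?w = "\<lambda>y::real^'n. weight CARD('n) (norm y)"
  have M0: "M \<ge> 0"
  proof -
    have "0 \<le> M * ?w 0" using norm_ge_zero[of "f 0"] M[of 0] by linarith
    then show ?thesis by (simp add: zero_le_mult_iff less_le_not_le[of 0 "weight CARD('n) 0", THEN iffD1, OF weight_pos])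
  qed
  have "f \<in> bounded_radial"
    by (rule bounded_radialI[where M = M]) (use rf M M0 weight_le_1[OF dim3] in \<open>auto intro: order_trans[OF M] mult_left_le\<close>)
  then have adm: "f \<in> admissible" by (rule bounded_radial_admissible)
  have rad: "radial_fun (\<lambda>y. complex_of_real (V y) * f y)"
    unfolding radial_fun_def using radial_V radial_funD[OF rf] by metis
  have K: "RV 0 f x = (LINT y|lborel. complex_of_real (shell_kernel x y) * (complex_of_real (V y) * f y))" for x
    unfolding RV_def resolvent_def by (rule newton_shell_integral[OF dim3 rad]) measurable
  have int: "integrable lborel (\<lambda>y. complex_of_real (shell_kernel x y) * (complex_of_real (V y) * f y))" for x
  proof (rule Bochner_Integration.integrable_bound)
    show "integrable lborel (\<lambda>y. decay x * (Vwt y * norm (f y)))" using admissibleD(3)[OF adm] by simp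
    show "AE y in lborel. norm (complex_of_real (shell_kernel x y) * (complex_of_real (V y) * f y)) \<le> norm (decay x * (Vwt y * norm (f y)))"
    proof (rule eventually_mono[OF AE_lborel_singleton[of 0]])
      fix y :: "real^'n" assume "y \<noteq> 0"
      then have "shell_kernel x y * \<bar>V y\<bar> * norm (f y) \<le> decay x * Vwt y * norm (f y)"
        by (intro mult_right_mono shell_kernel_V_le) auto
      then show "norm (complex_of_real (shell_kernel x y) * (complex_of_real (V y) * f y)) \<le> norm (decay x * (Vwt y * norm (f y)))"
        using shell_kernel_nonneg[OF dim3, of x y] by (simp add: norm_mult abs_mult mult.assoc less_imp_le)
    qed
  qed measurable
  let ?g = "\<lambda>y. complex_of_real (shell_kernel 0 y) * (complex_of_real (V y) * f y) - complex_of_real (shell_kernel x y) * (complex_of_real (V y) * f y)"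
  have "RV 0 f 0 - RV 0 f x = (LINT y|lborel. ?g y)"
    unfolding K by (rule Bochner_Integration.integral_diff[OF int int, symmetric])
  then have "ennreal (norm (RV 0 f 0 - RV 0 f x)) \<le> (\<integral>\<^sup>+y. ennreal (norm (?g y)) \<partial>lborel)"
    using integral_norm_bound_ennreal[OF Bochner_Integration.integrable_diff[OF int int], of 0 x] by simp
  also have "\<dots> \<le> (\<integral>\<^sup>+y. ennreal M * (ennreal (shell_kernel 0 y * \<bar>V_profile CARD('n) (norm y)\<bar> * ?w y) * indicator {..<norm x} (norm y)) \<partial>lborel)"
  proof (rule nn_integral_mono_AE, rule eventually_mono[OF AE_lborel_singleton[of 0]])
    fix y :: "real^'n" assume "y \<noteq> 0"
    have g: "norm (?g y) = \<bar>shell_kernel 0 y - shell_kernel x y\<bar> * \<bar>V y\<bar> * norm (f y)"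
      by (simp add: left_diff_distrib[symmetric] norm_mult of_real_diff[symmetric] mult.assoc del: of_real_diff)
    show "ennreal (norm (?g y)) \<le> ennreal M * (ennreal (shell_kernel 0 y * \<bar>V_profile CARD('n) (norm y)\<bar> * ?w y) * indicator {..<norm x} (norm y))"
    proof (cases "norm y < norm x")
      case True
      have "shell_kernel x y \<le> shell_kernel 0 y"
        using True \<open>y \<noteq> 0\<close> d34 area_pos unfolding shell_kernel_def by (intro divide_right_mono powr_mono2') auto
      then have "\<bar>shell_kernel 0 y - shell_kernel x y\<bar> \<le> shell_kernel 0 y"
        using shell_kernel_nonneg[OF dim3, of x y] by simp
      then have "norm (?g y) \<le> shell_kernel 0 y * \<bar>V y\<bar> * (M * ?w y)"
        unfolding g using M shell_kernel_nonneg[OF dim3, of 0 y] by (intro mult_mono) auto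
      then have "ennreal (norm (?g y)) \<le> ennreal (M * (shell_kernel 0 y * \<bar>V_profile CARD('n) (norm y)\<bar> * ?w y))"
        unfolding V_eq_profile[OF dim3] by (intro ennreal_leI) (simp add: mult_ac)
      then show ?thesis using True M0 by (simp add: ennreal_mult')
    next
      case False
      then have "shell_kernel 0 y = shell_kernel x y" by (simp add: shell_kernel_def max_absorb2)
      then show ?thesis unfolding g by simp
    qed
  qed
  also have "\<dots> = ennreal M * (\<integral>\<^sup>+y. ennreal (shell_kernel 0 y * \<bar>V_profile CARD('n) (norm y)\<bar> * ?w y) * indicator {..<norm x} (norm y) \<partial>lborel)"
    by (rule nn_integral_cmult) measurable
  also have "\<dots> \<le> ennreal M * ennreal (?w x / 2)"
    by (intro mult_left_mono inner_potential_weight dim3) auto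
  also have "\<dots> = ennreal (M / 2 * ?w x)" using M0 by (simp add: ennreal_mult'[symmetric])
  finally have *: "ennreal (norm (RV 0 f 0 - RV 0 f x)) \<le> ennreal (M / 2 * ?w x)" .
  have "0 \<le> M / 2 * ?w x" using M0 by (intro mult_nonneg_nonneg) (auto simp: less_imp_le)
  then show ?thesis using * by (simp only: ennreal_le_iff)
qed

end

context critical_dimension
begin

section \<open>The zero mode and its pairing\<close>

abbreviation zmode :: "real^'n \<Rightarrow> complex" where
  "zmode x \<equiv> complex_of_real (LambdaW x)"

definition VZ :: "real^'n \<Rightarrow> real" where
  "VZ y = V y * LambdaW y"

lemma VZ_eq: "VZ y = V_profile CARD('n) (norm y) * zero_mode CARD('n) (norm y)"
  by (simp add: VZ_def V_eq_profile[OF dim3] LambdaW_eq_zero_mode[OF dim3])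

lemma VZ_measurable [measurable]: "VZ \<in> borel_measurable borel"
  unfolding VZ_eq[abs_def] by measurable

lemma VZ_integrable: "integrable lborel VZ"
  using V_zero_mode_integrable[OF dim3] unfolding VZ_eq[abs_def] .

lemma VZ_integral_pos: "(LINT y|lborel. VZ y) > 0"
  using V_zero_mode_integral_pos[OF dim34] unfolding VZ_eq .

lemma zmode_measurable [measurable]: "LambdaW \<in> borel_measurable (borel :: (real^'n) measure)"
proof -
  have "(\<lambda>y::real^'n. zero_mode CARD('n) (norm y)) \<in> borel_measurable borel" by measurable
  then show ?thesis unfolding LambdaW_eq_zero_mode[OF dim3, symmetric] .
qed

lemma zmode_bound:
  obtains C where "C > 0" "\<And>x. norm (zmode x) \<le> C * decay x"
proof -
  obtain C where C: "C > 0" "\<And>r. \<bar>zero_mode CARD('n) r\<bar> \<le> C * (max 1 \<bar>r\<bar>) powr (- (real CARD('n) - 2))"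
    using zero_mode_bound[OF dim3] by blast
  show thesis
  proof (rule that[OF C(1)])
    fix x
    have "(max 1 (norm x)) powr (- (real CARD('n) - 2)) \<le> decay x"
      unfolding decay_def using \<gamma>_less by (intro powr_mono) auto
    then have "C * (max 1 (norm x)) powr (- (real CARD('n) - 2)) \<le> C * decay x"
      using C(1) by (intro mult_left_mono) auto
    then show "norm (zmode x) \<le> C * decay x"
      using C(2)[of "norm x"] by (simp add: LambdaW_eq_zero_mode[OF dim3])
  qed
qed

lemma zmode_bounded_radial: "zmode \<in> bounded_radial"
proof -
  obtain C where C: "C > 0" "\<And>x. norm (zmode x) \<le> C * decay x" using zmode_bound by blast
  show ?thesis
  proof (rule bounded_radialI)
    show "norm (zmode x) \<le> C" for x
      using order_trans[OF C(2)[of x] mult_left_mono[OF decay_le_1[of x], of C]] C(1) by simp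
    show "radial_fun zmode"
      unfolding radial_fun_def by (simp add: LambdaW_eq_zero_mode[OF dim3])
  qed measurable
qed

lemma zmode_0: "LambdaW (0 :: real^'n) \<noteq> 0"
  using d34 by (simp add: LambdaW_eq_zero_mode[OF dim3] zero_mode_at_0[OF dim3])

lemma radial_VZ: "radial_fun (\<lambda>y. complex_of_real (VZ y))"
  unfolding radial_fun_def VZ_eq by simp

lemma RV_0_zmode: "RV 0 zmode x = - zmode x"
proof -
  have "RV 0 zmode x = (LINT y|lborel. complex_of_real (resolvent_kernel 0 (x - y)) * complex_of_real (VZ y))"
    by (simp add: RV_def resolvent_def VZ_def)
  also have "\<dots> = (LINT y|lborel. complex_of_real (shell_kernel x y) * complex_of_real (VZ y))"
    by (rule newton_shell_integral[OF dim3 radial_VZ]) measurable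
  also have "\<dots> = complex_of_real (LINT y|lborel. shell_kernel x y * VZ y)"
    by (simp add: integral_complex_of_real[symmetric])
  also have "(LINT y|lborel. shell_kernel x y * VZ y) = - LambdaW x"
    unfolding VZ_eq shell_potential_zero_mode[OF dim34] by (simp add: LambdaW_eq_zero_mode[OF dim3])
  finally show ?thesis by simp
qed

lemma VZ_bound:
  obtains C where "C > 0" "\<And>y. \<bar>VZ y\<bar> \<le> C * (max 1 (norm y)) powr (- (real CARD('n) + 2))"
  using V_zero_mode_bound[OF dim3] unfolding VZ_eq by (metis abs_norm_cancel)

lemma VZ_le_Vwt:
  obtains C where "C > 0" "\<And>y. y \<noteq> 0 \<Longrightarrow> \<bar>VZ y\<bar> \<le> C * Vwt y"
proof -
  obtain A where A: "A > 0" "\<And>r. \<bar>zero_mode CARD('n) r\<bar> \<le> A * (max 1 \<bar>r\<bar>) powr (- (real CARD('n) - 2))"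
    using zero_mode_bound[OF dim3] by blast
  define c where "c = (real CARD('n) - 2) * (real CARD('n) * unit_ball_vol (real CARD('n)))"
  have c: "c > 0" using area_pos by (simp add: c_def)
  show thesis
  proof (rule that)
    show "A * c > 0" using A c by simp
    fix y :: "real^'n" assume "y \<noteq> 0"
    then have y: "norm y > 0" by simp
    have "(max 1 (norm y)) powr (- (real CARD('n) - 2)) \<le> norm y powr (2 - real CARD('n))"
      using y d34 by (auto intro!: powr_mono2')
    also have "\<dots> \<le> norm y powr (- (real CARD('n) - 2 - \<gamma>)) + norm y powr (2 - real CARD('n))" by simp
    finally have "\<bar>LambdaW y\<bar> \<le> A * (norm y powr (- (real CARD('n) - 2 - \<gamma>)) + norm y powr (2 - real CARD('n)))"
      using A(2)[of "norm y"] A(1) by (auto simp: LambdaW_eq_zero_mode[OF dim3] intro: order_trans mult_left_mono)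
    then have "\<bar>LambdaW y\<bar> * \<bar>V y\<bar> \<le> A * (norm y powr (- (real CARD('n) - 2 - \<gamma>)) + norm y powr (2 - real CARD('n))) * \<bar>V y\<bar>"
      by (rule mult_right_mono) simp
    also have "\<dots> = A * c * Vwt y" using c by (simp add: Vwt_def c_def[symmetric])
    finally show "\<bar>VZ y\<bar> \<le> A * c * Vwt y" by (simp add: VZ_def abs_mult mult_ac)
  qed
qed

lemma VZ_mult_integrable:
  assumes f: "f \<in> admissible"
  shows "integrable lborel (\<lambda>y. complex_of_real (VZ y) * f y)"
proof -
  note [measurable] = admissibleD(1)[OF f]
  obtain C where C: "C > 0" "\<And>y. y \<noteq> 0 \<Longrightarrow> \<bar>VZ y\<bar> \<le> C * Vwt y" using VZ_le_Vwt by blast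
  show ?thesis
  proof (rule Bochner_Integration.integrable_bound)
    show "integrable lborel (\<lambda>y. C * (Vwt y * norm (f y)))" using admissibleD(3)[OF f] by simp
    show "AE y in lborel. norm (complex_of_real (VZ y) * f y) \<le> norm (C * (Vwt y * norm (f y)))"
    proof (rule eventually_mono[OF AE_lborel_singleton[of 0]])
      fix y :: "real^'n" assume "y \<noteq> 0"
      then have "\<bar>VZ y\<bar> * norm (f y) \<le> C * Vwt y * norm (f y)" by (intro mult_right_mono C) auto
      then show "norm (complex_of_real (VZ y) * f y) \<le> norm (C * (Vwt y * norm (f y)))"
        using C(1) by (simp add: norm_mult abs_mult mult.assoc)
    qed
  qed measurable
qed

definition zpair :: "(real^'n \<Rightarrow> complex) \<Rightarrow> complex" where
  "zpair f = (LINT y|lborel. complex_of_real (VZ y) * f y)"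

section \<open>Passing from the Newton potential to the resolvent\<close>

text \<open>
  Twice this number bounds the operator \<open>RV s - RV 0\<close> on bounded functions, by the estimate for convolutions of radially
  decreasing functions.
\<close>
definition gap_mass :: "real \<Rightarrow> real" where
  "gap_mass s = (LINT y|lborel. resolvent_gap s y * \<bar>V (y::real^'n)\<bar>)"

lemma newton_V_integrable: "integrable lborel (\<lambda>y::real^'n. resolvent_kernel 0 y * \<bar>V y\<bar>)"
proof (rule integrableI_nonneg)
  have "(\<lambda>y::real^'n. 1) \<in> admissible" by (intro bounded_radial_admissible bounded_radial_const)
  from newton_V_le[OF this, of 0]
  have "(\<integral>\<^sup>+y. ennreal (resolvent_kernel 0 (y::real^'n) * \<bar>V y\<bar>) \<partial>lborel) \<le> ennreal (decay 0 * (LINT y|lborel. Vwt y * norm (1::complex)))"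
    by (simp add: ennreal_mult' resolvent_kernel_nonneg resolvent_kernel_minus[of _ 0, simplified] del: norm_one)
  then show "(\<integral>\<^sup>+y. ennreal (resolvent_kernel 0 (y::real^'n) * \<bar>V y\<bar>) \<partial>lborel) < \<infinity>"
    by (rule le_less_trans) simp
qed (auto simp: resolvent_kernel_nonneg)

lemma gap_V_integrable:
  assumes "s \<ge> 0"
  shows "integrable lborel (\<lambda>y::real^'n. resolvent_gap s y * \<bar>V y\<bar>)"
proof (rule Bochner_Integration.integrable_bound[OF newton_V_integrable])
  show "AE y in lborel. norm (resolvent_gap s y * \<bar>V (y::real^'n)\<bar>) \<le> norm (resolvent_kernel 0 y * \<bar>V y\<bar>)"
    by (rule eventually_mono[OF AE_lborel_singleton[of 0]])
       (use resolvent_gap_le[OF dim3 _ assms] in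
        \<open>auto simp: abs_mult abs_of_nonneg[OF resolvent_gap_nonneg[OF assms]] abs_of_nonneg[OF resolvent_kernel_nonneg] intro!: mult_right_mono\<close>)
qed measurable

lemma gap_mass_nonneg: "s \<ge> 0 \<Longrightarrow> 0 \<le> gap_mass s"
  unfolding gap_mass_def by (intro Bochner_Integration.integral_nonneg) (auto intro!: mult_nonneg_nonneg resolvent_gap_nonneg)

lemma gap_V_convolution_le:
  assumes s: "s \<ge> 0"
  shows "(\<integral>\<^sup>+y. ennreal (resolvent_gap s (x - y) * \<bar>V (y::real^'n)\<bar>) \<partial>lborel) \<le> ennreal (2 * gap_mass s)"
proof -
  have "(\<integral>\<^sup>+y. ennreal (resolvent_gap s (x - y) * \<bar>V (y::real^'n)\<bar>) \<partial>lborel) = (\<integral>\<^sup>+y. ennreal (resolvent_gap s (x - y)) * ennreal \<bar>V (y::real^'n)\<bar> \<partial>lborel)"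
    by (simp add: ennreal_mult' resolvent_gap_nonneg[OF s])
  also have "\<dots> \<le> 2 * (\<integral>\<^sup>+y. ennreal (resolvent_gap s y) * ennreal \<bar>V (y::real^'n)\<bar> \<partial>lborel)"
    by (rule convolution_decreasing_le) (auto intro!: ennreal_leI resolvent_gap_antimono[OF dim3 _ _ s] V_antimono)
  also have "(\<integral>\<^sup>+y. ennreal (resolvent_gap s y) * ennreal \<bar>V (y::real^'n)\<bar> \<partial>lborel) = ennreal (gap_mass s)"
    unfolding gap_mass_def using nn_integral_eq_integral[OF gap_V_integrable[OF s]]
    by (simp add: ennreal_mult' resolvent_gap_nonneg[OF s])
  also have "2 * ennreal (gap_mass s) = ennreal (2 * gap_mass s)" by (simp add: ennreal_mult')
  finally show ?thesis .
qed

lemma gap_mass_tendsto_0: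
  assumes "s \<longlonglongrightarrow> 0" "\<And>i. s i > 0"
  shows "(\<lambda>i. gap_mass (s i)) \<longlonglongrightarrow> 0"
proof -
  have s: "s i \<ge> 0" for i using assms(2)[of i] by simp
  have "(\<lambda>i. gap_mass (s i)) \<longlonglongrightarrow> (LINT y|(lborel :: (real^'n) measure). 0)"
    unfolding gap_mass_def
  proof (rule integral_dominated_convergence[OF _ _ newton_V_integrable])
    show "AE y in lborel. (\<lambda>i. resolvent_gap (s i) y * \<bar>V (y::real^'n)\<bar>) \<longlonglongrightarrow> 0"
    proof (rule eventually_mono[OF AE_lborel_singleton[of 0]])
      fix y :: "real^'n" assume "y \<noteq> 0"
      then have "(\<lambda>i. resolvent_gap (s i) y) \<longlonglongrightarrow> 0" by (intro resolvent_gap_tendsto_0 dim3 assms s)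
      then show "(\<lambda>i. resolvent_gap (s i) y * \<bar>V y\<bar>) \<longlonglongrightarrow> 0" by (rule tendsto_mult_left_zero)
    qed
    show "AE y in lborel. norm (resolvent_gap (s i) y * \<bar>V (y::real^'n)\<bar>) \<le> resolvent_kernel 0 y * \<bar>V y\<bar>" for i
      by (rule eventually_mono[OF AE_lborel_singleton[of 0]])
         (use resolvent_gap_le[OF dim3 _ s] in \<open>auto simp: abs_mult abs_of_nonneg[OF resolvent_gap_nonneg[OF s]] intro!: mult_right_mono\<close>)
  qed measurable
  then show ?thesis by simp
qed

lemma RV_minus_newton:
  assumes f: "f \<in> admissible" and s: "s \<ge> 0"
  shows "RV s f x - RV 0 f x = - (LINT y|lborel. complex_of_real (resolvent_gap s (x - y)) * (complex_of_real (V y) * f y))"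
    and "integrable lborel (\<lambda>y. complex_of_real (resolvent_gap s (x - y)) * (complex_of_real (V y) * f y))"
proof -
  note [measurable] = admissibleD(1)[OF f]
  note i = RV_integrable_and_bound(1)[OF f s, of x] RV_integrable_and_bound(1)[OF f order_refl, of x]
  have ae: "AE y in lborel. complex_of_real (resolvent_kernel 0 (x - y)) * (complex_of_real (V y) * f y) - complex_of_real (resolvent_kernel s (x - y)) * (complex_of_real (V y) * f y)
     = complex_of_real (resolvent_gap s (x - y)) * (complex_of_real (V y) * f y)"
  proof (rule eventually_mono[OF AE_lborel_singleton[of x]])
    fix y assume "y \<noteq> x"
    then have "resolvent_kernel s (x - y) = resolvent_kernel 0 (x - y) - resolvent_gap s (x - y)"
      by (intro resolvent_kernel_eq_gap dim3 s) simp
    then show "complex_of_real (resolvent_kernel 0 (x - y)) * (complex_of_real (V y) * f y) - complex_of_real (resolvent_kernel s (x - y)) * (complex_of_real (V y) * f y)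
     = complex_of_real (resolvent_gap s (x - y)) * (complex_of_real (V y) * f y)"
      by (simp add: left_diff_distrib)
  qed
  show "integrable lborel (\<lambda>y. complex_of_real (resolvent_gap s (x - y)) * (complex_of_real (V y) * f y))"
    by (rule integrable_cong_AE_imp[OF Bochner_Integration.integrable_diff[OF i(2,1)] _ ae]) measurable
  have "RV 0 f x - RV s f x = (LINT y|lborel. complex_of_real (resolvent_kernel 0 (x - y)) * (complex_of_real (V y) * f y) - complex_of_real (resolvent_kernel s (x - y)) * (complex_of_real (V y) * f y))"
    unfolding RV_def resolvent_def by (rule Bochner_Integration.integral_diff[OF i(2,1), symmetric])
  also have "\<dots> = (LINT y|lborel. complex_of_real (resolvent_gap s (x - y)) * (complex_of_real (V y) * f y))"
    by (rule integral_cong_AE[OF _ _ ae]) measurable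
  finally show "RV s f x - RV 0 f x = - (LINT y|lborel. complex_of_real (resolvent_gap s (x - y)) * (complex_of_real (V y) * f y))"
    by (metis minus_diff_eq)
qed

lemma RV_minus_newton_le:
  assumes f: "f \<in> bounded_radial" and s: "s \<ge> 0" and M: "\<And>y. norm (f y) \<le> M"
  shows "norm (RV s f x - RV 0 f x) \<le> 2 * gap_mass s * M"
proof -
  have [measurable]: "f \<in> borel_measurable borel" using f by (simp add: bounded_radial_def)
  have M0: "M \<ge> 0" using M[of 0] norm_ge_zero[of "f 0"] by linarith
  note adm = bounded_radial_admissible[OF f]
  have "ennreal (norm (RV s f x - RV 0 f x)) \<le> (\<integral>\<^sup>+y. ennreal (norm (complex_of_real (resolvent_gap s (x - y)) * (complex_of_real (V y) * f y))) \<partial>lborel)"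
    unfolding RV_minus_newton(1)[OF adm s] norm_minus_cancel by (rule integral_norm_bound_ennreal[OF RV_minus_newton(2)[OF adm s]])
  also have "\<dots> \<le> (\<integral>\<^sup>+y. ennreal M * ennreal (resolvent_gap s (x - y) * \<bar>V y\<bar>) \<partial>lborel)"
  proof (rule nn_integral_mono)
    fix y
    have "resolvent_gap s (x - y) * \<bar>V y\<bar> * norm (f y) \<le> resolvent_gap s (x - y) * \<bar>V y\<bar> * M"
      by (intro mult_left_mono M mult_nonneg_nonneg resolvent_gap_nonneg s abs_ge_zero)
    then show "ennreal (norm (complex_of_real (resolvent_gap s (x - y)) * (complex_of_real (V y) * f y))) \<le> ennreal M * ennreal (resolvent_gap s (x - y) * \<bar>V y\<bar>)"
      using resolvent_gap_nonneg[OF s, of "x - y"] M0 by (simp add: norm_mult ennreal_mult'[symmetric] mult_ac ennreal_leI)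
  qed
  also have "\<dots> = ennreal M * (\<integral>\<^sup>+y. ennreal (resolvent_gap s (x - y) * \<bar>V y\<bar>) \<partial>lborel)"
    by (rule nn_integral_cmult) measurable
  also have "\<dots> \<le> ennreal M * ennreal (2 * gap_mass s)" by (intro mult_left_mono gap_V_convolution_le s) simp
  also have "\<dots> = ennreal (2 * gap_mass s * M)" using M0 by (simp add: ennreal_mult'[symmetric] mult_ac)
  finally show ?thesis using M0 gap_mass_nonneg[OF s] by (simp add: ennreal_le_iff)
qed

section \<open>The defect of the zero mode\<close>

text \<open>\<open>defect s\<close> is the image of \<open>\<Lambda>W\<close> under \<open>1 + (-\<Delta> + s)\<^sup>-\<^sup>1 V\<close>, a real function that vanishes as \<open>s\<close> tends to 0.\<close>
definition defect :: "real \<Rightarrow> real^'n \<Rightarrow> real" where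
  "defect s x = - (LINT y|lborel. resolvent_gap s (x - y) * VZ y)"

lemma defect_measurable [measurable]: "defect s \<in> borel_measurable borel"
  unfolding defect_def by measurable

lemma defect_eq:
  assumes s: "s \<ge> 0"
  shows "zmode x + RV s zmode x = complex_of_real (defect s x)"
proof -
  have "zmode x + RV s zmode x = RV s zmode x - RV 0 zmode x" by (simp add: RV_0_zmode)
  also have "\<dots> = - (LINT y|lborel. complex_of_real (resolvent_gap s (x - y) * VZ y))"
    unfolding RV_minus_newton(1)[OF bounded_radial_admissible[OF zmode_bounded_radial] s] by (simp add: VZ_def)
  also have "\<dots> = complex_of_real (defect s x)"
    unfolding defect_def by (simp add: integral_complex_of_real del: of_real_mult)
  finally show ?thesis .
qed

lemma gap_VZ_integrable:
  assumes s: "s \<ge> 0"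
  shows "integrable lborel (\<lambda>y. resolvent_gap s (x - y) * VZ y)"
  using RV_minus_newton(2)[OF bounded_radial_admissible[OF zmode_bounded_radial] s, of x]
  unfolding VZ_def complex_of_real_integrable_eq[symmetric] by simp

lemma defect_nn_le:
  assumes s: "s \<ge> 0"
  shows "ennreal \<bar>defect s x\<bar> \<le> (\<integral>\<^sup>+y. ennreal (resolvent_gap s (x - y) * \<bar>VZ y\<bar>) \<partial>lborel)"
  unfolding defect_def abs_minus_cancel
  using integral_norm_bound_ennreal[OF gap_VZ_integrable[OF s], of x]
  by (simp add: abs_mult abs_of_nonneg[OF resolvent_gap_nonneg[OF s]])

text \<open>
  Up to a constant multiple of the rate, this dominates the integrand of the defect at \<open>x\<close> for all small \<open>s\<close>.
\<close>
definition singular_majorant :: "real^'n \<Rightarrow> real^'n \<Rightarrow> real" where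
  "singular_majorant x y = (1 + 1 / norm (x - y)) * \<bar>VZ y\<bar>"

lemma singular_majorant_integrable:
  obtains J where "J > 0" "\<And>x. integrable lborel (singular_majorant x)" "\<And>x. (LINT y|lborel. singular_majorant x y) \<le> J"
proof -
  obtain C where C: "C > 0" "\<And>y. \<bar>VZ y\<bar> \<le> C * (max 1 (norm y)) powr (- (real CARD('n) + 2))" using VZ_bound by blast
  let ?k = "\<lambda>z::real^'n. ennreal (1 + 1 / norm z)" and ?w = "\<lambda>y::real^'n. ennreal (C * (max 1 (norm y)) powr (- (real CARD('n) + 2)))"
  let ?m = "\<lambda>y::real^'n. (1 + 1 / norm y) * (C * (max 1 (norm y)) powr (- (real CARD('n) + 2)))"
  have int: "integrable lborel ?m"
  proof (rule integrable_powr_bound[where C = "2 * C" and \<alpha> = 1 and \<beta> = "real CARD('n) + 2"])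
    show "\<bar>?m y\<bar> \<le> 2 * C * norm y powr (- 1)" if y: "0 < norm y" "norm y \<le> 1" for y
    proof -
      have "1 + 1 / norm y \<le> 2 * (1 / norm y)" using y by (simp add: field_simps)
      then have "(1 + 1 / norm y) * C \<le> 2 * (1 / norm y) * C" using C(1) by (intro mult_right_mono) auto
      then show ?thesis using y C(1) by (simp add: max_absorb1 powr_minus_divide abs_mult)
    qed
    show "\<bar>?m y\<bar> \<le> 2 * C * norm y powr (- (real CARD('n) + 2))" if y: "1 \<le> norm y" for y
    proof -
      have "1 / norm y \<le> 1 / 1" using y by (intro divide_left_mono) auto
      then have "1 + 1 / norm y \<le> 2" by simp
      then have "(1 + 1 / norm y) * (C * norm y powr (- (real CARD('n) + 2))) \<le> 2 * (C * norm y powr (- (real CARD('n) + 2)))"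
        using C(1) by (intro mult_right_mono) auto
      then show ?thesis using y C(1) by (simp add: max_absorb2 abs_mult mult.assoc)
    qed
  qed (use d34 in auto)
  define J where "J = 2 * (LINT y|lborel. ?m y)"
  have J0: "0 \<le> J" unfolding J_def using C(1) by (intro mult_nonneg_nonneg Bochner_Integration.integral_nonneg) auto
  have nn: "(\<integral>\<^sup>+y. ennreal (norm (singular_majorant x y)) \<partial>lborel) \<le> ennreal J" for x
  proof -
    have "(\<integral>\<^sup>+y. ennreal (norm (singular_majorant x y)) \<partial>lborel) \<le> (\<integral>\<^sup>+y. ?k (x - y) * ?w y \<partial>lborel)"
    proof (rule nn_integral_mono)
      fix y
      have "norm (singular_majorant x y) \<le> (1 + 1 / norm (x - y)) * (C * (max 1 (norm y)) powr (- (real CARD('n) + 2)))"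
        unfolding singular_majorant_def real_norm_def abs_mult abs_idempotent by (intro mult_mono C(2)) auto
      then show "ennreal (norm (singular_majorant x y)) \<le> ?k (x - y) * ?w y"
        by (subst ennreal_mult'[symmetric]) (auto intro: ennreal_leI)
    qed
    also have "\<dots> \<le> 2 * (\<integral>\<^sup>+y. ?k y * ?w y \<partial>lborel)"
    proof (rule convolution_decreasing_le)
      fix x y :: "real^'n" assume xy: "x \<noteq> 0" "norm x \<le> norm y"
      show "?k y \<le> ?k x" proof -
        have "0 < norm x" "0 < norm y" using xy by (auto intro: less_le_trans)
        then show ?thesis using xy by (intro ennreal_leI add_left_mono divide_left_mono) auto
      qed
      have "(max 1 (norm y)) powr (- (real CARD('n) + 2)) \<le> (max 1 (norm x)) powr (- (real CARD('n) + 2))"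
        using xy by (intro powr_mono2') auto
      then show "?w y \<le> ?w x" using C(1) by (intro ennreal_leI mult_left_mono) auto
    qed measurable
    also have "(\<integral>\<^sup>+y. ?k y * ?w y \<partial>lborel) = ennreal (LINT y|lborel. ?m y)"
    proof -
      have "(\<integral>\<^sup>+y. ?k y * ?w y \<partial>lborel) = (\<integral>\<^sup>+y. ennreal (?m y) \<partial>lborel)"
        by (rule nn_integral_cong, rule ennreal_mult'[symmetric]) simp
      also have "\<dots> = ennreal (LINT y|lborel. ?m y)"
        using C(1) by (intro nn_integral_eq_integral int) auto
      finally show ?thesis .
    qed
    also have "2 * ennreal (LINT y|lborel. ?m y) = ennreal J" by (simp add: J_def ennreal_mult')
    finally show ?thesis .
  qed
  have meas: "singular_majorant x \<in> borel_measurable lborel" for x unfolding singular_majorant_def by measurable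
  have int': "integrable lborel (singular_majorant x)" for x
    using nn[of x] meas by (intro integrableI_bounded) (auto intro: le_less_trans)
  show thesis
  proof (rule that[of "J + 1"])
    show "(LINT y|lborel. singular_majorant x y) \<le> J + 1" for x
    proof -
      have "ennreal (LINT y|lborel. norm (singular_majorant x y)) \<le> ennreal J"
        using nn[of x] nn_integral_eq_integral[OF integrable_norm[OF int'[of x]]] by simp
      then have "(LINT y|lborel. norm (singular_majorant x y)) \<le> J" using J0 by (simp only: ennreal_le_iff)
      then show ?thesis by (simp add: singular_majorant_def)
    qed
  qed (use J0 int' in auto)
qed

lemma defect_le_rate:
  obtains C where "C > 0" "\<And>s x. 0 < s \<Longrightarrow> s < 1 \<Longrightarrow> \<bar>defect s x\<bar> \<le> C * gap_rate CARD('n) s"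
proof -
  obtain A where A: "A > 0" "\<And>s (z::real^'n). 0 < s \<Longrightarrow> s < 1 \<Longrightarrow> z \<noteq> 0 \<Longrightarrow> resolvent_gap s z \<le> A * gap_rate CARD('n) s * (1 + 1 / norm z)"
    using resolvent_gap_le_rate[OF dim34] by blast
  obtain J where J: "J > 0" "\<And>x. integrable lborel (singular_majorant x)" "\<And>x. (LINT y|lborel. singular_majorant x y) \<le> J"
    using singular_majorant_integrable by blast
  show thesis
  proof (rule that)
    show "A * J > 0" using A J by simp
    fix s :: real and x :: "real^'n" assume s: "0 < s" "s < 1"
    have r: "gap_rate CARD('n) s > 0" using gap_rate_pos s dim34 by blast
    have "\<bar>defect s x\<bar> \<le> (LINT y|lborel. \<bar>resolvent_gap s (x - y) * VZ y\<bar>)"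
      unfolding defect_def abs_minus_cancel by (rule integral_abs_bound)
    also have "\<dots> \<le> (LINT y|lborel. A * gap_rate CARD('n) s * singular_majorant x y)"
    proof (rule integral_mono_AE)
      show "integrable lborel (\<lambda>y. \<bar>resolvent_gap s (x - y) * VZ y\<bar>)" using gap_VZ_integrable[of s x] s by auto
      show "integrable lborel (\<lambda>y. A * gap_rate CARD('n) s * singular_majorant x y)" using J(2) by simp
      show "AE y in lborel. \<bar>resolvent_gap s (x - y) * VZ y\<bar> \<le> A * gap_rate CARD('n) s * singular_majorant x y"
      proof (rule eventually_mono[OF AE_lborel_singleton[of x]])
        fix y assume "y \<noteq> x"
        then have "resolvent_gap s (x - y) * \<bar>VZ y\<bar> \<le> A * gap_rate CARD('n) s * (1 + 1 / norm (x - y)) * \<bar>VZ y\<bar>"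
          using s by (intro mult_right_mono A) auto
        then show "\<bar>resolvent_gap s (x - y) * VZ y\<bar> \<le> A * gap_rate CARD('n) s * singular_majorant x y"
          using resolvent_gap_nonneg[of s "x - y"] s by (simp add: abs_mult singular_majorant_def mult.assoc)
      qed
    qed
    also have "\<dots> = A * gap_rate CARD('n) s * (LINT y|lborel. singular_majorant x y)" by simp
    also have "\<dots> \<le> A * gap_rate CARD('n) s * J" using A(1) r by (intro mult_left_mono J) auto
    finally show "\<bar>defect s x\<bar> \<le> A * J * gap_rate CARD('n) s" by (simp add: mult_ac)
  qed
qed

lemma V_defect_le:
  assumes s: "s \<ge> 0"
  shows "integrable lborel (\<lambda>x. \<bar>V x\<bar> * \<bar>defect s x\<bar>)"
    and "(LINT x|lborel. \<bar>V x\<bar> * \<bar>defect s x\<bar>) \<le> 2 * gap_mass s * (LINT y|lborel. \<bar>VZ y\<bar>)"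
proof -
  let ?B = "2 * gap_mass s * (LINT y|lborel. \<bar>VZ y\<bar>)"
  have B: "0 \<le> ?B" using gap_mass_nonneg[OF s] by (intro mult_nonneg_nonneg Bochner_Integration.integral_nonneg) auto
  have "(\<integral>\<^sup>+x. ennreal (norm (\<bar>V x\<bar> * \<bar>defect s x\<bar>)) \<partial>lborel) \<le> (\<integral>\<^sup>+x. (\<integral>\<^sup>+y. ennreal (\<bar>V x\<bar> * (resolvent_gap s (x - y) * \<bar>VZ y\<bar>)) \<partial>lborel) \<partial>lborel)"
  proof (rule nn_integral_mono)
    fix x :: "real^'n"
    have "ennreal (norm (\<bar>V x\<bar> * \<bar>defect s x\<bar>)) = ennreal \<bar>V x\<bar> * ennreal \<bar>defect s x\<bar>" by (simp add: ennreal_mult' abs_mult)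
    also have "\<dots> \<le> ennreal \<bar>V x\<bar> * (\<integral>\<^sup>+y. ennreal (resolvent_gap s (x - y) * \<bar>VZ y\<bar>) \<partial>lborel)"
      by (intro mult_left_mono defect_nn_le s) simp
    also have "\<dots> = (\<integral>\<^sup>+y. ennreal (\<bar>V x\<bar> * (resolvent_gap s (x - y) * \<bar>VZ y\<bar>)) \<partial>lborel)"
      by (subst nn_integral_cmult[symmetric]) (auto simp: ennreal_mult')
    finally show "ennreal (norm (\<bar>V x\<bar> * \<bar>defect s x\<bar>)) \<le> (\<integral>\<^sup>+y. ennreal (\<bar>V x\<bar> * (resolvent_gap s (x - y) * \<bar>VZ y\<bar>)) \<partial>lborel)" .
  qed
  also have "\<dots> = (\<integral>\<^sup>+y. (\<integral>\<^sup>+x. ennreal (\<bar>V x\<bar> * (resolvent_gap s (x - y) * \<bar>VZ y\<bar>)) \<partial>lborel) \<partial>lborel)"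
    by (rule lborel_pair.Fubini'[symmetric]) measurable
  also have "\<dots> \<le> (\<integral>\<^sup>+y. ennreal \<bar>VZ y\<bar> * ennreal (2 * gap_mass s) \<partial>lborel)"
  proof (rule nn_integral_mono)
    fix y :: "real^'n"
    have "resolvent_gap s (x - y) = resolvent_gap s (y - x)" for x
      by (simp add: resolvent_gap_def heat_def norm_minus_commute)
    then have "(\<integral>\<^sup>+x. ennreal (\<bar>V x\<bar> * (resolvent_gap s (x - y) * \<bar>VZ y\<bar>)) \<partial>lborel) = (\<integral>\<^sup>+x. ennreal \<bar>VZ y\<bar> * ennreal (resolvent_gap s (y - x) * \<bar>V x\<bar>) \<partial>lborel)"
      by (simp add: ennreal_mult'[symmetric] mult_ac)
    also have "\<dots> = ennreal \<bar>VZ y\<bar> * (\<integral>\<^sup>+x. ennreal (resolvent_gap s (y - x) * \<bar>V x\<bar>) \<partial>lborel)"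
      by (rule nn_integral_cmult) measurable
    also have "\<dots> \<le> ennreal \<bar>VZ y\<bar> * ennreal (2 * gap_mass s)" by (intro mult_left_mono gap_V_convolution_le s) simp
    finally show "(\<integral>\<^sup>+x. ennreal (\<bar>V x\<bar> * (resolvent_gap s (x - y) * \<bar>VZ y\<bar>)) \<partial>lborel) \<le> ennreal \<bar>VZ y\<bar> * ennreal (2 * gap_mass s)" .
  qed
  also have "\<dots> = (\<integral>\<^sup>+y. ennreal \<bar>VZ y\<bar> \<partial>lborel) * ennreal (2 * gap_mass s)"
    by (rule nn_integral_multc) measurable
  also have "(\<integral>\<^sup>+y. ennreal \<bar>VZ y\<bar> \<partial>lborel) = ennreal (LINT y|lborel. \<bar>VZ y\<bar>)"
    using nn_integral_eq_integral[OF integrable_norm[OF VZ_integrable]] by simp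
  also have "ennreal (LINT y|lborel. \<bar>VZ y\<bar>) * ennreal (2 * gap_mass s) = ennreal ?B"
    by (subst ennreal_mult'[symmetric]) (auto intro!: Bochner_Integration.integral_nonneg simp: mult_ac)
  finally have *: "(\<integral>\<^sup>+x. ennreal (norm (\<bar>V x\<bar> * \<bar>defect s x\<bar>)) \<partial>lborel) \<le> ennreal ?B" .
  show int: "integrable lborel (\<lambda>x. \<bar>V x\<bar> * \<bar>defect s x\<bar>)"
    by (rule integrableI_bounded) (use * in \<open>auto intro: le_less_trans\<close>)
  have "ennreal (LINT x|lborel. norm (\<bar>V x\<bar> * \<bar>defect s x\<bar>)) \<le> ennreal ?B"
    using * nn_integral_eq_integral[OF integrable_norm[OF int]] by simp
  then have "(LINT x|lborel. norm (\<bar>V x\<bar> * \<bar>defect s x\<bar>)) \<le> ?B" using B by (simp only: ennreal_le_iff)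
  then show "(LINT x|lborel. \<bar>V x\<bar> * \<bar>defect s x\<bar>) \<le> ?B" by simp
qed

text \<open>
  Divided by the rate, the gap tends to a constant \<open>\<kappa>\<close> off the diagonal.  By dominated convergence the defect
  divided by the rate tends to \<open>- \<kappa>\<close> times the integral of \<open>V \<Lambda>W\<close> at every point, and its pairing with \<open>V \<Lambda>W\<close> to
  \<open>- \<kappa>\<close> times the square of that integral.
\<close>
lemma defect_asymptotics:
  obtains c where "c > 0" "\<forall>\<^sub>F s in at_right 0. c * gap_rate CARD('n) s \<le> \<bar>LINT x|lborel. VZ x * defect s x\<bar>"
proof -
  obtain A where A: "A > 0" "\<And>s (z::real^'n). 0 < s \<Longrightarrow> s < 1 \<Longrightarrow> z \<noteq> 0 \<Longrightarrow> resolvent_gap s z \<le> A * gap_rate CARD('n) s * (1 + 1 / norm z)"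
    using resolvent_gap_le_rate[OF dim34] by blast
  obtain J where J: "J > 0" "\<And>x. integrable lborel (singular_majorant x)" "\<And>x. (LINT y|lborel. singular_majorant x y) \<le> J"
    using singular_majorant_integrable by blast
  obtain B where B: "B > 0" "\<And>s x. 0 < s \<Longrightarrow> s < 1 \<Longrightarrow> \<bar>defect s x\<bar> \<le> B * gap_rate CARD('n) s"
    using defect_le_rate by blast
  obtain \<kappa> where \<kappa>: "\<kappa> > 0" "\<And>(s::nat \<Rightarrow> real) (z::real^'n). s \<longlonglongrightarrow> 0 \<Longrightarrow> (\<And>i. 0 < s i) \<Longrightarrow> z \<noteq> 0 \<Longrightarrow> (\<lambda>i. resolvent_gap (s i) z / gap_rate CARD('n) (s i)) \<longlonglongrightarrow> \<kappa>"
    using resolvent_gap_asymptotics[OF dim34] by blast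
  define P where "P = (LINT y|lborel. VZ y)"
  have P: "P > 0" using VZ_integral_pos by (simp add: P_def)
  have r: "gap_rate CARD('n) s > 0" if "s > 0" for s using gap_rate_pos that dim34 by blast
  have lim: "(\<lambda>i. (LINT x|lborel. VZ x * defect (s i) x) / gap_rate CARD('n) (s i)) \<longlonglongrightarrow> - (\<kappa> * P * P)"
    if s: "s \<longlonglongrightarrow> 0" "\<And>i. 0 < s i" "\<And>i. s i < 1" for s
  proof -
    have inner: "(\<lambda>i. defect (s i) x / gap_rate CARD('n) (s i)) \<longlonglongrightarrow> - (\<kappa> * P)" for x
    proof -
      have "(\<lambda>i. LINT y|lborel. resolvent_gap (s i) (x - y) / gap_rate CARD('n) (s i) * VZ y) \<longlonglongrightarrow> (LINT y|lborel. \<kappa> * VZ y)"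
      proof (rule integral_dominated_convergence[where w = "\<lambda>y. A * singular_majorant x y"])
        show "integrable lborel (\<lambda>y. A * singular_majorant x y)" using J(2) by simp
        show "AE y in lborel. (\<lambda>i. resolvent_gap (s i) (x - y) / gap_rate CARD('n) (s i) * VZ y) \<longlonglongrightarrow> \<kappa> * VZ y"
          by (rule eventually_mono[OF AE_lborel_singleton[of x]]) (intro tendsto_mult tendsto_const \<kappa> s, simp)
        show "AE y in lborel. norm (resolvent_gap (s i) (x - y) / gap_rate CARD('n) (s i) * VZ y) \<le> A * singular_majorant x y" for i
        proof (rule eventually_mono[OF AE_lborel_singleton[of x]])
          fix y assume "y \<noteq> x"
          then have "resolvent_gap (s i) (x - y) \<le> A * gap_rate CARD('n) (s i) * (1 + 1 / norm (x - y))"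
            using s by (intro A) auto
          then have "resolvent_gap (s i) (x - y) / gap_rate CARD('n) (s i) \<le> A * (1 + 1 / norm (x - y))"
            using r[OF s(2), of i] by (simp add: field_simps)
          then have "resolvent_gap (s i) (x - y) / gap_rate CARD('n) (s i) * \<bar>VZ y\<bar> \<le> A * (1 + 1 / norm (x - y)) * \<bar>VZ y\<bar>"
            by (rule mult_right_mono) simp
          moreover have "0 \<le> resolvent_gap (s i) (x - y) / gap_rate CARD('n) (s i)"
            using r[OF s(2), of i] resolvent_gap_nonneg[of "s i" "x - y"] s(2)[of i] by simp
          ultimately show "norm (resolvent_gap (s i) (x - y) / gap_rate CARD('n) (s i) * VZ y) \<le> A * singular_majorant x y"
            by (simp only: real_norm_def abs_mult abs_of_nonneg singular_majorant_def mult.assoc)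
        qed
      qed measurable
      then have "(\<lambda>i. - (LINT y|lborel. resolvent_gap (s i) (x - y) / gap_rate CARD('n) (s i) * VZ y)) \<longlonglongrightarrow> - (\<kappa> * P)"
        by (intro tendsto_minus) (simp add: P_def)
      then show ?thesis by (simp add: defect_def)
    qed
    have "(\<lambda>i. LINT x|lborel. VZ x * (defect (s i) x / gap_rate CARD('n) (s i))) \<longlonglongrightarrow> (LINT x|lborel. VZ x * - (\<kappa> * P))"
    proof (rule integral_dominated_convergence[where w = "\<lambda>x. B * \<bar>VZ x\<bar>"])
      show "integrable lborel (\<lambda>x. B * \<bar>VZ x\<bar>)" using VZ_integrable by simp
      show "AE x in lborel. (\<lambda>i. VZ x * (defect (s i) x / gap_rate CARD('n) (s i))) \<longlonglongrightarrow> VZ x * - (\<kappa> * P)"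
        by (intro AE_I2 tendsto_mult tendsto_const inner)
      show "AE x in lborel. norm (VZ x * (defect (s i) x / gap_rate CARD('n) (s i))) \<le> B * \<bar>VZ x\<bar>" for i
      proof (rule AE_I2)
        fix x
        have "\<bar>defect (s i) x\<bar> / gap_rate CARD('n) (s i) \<le> B"
          using B(2)[OF s(2,3), of i x] r[OF s(2), of i] by (simp add: field_simps)
        then have "\<bar>defect (s i) x\<bar> / gap_rate CARD('n) (s i) * \<bar>VZ x\<bar> \<le> B * \<bar>VZ x\<bar>"
          by (rule mult_right_mono) simp
        then show "norm (VZ x * (defect (s i) x / gap_rate CARD('n) (s i))) \<le> B * \<bar>VZ x\<bar>"
          using r[OF s(2), of i] by (simp add: abs_mult mult_ac)
      qed
    qed measurable
    then show ?thesis by (simp add: P_def mult_ac)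
  qed
  define c where "c = \<kappa> * P * P / 2"
  have c: "c > 0" using \<kappa>(1) P by (simp add: c_def)
  show thesis
  proof (rule that[OF c], rule sequentially_imp_eventually_at_right[where b = 1])
    fix s :: "nat \<Rightarrow> real" assume s: "\<And>i. 0 < s i" "\<And>i. s i < 1" "s \<longlonglongrightarrow> 0"
    have "- (\<kappa> * P * P) < - c" using c unfolding c_def by linarith
    with lim[OF s(3,1,2)] have "\<forall>\<^sub>F i in sequentially. (LINT x|lborel. VZ x * defect (s i) x) / gap_rate CARD('n) (s i) < - c"
      by (rule order_tendstoD)
    then show "\<forall>\<^sub>F i in sequentially. c * gap_rate CARD('n) (s i) \<le> \<bar>LINT x|lborel. VZ x * defect (s i) x\<bar>"
    proof eventually_elim
      case (elim i)
      then have "(LINT x|lborel. VZ x * defect (s i) x) < - c * gap_rate CARD('n) (s i)"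
        using r[OF s(1), of i] by (simp add: field_simps)
      then show ?case by linarith
    qed
  qed simp
qed

lemma gap_mass_small: "e > 0 \<Longrightarrow> \<forall>\<^sub>F s in at_right 0. gap_mass s < e"
  by (rule sequentially_imp_eventually_at_right[where b = 1]) (auto intro: order_tendstoD(2)[OF gap_mass_tendsto_0])

section \<open>Duality\<close>

text \<open>
  The resolvent kernel is symmetric, so by Fubini's theorem the operator can be moved onto \<open>\<Lambda>W\<close>, where it produces the
  defect.
\<close>
lemma zpair_one_plus_RV:
  assumes f: "f \<in> admissible" and s: "s \<ge> 0"
  shows "integrable lborel (\<lambda>y. complex_of_real (V y) * f y * complex_of_real (defect s y))"
    and "zpair f + zpair (RV s f) = (LINT y|lborel. complex_of_real (V y) * f y * complex_of_real (defect s y))"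
proof -
  note [measurable] = admissibleD(1)[OF f]
  let ?B = "LINT y|lborel. Vwt y * norm (f y)"
  let ?h = "\<lambda>x y. complex_of_real (VZ x) * (complex_of_real (resolvent_kernel s (x - y)) * (complex_of_real (V y) * f y))"
  have int: "integrable (lborel \<Otimes>\<^sub>M lborel) (case_prod ?h)"
  proof (rule lborel_pair.Fubini_integrable)
    show "case_prod ?h \<in> borel_measurable (lborel \<Otimes>\<^sub>M lborel)" unfolding case_prod_beta by measurable
    show "AE x in lborel. integrable lborel (\<lambda>y. case_prod ?h (x, y))"
      using RV_integrable_and_bound(1)[OF f s] by simp
    show "integrable lborel (\<lambda>x. LINT y|lborel. norm (case_prod ?h (x, y)))"
    proof (rule Bochner_Integration.integrable_bound)
      show "integrable lborel (\<lambda>x. \<bar>VZ x\<bar> * ?B)" using VZ_integrable by simp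
      have B: "0 \<le> ?B" by (intro Bochner_Integration.integral_nonneg) auto
      show "AE x in lborel. norm (LINT y|lborel. norm (case_prod ?h (x, y))) \<le> norm (\<bar>VZ x\<bar> * ?B)"
      proof (rule AE_I2)
        fix x
        let ?I = "LINT y|lborel. norm (complex_of_real (resolvent_kernel s (x - y)) * (complex_of_real (V y) * f y))"
        have "?I \<le> decay x * ?B" by (rule RV_integrable_and_bound(3)[OF f s])
        also have "\<dots> \<le> 1 * ?B" using B by (intro mult_right_mono decay_le_1)
        finally have I: "?I \<le> ?B" by simp
        have "0 \<le> ?I" by (intro Bochner_Integration.integral_nonneg) auto
        moreover have "(LINT y|lborel. norm (case_prod ?h (x, y))) = \<bar>VZ x\<bar> * ?I" by (simp add: norm_mult)
        ultimately show "norm (LINT y|lborel. norm (case_prod ?h (x, y))) \<le> norm (\<bar>VZ x\<bar> * ?B)"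
          using I B by (auto simp: abs_mult intro!: mult_left_mono)
      qed
    qed measurable
  qed
  have k: "(LINT x|lborel. ?h x y) = complex_of_real (V y) * f y * RV s zmode y" for y
  proof -
    have "(LINT x|lborel. ?h x y) = (LINT x|lborel. complex_of_real (V y) * f y * (complex_of_real (resolvent_kernel s (y - x)) * (complex_of_real (V x) * zmode x)))"
      by (intro Bochner_Integration.integral_cong refl) (simp add: VZ_def resolvent_kernel_minus[of s _ y] mult_ac)
    then show ?thesis by (simp add: RV_def resolvent_def)
  qed
  have int2: "integrable lborel (\<lambda>y. complex_of_real (V y) * f y * RV s zmode y)"
    using lborel_pair.integrable_snd[OF int] unfolding k .
  have fub: "(LINT y|lborel. LINT x|lborel. ?h x y) = (LINT x|lborel. LINT y|lborel. ?h x y)"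
    by (rule lborel_pair.Fubini_integral[OF int])
  have p: "zpair (RV s f) = (LINT y|lborel. complex_of_real (V y) * f y * RV s zmode y)"
    using fub unfolding k by (simp add: zpair_def RV_def resolvent_def)
  have eq: "complex_of_real (VZ y) * f y + complex_of_real (V y) * f y * RV s zmode y = complex_of_real (V y) * f y * complex_of_real (defect s y)" for y
    unfolding defect_eq[OF s, symmetric] by (simp add: VZ_def distrib_left mult_ac)
  have "integrable lborel (\<lambda>y. complex_of_real (VZ y) * f y + complex_of_real (V y) * f y * RV s zmode y)"
    by (rule Bochner_Integration.integrable_add[OF VZ_mult_integrable[OF f] int2])
  then show "integrable lborel (\<lambda>y. complex_of_real (V y) * f y * complex_of_real (defect s y))" unfolding eq .
  have "zpair f + zpair (RV s f) = (LINT y|lborel. complex_of_real (VZ y) * f y + complex_of_real (V y) * f y * RV s zmode y)"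
    unfolding p unfolding zpair_def by (rule Bochner_Integration.integral_add[OF VZ_mult_integrable[OF f] int2, symmetric])
  then show "zpair f + zpair (RV s f) = (LINT y|lborel. complex_of_real (V y) * f y * complex_of_real (defect s y))" unfolding eq .
qed

end

lemma gap_rate_tendsto_0:
  assumes "n = 3 \<or> n = 4"
  shows "(gap_rate n \<longlongrightarrow> 0) (at_right 0)"
  using assms
proof
  assume n: "n = 3"
  have "((\<lambda>s. s powr (1 / 2)) \<longlongrightarrow> (0::real)) (at_right 0)" by real_asymp
  moreover have "\<forall>\<^sub>F s in at_right 0. s powr (1 / 2) = gap_rate n s"
    using eventually_at_right_less[of 0] by eventually_elim (simp add: gap_rate_3 n)
  ultimately show ?thesis by (rule Lim_transform_eventually)
next
  assume n: "n = 4"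
  have "((\<lambda>s. s * ln (1 + 1 / s)) \<longlongrightarrow> (0::real)) (at_right 0)" by real_asymp
  then show ?thesis unfolding n gap_rate_4[abs_def] .
qed

context critical_dimension
begin

section \<open>The contraction\<close>

text \<open>
  \<open>inner_part s f\<close> is the difference of the values at the centre and at \<open>x\<close>.  With it,
  \<open>1 + RV s\<close> is the operator \<open>1 - inner_part s\<close> plus the rank one map \<open>f \<mapsto> RV s f 0\<close>.
\<close>
definition inner_part :: "real \<Rightarrow> (real^'n \<Rightarrow> complex) \<Rightarrow> real^'n \<Rightarrow> complex" where
  "inner_part s f x = RV s f 0 - RV s f x"

abbreviation wgt :: "real^'n \<Rightarrow> real" where
  "wgt x \<equiv> weight CARD('n) (norm x)"

definition wmin :: real where
  "wmin = exp (- (real CARD('n) * (real CARD('n) + 2) / (real CARD('n) - 2)))"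

lemma wmin_pos: "wmin > 0" and wmin_le: "wmin \<le> wgt x" and wgt_le_1: "wgt x \<le> 1"
  using weight_ge[OF dim3] weight_le_1[OF dim3] by (simp_all add: wmin_def)

text \<open>
  With this bound the gap adds at most a quarter to the contraction factor one half.
\<close>
definition small_gap :: "real \<Rightarrow> bool" where
  "small_gap s \<longleftrightarrow> 0 \<le> s \<and> gap_mass s \<le> wmin / 16"

lemma bounded_radialD: "f \<in> bounded_radial \<Longrightarrow> f \<in> borel_measurable borel" "f \<in> bounded_radial \<Longrightarrow> radial_fun f"
  by (auto simp: bounded_radial_def)

lemma inner_part_bounded_radial:
  assumes "f \<in> bounded_radial" "s \<ge> 0"
  shows "inner_part s f \<in> bounded_radial"
  unfolding inner_part_def[abs_def]
  by (intro bounded_radial_diff bounded_radial_const RV_bounded_radial bounded_radial_admissible assms)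

lemma inner_part_contracts:
  assumes f: "f \<in> bounded_radial" and s: "small_gap s" and M: "\<And>y. norm (f y) \<le> M * wgt y"
  shows "norm (inner_part s f x) \<le> 3 / 4 * M * wgt x"
proof -
  have s0: "s \<ge> 0" and g: "gap_mass s \<le> wmin / 16" using s by (auto simp: small_gap_def)
  have M0: "M \<ge> 0"
  proof -
    have "0 * wgt 0 \<le> M * wgt 0" using norm_ge_zero[of "f 0"] M[of 0] by linarith
    then show ?thesis by (rule mult_right_le_imp_le[OF _ weight_pos])
  qed
  have fM: "norm (f y) \<le> M" for y
    using order_trans[OF M mult_left_mono[OF wgt_le_1 M0]] by simp
  have 1: "norm (RV 0 f 0 - RV 0 f x) \<le> M / 2 * wgt x"
    by (rule newton_difference_contracts[OF bounded_radialD[OF f] M])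
  have 2: "norm (RV s f y - RV 0 f y) \<le> 2 * gap_mass s * M" for y
    by (rule RV_minus_newton_le[OF f s0 fM])
  have 3: "2 * gap_mass s * M \<le> M / 8 * wgt x"
  proof -
    have "2 * gap_mass s * M \<le> 2 * (wmin / 16) * M" using g M0 by (intro mult_right_mono) auto
    also have "\<dots> = M / 8 * wmin" by simp
    also have "\<dots> \<le> M / 8 * wgt x" using M0 by (intro mult_left_mono wmin_le) auto
    finally show ?thesis .
  qed
  have dec: "inner_part s f x = (RV 0 f 0 - RV 0 f x) + (RV s f 0 - RV 0 f 0) - (RV s f x - RV 0 f x)"
    by (simp add: inner_part_def)
  have "norm (inner_part s f x) \<le> norm (RV 0 f 0 - RV 0 f x) + norm (RV s f 0 - RV 0 f 0) + norm (RV s f x - RV 0 f x)"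
    unfolding dec using norm_triangle_ineq4[of "(RV 0 f 0 - RV 0 f x) + (RV s f 0 - RV 0 f 0)" "RV s f x - RV 0 f x"]
      norm_triangle_ineq[of "RV 0 f 0 - RV 0 f x" "RV s f 0 - RV 0 f 0"] by linarith
  also have "\<dots> \<le> M / 2 * wgt x + M / 8 * wgt x + M / 8 * wgt x"
    by (intro add_mono 1 order_trans[OF 2 3])
  also have "\<dots> = 3 / 4 * M * wgt x" by (simp add: field_simps)
  finally show ?thesis .
qed

lemma inner_part_diff:
  assumes "f \<in> bounded_radial" "g \<in> bounded_radial" "s \<ge> 0"
  shows "inner_part s (\<lambda>y. f y - g y) x = inner_part s f x - inner_part s g x"
  using assms by (simp add: inner_part_def RV_diff bounded_radial_admissible)

lemma inner_part_add:
  assumes "f \<in> bounded_radial" "g \<in> bounded_radial" "s \<ge> 0"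
  shows "inner_part s (\<lambda>y. f y + g y) x = inner_part s f x + inner_part s g x"
  using assms by (simp add: inner_part_def RV_add bounded_radial_admissible)

text \<open>
  Iterating the contraction starting from any bound for \<open>f\<close> leaves only the geometric series in \<open>H\<close>; the division by
  \<open>wmin\<close> passes from the supremum norm to the weighted norm.
\<close>
lemma inner_equation_bound:
  assumes f: "f \<in> bounded_radial" and s: "small_gap s" and H: "\<And>x. norm (f x - inner_part s f x) \<le> H"
  shows "norm (f x) \<le> 4 / wmin * H"
proof -
  have H0: "H \<ge> 0" using H[of 0] norm_ge_zero order_trans by blast
  obtain M where M: "\<And>x. norm (f x) \<le> M" using f by (auto simp: bounded_radial_def)
  have M0: "M \<ge> 0" using M[of 0] norm_ge_zero order_trans by blast
  have it: "norm (f x) \<le> ((3 / 4) ^ n * (M / wmin) + 4 / wmin * H) * wgt x" for n x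
  proof (induction n arbitrary: x)
    case 0
    have "M = M / wmin * wmin" using wmin_pos by simp
    also have "\<dots> \<le> (M / wmin + 4 / wmin * H) * wgt x"
      using M0 H0 wmin_pos by (intro mult_mono wmin_le) auto
    finally show ?case using M[of x] by simp
  next
    case (Suc n)
    let ?M = "(3 / 4) ^ n * (M / wmin) + 4 / wmin * H"
    have "norm (f x) \<le> norm (f x - inner_part s f x) + norm (inner_part s f x)"
      using norm_triangle_ineq[of "f x - inner_part s f x" "inner_part s f x"] by simp
    also have "\<dots> \<le> H + 3 / 4 * ?M * wgt x" by (intro add_mono H inner_part_contracts[OF f s Suc])
    also have "\<dots> \<le> H / wmin * wgt x + 3 / 4 * ?M * wgt x"
      using mult_left_mono[OF wmin_le, of "H / wmin" x] H0 wmin_pos by simp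
    also have "H / wmin * wgt x + 3 / 4 * ?M * wgt x = ((3 / 4) ^ Suc n * (M / wmin) + 4 / wmin * H) * wgt x"
      by (simp add: field_simps)
    finally show ?case by simp
  qed
  have "(\<lambda>n. ((3 / 4) ^ n * (M / wmin) + 4 / wmin * H) * wgt x) \<longlonglongrightarrow> (0 * (M / wmin) + 4 / wmin * H) * wgt x"
    by (intro tendsto_intros LIMSEQ_power_zero) auto
  then have "norm (f x) \<le> (0 * (M / wmin) + 4 / wmin * H) * wgt x"
    by (rule Lim_bounded2) (use it in auto)
  also have "\<dots> \<le> 4 / wmin * H * 1"
    unfolding mult_zero_left add_0 using H0 wmin_pos wgt_le_1 by (intro mult_left_mono) auto
  finally show ?thesis by simp
qed

text \<open>The Neumann series.\<close>
lemma inner_equation_solvable: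
  assumes h: "h \<in> bounded_radial" and s: "small_gap s"
  obtains f where "f \<in> bounded_radial" "\<And>x. f x - inner_part s f x = h x"
proof -
  have s0: "s \<ge> 0" using s by (simp add: small_gap_def)
  obtain M0 where M0: "\<And>x. norm (h x) \<le> M0" using h by (auto simp: bounded_radial_def)
  have M00: "M0 \<ge> 0" using M0[of 0] norm_ge_zero order_trans by blast
  define M where "M = M0 / wmin"
  have M: "M \<ge> 0" using M00 wmin_pos by (simp add: M_def)
  have hM: "norm (h x) \<le> M * wgt x" for x
  proof -
    have "M0 = M * wmin" using wmin_pos by (simp add: M_def)
    also have "\<dots> \<le> M * wgt x" using M by (intro mult_left_mono wmin_le)
    finally show ?thesis using M0[of x] by simp
  qed
  define u where "u n = (inner_part s ^^ n) h" for n
  have u_Suc: "u (Suc n) = inner_part s (u n)" for n by (simp add: u_def)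
  have u_br: "u n \<in> bounded_radial" for n
    by (induction n) (simp add: u_def h, simp add: u_Suc inner_part_bounded_radial s0)
  have u_le: "norm (u n x) \<le> (3 / 4) ^ n * M * wgt x" for n x
  proof (induction n arbitrary: x)
    case 0
    then show ?case using hM by (simp add: u_def)
  next
    case (Suc n)
    have "norm (inner_part s (u n) x) \<le> 3 / 4 * ((3 / 4) ^ n * M) * wgt x"
      by (rule inner_part_contracts[OF u_br s Suc])
    then show ?case by (simp add: u_Suc)
  qed
  have u_le': "norm (u n x) \<le> (3 / 4) ^ n * M" for n x
  proof -
    have "(3 / 4) ^ n * M * wgt x \<le> (3 / 4) ^ n * M * 1" using M by (intro mult_left_mono wgt_le_1) auto
    from order_trans[OF u_le[of n x] this] show ?thesis by simp
  qed
  have geo: "summable (\<lambda>n. (3 / 4 :: real) ^ n * M)" by (intro summable_mult2 summable_geometric) simp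
  have summ: "summable (\<lambda>n. u n x)" for x
    by (rule summable_comparison_test'[OF geo]) (rule u_le')
  define f where "f x = (\<Sum>n. u n x)" for x
  define S where "S N x = (\<Sum>n<N. u n x)" for N x
  have S_br: "S N \<in> bounded_radial" for N
  proof (induction N)
    case 0
    then show ?case using bounded_radial_const[of 0] by (simp add: S_def[abs_def])
  next
    case (Suc N)
    have "S (Suc N) = (\<lambda>x. S N x + u N x)" by (simp add: S_def fun_eq_iff)
    then show ?case using bounded_radial_add[OF Suc u_br] by simp
  qed
  have tail: "norm (f x - S N x) \<le> (3 / 4) ^ N * (4 * M)" for N x
  proof -
    have "f x - S N x = (\<Sum>n. u (n + N) x)"
      using suminf_minus_initial_segment[OF summ[of x], of N] by (simp add: f_def S_def)
    also have "norm \<dots> \<le> (\<Sum>n. (3 / 4) ^ (n + N) * M)"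
    proof (rule order_trans[OF summable_norm suminf_le])
      have *: "summable (\<lambda>n. (3 / 4) ^ (n + N) * M)" using summable_ignore_initial_segment[OF geo, of N] .
      show n: "summable (\<lambda>n. norm (u (n + N) x))" by (rule summable_comparison_test'[OF *]) (simp add: u_le')
      show "summable (\<lambda>n. norm (u (n + N) x))" by fact
      show "summable (\<lambda>n. (3 / 4) ^ (n + N) * M)" by fact
    qed (rule u_le')
    also have "(\<Sum>n. (3 / 4) ^ (n + N) * M) = (\<Sum>n. (3 / 4) ^ n * ((3 / 4) ^ N * M))" by (simp add: power_add mult_ac)
    also have "\<dots> = (\<Sum>n. (3 / 4) ^ n) * ((3 / 4) ^ N * M)"
      by (rule suminf_mult2[symmetric]) (simp add: summable_geometric)
    also have "(\<Sum>n. (3 / 4 :: real) ^ n) = 4" by (subst suminf_geometric) auto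
    finally show ?thesis by (simp add: mult_ac)
  qed
  have f_br: "f \<in> bounded_radial"
  proof (rule bounded_radialI)
    show "f \<in> borel_measurable borel"
      unfolding f_def[abs_def] using bounded_radialD(1)[OF u_br] by (intro borel_measurable_suminf)
    show "radial_fun f"
      unfolding radial_fun_def
    proof (intro allI impI)
      fix x y :: "real^'n" assume "norm x = norm y"
      then have "u n x = u n y" for n by (rule radial_funD[OF bounded_radialD(2)[OF u_br]])
      then show "f x = f y" by (simp add: f_def)
    qed
    show "norm (f x) \<le> 4 * M" for x using tail[of x 0] by (simp add: S_def)
  qed
  have TS: "inner_part s (S N) x = S (Suc N) x - h x" for N x
  proof (induction N)
    case 0
    have "inner_part s (\<lambda>x. 0) x = 0" by (simp add: inner_part_def RV_def resolvent_def)
    then show ?case by (simp add: S_def[abs_def] u_def)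
  next
    case (Suc N)
    have "S (Suc N) = (\<lambda>x. S N x + u N x)" by (simp add: S_def fun_eq_iff)
    then have step: "inner_part s (S (Suc N)) x = inner_part s (S N) x + u (Suc N) x"
      using inner_part_add[OF S_br u_br s0] by (simp add: u_Suc)
    show ?case unfolding step Suc by (simp add: S_def)
  qed
  have "f x - inner_part s f x = h x" for x
  proof -
    have 1: "(\<lambda>N. (3 / 4) ^ N * (4 * M)) \<longlonglongrightarrow> 0 * (4 * M)"
      by (intro tendsto_intros LIMSEQ_power_zero) auto
    have "(\<lambda>N. f x - S N x) \<longlonglongrightarrow> 0"
      by (rule Lim_null_comparison[OF _ 1[unfolded mult_zero_left]]) (use tail in auto)
    then have "(\<lambda>N. f x - (f x - S N x)) \<longlonglongrightarrow> f x - 0" by (intro tendsto_intros)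
    then have S_lim: "(\<lambda>N. S N x) \<longlonglongrightarrow> f x" by simp
    have close: "norm (inner_part s f x - (S (Suc N) x - h x)) \<le> (3 / 4) ^ N * (4 * M / wmin)" for N
    proof -
      have *: "norm (f y - S N y) \<le> (3 / 4) ^ N * (4 * M / wmin) * wgt y" for y
      proof -
        have "(3 / 4) ^ N * (4 * M) = (3 / 4) ^ N * (4 * M / wmin) * wmin" using wmin_pos by simp
        also have "\<dots> \<le> (3 / 4) ^ N * (4 * M / wmin) * wgt y" using M wmin_pos by (intro mult_left_mono wmin_le) auto
        finally show ?thesis using tail[of y N] by simp
      qed
      have "norm (inner_part s (\<lambda>y. f y - S N y) x) \<le> 3 / 4 * ((3 / 4) ^ N * (4 * M / wmin)) * wgt x"
        by (rule inner_part_contracts[OF bounded_radial_diff[OF f_br S_br] s *])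
      also have "\<dots> \<le> 1 * ((3 / 4) ^ N * (4 * M / wmin)) * 1"
        using M wmin_pos wgt_le_1 by (intro mult_mono) (auto simp: less_imp_le)
      finally show ?thesis using inner_part_diff[OF f_br S_br s0] TS by simp
    qed
    have 2: "(\<lambda>N. (3 / 4) ^ N * (4 * M / wmin)) \<longlonglongrightarrow> 0 * (4 * M / wmin)"
      by (intro tendsto_intros LIMSEQ_power_zero) auto
    have "(\<lambda>N. inner_part s f x - (S (Suc N) x - h x)) \<longlonglongrightarrow> 0"
      by (rule Lim_null_comparison[OF always_eventually[OF allI[OF close]] 2[unfolded mult_zero_left]])
    moreover have "(\<lambda>N. inner_part s f x - (S (Suc N) x - h x)) \<longlonglongrightarrow> inner_part s f x - (f x - h x)"
      by (intro tendsto_intros LIMSEQ_Suc S_lim)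
    ultimately have "inner_part s f x - (f x - h x) = 0" by (intro LIMSEQ_unique)
    then show ?thesis by (simp add: algebra_simps)
  qed
  then show thesis using that f_br by blast
qed

section \<open>The estimate for bounded functions\<close>

lemma RV_bounded_le:
  assumes f: "f \<in> bounded_radial" and s: "s \<ge> 0" and M: "\<And>y. norm (f y) \<le> M"
  shows "norm (RV s f x) \<le> (LINT y|lborel. Vwt y) * M * decay x"
proof -
  have "norm (RV s f x) \<le> decay x * (LINT y|lborel. Vwt y * norm (f y))"
    by (rule RV_integrable_and_bound(2)[OF bounded_radial_admissible[OF f] s])
  also have "\<dots> \<le> decay x * ((LINT y|lborel. Vwt y) * M)"
    by (intro mult_left_mono bounded_radial_Vwt_le(2) bounded_radialD(1) f M) (simp add: less_imp_le)
  finally show ?thesis by (simp add: mult_ac)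
qed

text \<open>
  The a priori estimate.  A multiple of the zero mode is split off so that the remainder \<open>w\<close> satisfies
  the inner equation up to the defect; the size of the multiple is read off from the duality identity,
  in which the zero mode contributes a term of the exact order of \<open>gap_rate\<close>.
\<close>
lemma bounded_a_priori:
  obtains C where "C > 0"
    "\<forall>\<^sub>F s in at_right 0. 0 < s \<and> small_gap s \<and> gap_rate CARD('n) s \<le> 1 \<and>
      (\<forall>v \<in> bounded_radial. \<forall>H. (\<forall>x. norm (v x + RV s v x) \<le> H * decay x) \<longrightarrow>
        (\<forall>x. norm (v x) \<le> C * (H + norm (zpair (\<lambda>x. v x + RV s v x)) / gap_rate CARD('n) s)))"
proof -
  obtain CZ where CZ: "CZ > 0" "\<And>x. norm (zmode x) \<le> CZ * decay x" using zmode_bound by blast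
  obtain CD where CD: "CD > 0" "\<And>s x. 0 < s \<Longrightarrow> s < 1 \<Longrightarrow> \<bar>defect s x\<bar> \<le> CD * gap_rate CARD('n) s" using defect_le_rate by blast
  obtain c where c: "c > 0" "\<forall>\<^sub>F s in at_right 0. c * gap_rate CARD('n) s \<le> \<bar>LINT x|lborel. VZ x * defect s x\<bar>" using defect_asymptotics by blast
  define z0 where "z0 = LambdaW (0::real^'n)"
  have z0: "z0 \<noteq> 0" using zmode_0 by (simp add: z0_def)
  define A where "A = (LINT y|lborel. Vwt y)"
  have A: "A \<ge> 0" unfolding A_def by (intro Bochner_Integration.integral_nonneg) auto
  define Vd where "Vd = (LINT y|lborel. \<bar>V (y::real^'n)\<bar> * decay y)"
  have Vd: "Vd \<ge> 0" unfolding Vd_def by (intro Bochner_Integration.integral_nonneg) (auto simp: less_imp_le)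
  define Fz where "Fz = (LINT y|lborel. \<bar>VZ y\<bar>)"
  have Fz: "Fz \<ge> 0" unfolding Fz_def by (intro Bochner_Integration.integral_nonneg) auto
  define C1 where "C1 = 4 / wmin"
  have C1: "C1 > 0" using wmin_pos by (simp add: C1_def)
  define K1 where "K1 = (1 + A * C1) * CD * Vd"
  have K1: "K1 \<ge> 0" using A C1 CD(1) Vd by (simp add: K1_def)
  define K2 where "K2 = A * C1 * (2 * CD) * CD * Vd"
  have K2: "K2 \<ge> 0" using A C1 CD(1) Vd by (simp add: K2_def)
  define K3 where "K3 = CD * (2 * Fz)"
  have K3: "K3 \<ge> 0" using CD(1) Fz by (simp add: K3_def)
  define D1 where "D1 = C1 * (2 * CD) + CZ"
  have D1: "D1 > 0" using C1 CD CZ by (simp add: D1_def add_pos_pos)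
  define C where "C = C1 + D1 * (2 / c) * (1 + K1)"
  have Cpos: "C > 0" using C1 D1 c(1) K1 by (simp add: C_def add_pos_nonneg)
  have rate_lim: "\<forall>\<^sub>F s in at_right 0. gap_rate CARD('n) s < e" if "e > 0" for e
    using order_tendstoD(2)[OF gap_rate_tendsto_0[OF dim34] that] .
  have "\<forall>\<^sub>F s in at_right 0. s < (1::real)" by (rule eventually_at_right_real[of 0 1, THEN eventually_mono]) auto
  moreover have "\<forall>\<^sub>F s in at_right 0. gap_mass s < wmin / 16" by (rule gap_mass_small) (use wmin_pos in simp)
  moreover have "\<forall>\<^sub>F s in at_right 0. gap_mass s < c / (4 * (K3 + 1))" by (rule gap_mass_small) (use c K3 in simp)
  moreover have "\<forall>\<^sub>F s in at_right 0. gap_rate CARD('n) s < c / (4 * (K2 + 1))" by (rule rate_lim) (use c K2 in simp)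
  moreover have "\<forall>\<^sub>F s in at_right 0. gap_rate CARD('n) s < 1" by (rule rate_lim) simp
  moreover note c(2) eventually_at_right_less[of 0]
  ultimately have "\<forall>\<^sub>F s in at_right 0. 0 < s \<and> small_gap s \<and> gap_rate CARD('n) s \<le> 1 \<and>
      (\<forall>v \<in> bounded_radial. \<forall>H. (\<forall>x. norm (v x + RV s v x) \<le> H * decay x) \<longrightarrow>
        (\<forall>x. norm (v x) \<le> C * (H + norm (zpair (\<lambda>x. v x + RV s v x)) / gap_rate CARD('n) s)))"
  proof eventually_elim
    case (elim s)
    then have s: "0 < s" "s < 1" "0 \<le> s" by auto
    let ?r = "gap_rate CARD('n) s"
    have r: "?r > 0" using gap_rate_pos[OF s(1)] dim34 by blast
    have sg: "small_gap s" using elim s by (simp add: small_gap_def)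
    have def_le: "\<bar>defect s x\<bar> \<le> CD * ?r" for x by (rule CD(2)[OF s(1,2)])
    have smallness: "K2 * ?r + K3 * gap_mass s \<le> c / 2"
    proof -
      have "K2 * ?r \<le> (K2 + 1) * (c / (4 * (K2 + 1)))" using elim K2 r by (intro mult_mono) auto
      moreover have "K3 * gap_mass s \<le> (K3 + 1) * (c / (4 * (K3 + 1)))"
        using elim K3 gap_mass_nonneg[OF s(3)] by (intro mult_mono) auto
      moreover have q: "(K + 1) * (c / (4 * (K + 1))) = c / 4" if "K \<ge> 0" for K
      proof -
        define L where "L = K + 1"
        have "L \<noteq> 0" using that by (simp add: L_def)
        then show ?thesis unfolding L_def[symmetric] by simp
      qed
      ultimately show ?thesis using q[OF K2] q[OF K3] by linarith
    qed
    have main: "norm (v x) \<le> C * (H + norm (zpair (\<lambda>x. v x + RV s v x)) / ?r)"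
      if v: "v \<in> bounded_radial" and H: "\<And>x. norm (v x + RV s v x) \<le> H * decay x" for v H x
    proof -
      (* With this multiple of the zero mode, RV s w 0 is of the order of the defect. *)
      define b where "b = RV s v 0 / complex_of_real z0"
      define w where "w x = v x + b * zmode x" for x
      define p where "p = norm (zpair (\<lambda>x. v x + RV s v x))"
      have H0: "0 \<le> H"
      proof -
        have "0 \<le> H * decay 0" using norm_ge_zero[of "v 0 + RV s v 0"] H[of 0] by linarith
        then show ?thesis using decay_pos[of 0] by (simp add: zero_le_mult_iff)
      qed
      have bz: "(\<lambda>x. b * zmode x) \<in> bounded_radial" by (rule bounded_radial_cmult[OF zmode_bounded_radial])
      have w_br: "w \<in> bounded_radial" unfolding w_def[abs_def] by (rule bounded_radial_add[OF v bz])
      have RVw: "RV s w x = RV s v x + b * RV s zmode x" for x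
        unfolding w_def[abs_def] RV_add[OF bounded_radial_admissible[OF v] bounded_radial_admissible[OF bz] s(3)] RV_cmult ..
      have RVz: "RV s zmode x = complex_of_real (defect s x) - zmode x" for x
        using defect_eq[OF s(3), of x] by (simp add: algebra_simps)
      have w_eq: "w x + RV s w x = v x + RV s v x + b * complex_of_real (defect s x)" for x
        unfolding RVw RVz by (simp add: w_def algebra_simps)
      have "w x - inner_part s w x = (v x + RV s v x) + b * (complex_of_real (defect s x) - complex_of_real (defect s 0))" for x
      proof -
        have "RV s w 0 = b * complex_of_real (defect s 0)"
        proof -
          have bz0: "RV s v 0 = b * complex_of_real z0" using z0 by (simp add: b_def)
          show ?thesis unfolding RVw RVz bz0 z0_def[symmetric] by (simp add: algebra_simps)
        qed
        then show ?thesis using w_eq[of x] by (simp add: inner_part_def algebra_simps)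
      qed
      moreover have "norm ((v x + RV s v x) + b * (complex_of_real (defect s x) - complex_of_real (defect s 0))) \<le> H + norm b * (2 * CD * ?r)" for x
      proof (rule norm_triangle_mono)
        show "norm (v x + RV s v x) \<le> H" using order_trans[OF H mult_left_mono[OF decay_le_1 H0]] by simp
        have "norm (complex_of_real (defect s x) - complex_of_real (defect s 0)) \<le> 2 * CD * ?r"
          using def_le[of x] def_le[of 0] unfolding of_real_diff[symmetric] norm_of_real by linarith
        then show "norm (b * (complex_of_real (defect s x) - complex_of_real (defect s 0))) \<le> norm b * (2 * CD * ?r)"
          unfolding norm_mult by (rule mult_left_mono) simp
      qed
      ultimately have "norm (w x - inner_part s w x) \<le> H + norm b * (2 * CD * ?r)" for x by simp
      from inner_equation_bound[OF w_br sg this]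
      have w_le: "norm (w x) \<le> C1 * (H + norm b * (2 * CD * ?r))" for x unfolding C1_def .
      define Wb where "Wb = C1 * (H + norm b * (2 * CD * ?r))"
      have Wb: "Wb \<ge> 0" using w_le[of 0] norm_ge_zero order_trans unfolding Wb_def by blast
      (* The supremum bound for w is improved to decay, which makes the integral against V converge. *)
      have w_pt: "norm (w x) \<le> (H + A * Wb) * decay x + norm b * \<bar>defect s x\<bar>" for x
      proof -
        have "w x = (v x + RV s v x) - RV s w x + b * complex_of_real (defect s x)"
          using w_eq[of x] by (simp add: algebra_simps)
        also have "norm \<dots> \<le> norm (v x + RV s v x) + norm (RV s w x) + norm (b * complex_of_real (defect s x))"
          by (intro norm_triangle_mono norm_triangle_ineq4) simp
        also have "\<dots> \<le> H * decay x + A * Wb * decay x + norm b * \<bar>defect s x\<bar>"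
          using w_le RV_bounded_le[OF w_br s(3), of Wb x] H[of x] unfolding A_def Wb_def
          by (intro add_mono) (auto simp: norm_mult)
        finally show ?thesis by (simp add: distrib_right)
      qed
      have iw: "integrable lborel (\<lambda>y. complex_of_real (V y) * w y * complex_of_real (defect s y))"
        by (rule zpair_one_plus_RV(1)[OF bounded_radial_admissible[OF w_br] s(3)])
      have ib: "integrable lborel (\<lambda>y. b * (complex_of_real (V y) * zmode y * complex_of_real (defect s y)))"
        using zpair_one_plus_RV(1)[OF bounded_radial_admissible[OF zmode_bounded_radial] s(3)] by simp
      have w_int: "norm (LINT y|lborel. complex_of_real (V y) * w y * complex_of_real (defect s y))
          \<le> (H + A * Wb) * (CD * ?r) * Vd + norm b * (CD * ?r) * (2 * gap_mass s * Fz)"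
      proof -
        have "norm (LINT y|lborel. complex_of_real (V y) * w y * complex_of_real (defect s y))
            \<le> (LINT y|lborel. norm (complex_of_real (V y) * w y * complex_of_real (defect s y)))"
          by (rule integral_norm_bound)
        also have "\<dots> \<le> (LINT y|lborel. (H + A * Wb) * (CD * ?r) * (\<bar>V y\<bar> * decay y) + norm b * (CD * ?r) * (\<bar>V y\<bar> * \<bar>defect s y\<bar>))"
        proof (rule integral_mono)
          show "integrable lborel (\<lambda>y. norm (complex_of_real (V y) * w y * complex_of_real (defect s y)))" using iw by simp
          show "integrable lborel (\<lambda>y. (H + A * Wb) * (CD * ?r) * (\<bar>V y\<bar> * decay y) + norm b * (CD * ?r) * (\<bar>V y\<bar> * \<bar>defect s y\<bar>))"
            using V_decay_integrable V_defect_le(1)[OF s(3)] by simp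
          fix y
          have "norm (complex_of_real (V y) * w y * complex_of_real (defect s y)) = \<bar>V y\<bar> * \<bar>defect s y\<bar> * norm (w y)"
            by (simp add: norm_mult mult_ac)
          also have "\<dots> \<le> \<bar>V y\<bar> * \<bar>defect s y\<bar> * ((H + A * Wb) * decay y + norm b * \<bar>defect s y\<bar>)"
            by (intro mult_left_mono w_pt) simp
          also have "\<dots> = (H + A * Wb) * (\<bar>V y\<bar> * decay y) * \<bar>defect s y\<bar> + norm b * (\<bar>V y\<bar> * \<bar>defect s y\<bar>) * \<bar>defect s y\<bar>"
            by (simp add: algebra_simps)
          also have "\<dots> \<le> (H + A * Wb) * (\<bar>V y\<bar> * decay y) * (CD * ?r) + norm b * (\<bar>V y\<bar> * \<bar>defect s y\<bar>) * (CD * ?r)"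
            using H0 A Wb by (intro add_mono mult_left_mono def_le) (auto simp: less_imp_le)
          finally show "norm (complex_of_real (V y) * w y * complex_of_real (defect s y))
            \<le> (H + A * Wb) * (CD * ?r) * (\<bar>V y\<bar> * decay y) + norm b * (CD * ?r) * (\<bar>V y\<bar> * \<bar>defect s y\<bar>)"
            by (simp add: mult_ac)
        qed
        also have "\<dots> = (H + A * Wb) * (CD * ?r) * Vd + norm b * (CD * ?r) * (LINT y|lborel. \<bar>V y\<bar> * \<bar>defect s y\<bar>)"
          using V_decay_integrable V_defect_le(1)[OF s(3)] by (simp add: Vd_def)
        also have "\<dots> \<le> (H + A * Wb) * (CD * ?r) * Vd + norm b * (CD * ?r) * (2 * gap_mass s * Fz)"
          using V_defect_le(2)[OF s(3)] CD(1) r unfolding Fz_def by (intro add_left_mono mult_left_mono) auto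
        finally show ?thesis .
      qed
      have dual: "zpair (\<lambda>x. v x + RV s v x) = (LINT y|lborel. complex_of_real (V y) * w y * complex_of_real (defect s y))
          - b * complex_of_real (LINT y|lborel. VZ y * defect s y)"
      proof -
        have "zpair (\<lambda>x. v x + RV s v x) = zpair v + zpair (RV s v)"
          unfolding zpair_def distrib_left
          by (intro Bochner_Integration.integral_add VZ_mult_integrable bounded_radial_admissible v RV_bounded_radial s)
        also have "\<dots> = (LINT y|lborel. complex_of_real (V y) * v y * complex_of_real (defect s y))"
          by (rule zpair_one_plus_RV(2)[OF bounded_radial_admissible[OF v] s(3)])
        also have "\<dots> = (LINT y|lborel. complex_of_real (V y) * w y * complex_of_real (defect s y) - b * (complex_of_real (V y) * zmode y * complex_of_real (defect s y)))"
          by (intro Bochner_Integration.integral_cong refl) (simp add: w_def algebra_simps)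
        also have "\<dots> = (LINT y|lborel. complex_of_real (V y) * w y * complex_of_real (defect s y)) - (LINT y|lborel. b * (complex_of_real (V y) * zmode y * complex_of_real (defect s y)))"
          by (rule Bochner_Integration.integral_diff[OF iw ib])
        also have "(LINT y|lborel. b * (complex_of_real (V y) * zmode y * complex_of_real (defect s y))) = b * (LINT y|lborel. complex_of_real (VZ y * defect s y))"
          by (simp add: VZ_def)
        also have "(LINT y|lborel. complex_of_real (VZ y * defect s y)) = complex_of_real (LINT y|lborel. VZ y * defect s y)"
          by (rule integral_complex_of_real)
        finally show ?thesis .
      qed
      (* The duality identity is solved for b; the terms in b on the right have small coefficients. *)
      have "norm b * (c * ?r) \<le> norm b * \<bar>LINT y|lborel. VZ y * defect s y\<bar>"
        using elim by (intro mult_left_mono) auto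
      also have "\<dots> = norm (b * complex_of_real (LINT y|lborel. VZ y * defect s y))" by (simp add: norm_mult)
      also have "b * complex_of_real (LINT y|lborel. VZ y * defect s y) = (LINT y|lborel. complex_of_real (V y) * w y * complex_of_real (defect s y)) - zpair (\<lambda>x. v x + RV s v x)"
        using dual by simp
      also have "norm \<dots> \<le> norm (LINT y|lborel. complex_of_real (V y) * w y * complex_of_real (defect s y)) + p"
        unfolding p_def by (rule norm_triangle_ineq4)
      also have "\<dots> \<le> ((H + A * Wb) * (CD * ?r) * Vd + norm b * (CD * ?r) * (2 * gap_mass s * Fz)) + p"
        using w_int by simp
      also have "\<dots> = ?r * (K1 * H + norm b * (K2 * ?r + K3 * gap_mass s)) + p"
        unfolding Wb_def K1_def K2_def K3_def by (simp add: algebra_simps)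
      also have "\<dots> \<le> ?r * (K1 * H + norm b * (c / 2)) + p"
        using smallness r by (intro add_right_mono mult_left_mono add_left_mono) auto
      finally have "?r * (norm b * (c / 2)) \<le> ?r * (K1 * H) + p" by (simp add: algebra_simps)
      then have "norm b * (c / 2) \<le> K1 * H + p / ?r" using r by (simp add: field_simps)
      then have nb: "norm b \<le> 2 / c * (K1 * H + p / ?r)" using c(1) by (simp add: field_simps)
      have pr: "0 \<le> p / ?r" using r by (simp add: p_def)
      have "norm (v x) = norm (w x - b * zmode x)" by (simp add: w_def)
      also have "\<dots> \<le> norm (w x) + norm b * norm (zmode x)" unfolding norm_mult[symmetric] by (rule norm_triangle_ineq4)
      also have "\<dots> \<le> C1 * (H + norm b * (2 * CD * 1)) + norm b * (CZ * 1)"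
      proof (intro add_mono mult_left_mono)
        have "norm b * (2 * CD * ?r) \<le> norm b * (2 * CD * 1)" using elim CD(1) by (intro mult_left_mono) auto
        then have "C1 * (H + norm b * (2 * CD * ?r)) \<le> C1 * (H + norm b * (2 * CD * 1))" using C1 by (intro mult_left_mono[OF add_left_mono]) simp_all
        then show "norm (w x) \<le> C1 * (H + norm b * (2 * CD * 1))" using w_le[of x] by linarith
        show "norm (zmode x) \<le> CZ * 1" using order_trans[OF CZ(2) mult_left_mono[OF decay_le_1]] CZ(1) by simp
      qed simp
      also have "\<dots> = C1 * H + D1 * norm b" by (simp add: D1_def algebra_simps)
      also have "\<dots> \<le> C1 * (H + p / ?r) + D1 * (2 / c * ((1 + K1) * (H + p / ?r)))"
      proof (intro add_mono mult_left_mono)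
        have "K1 * H + p / ?r \<le> (1 + K1) * (H + p / ?r)" 
        proof -
          have "K1 * H + t \<le> (1 + K1) * (H + t)" if "0 \<le> t" for t
            using K1 H0 mult_nonneg_nonneg[OF K1 that] by (simp add: algebra_simps)
          then show ?thesis using pr .
        qed
        then have "2 / c * (K1 * H + p / ?r) \<le> 2 / c * ((1 + K1) * (H + p / ?r))" using c(1) by (intro mult_left_mono) auto
        then show "norm b \<le> 2 / c * ((1 + K1) * (H + p / ?r))" using nb by linarith
      qed (use pr C1 D1 in auto)
      also have "\<dots> = C * (H + p / ?r)" unfolding C_def by (simp only: distrib_right mult.assoc)
      finally show ?thesis unfolding p_def .
    qed
    show ?case using s sg elim main by auto
  qed
  then show thesis using that[OF Cpos] by blast
qed

text \<open>
  Add to the solution \<open>w\<close> of the inner equation the right multiple of the solution \<open>u\<close> for the right-hand side 1.  The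
  operator maps \<open>u\<close> to a constant \<open>e\<close>, which injectivity keeps away from 0.
\<close>
lemma bounded_solvable:
  assumes s: "small_gap s" "0 \<le> s"
    and inj: "\<And>v. v \<in> bounded_radial \<Longrightarrow> (\<And>x. v x + RV s v x = 0) \<Longrightarrow> (\<And>x. v x = 0)"
    and h: "h \<in> bounded_radial"
  obtains v where "v \<in> bounded_radial" "\<And>x. v x + RV s v x = h x"
proof -
  obtain w where w: "w \<in> bounded_radial" "\<And>x. w x - inner_part s w x = h x"
    using inner_equation_solvable[OF h s(1)] by blast
  obtain u where u: "u \<in> bounded_radial" "\<And>x. u x - inner_part s u x = 1"
    using inner_equation_solvable[OF bounded_radial_const s(1)] by blast
  define e where "e = 1 + RV s u 0"
  have u_eq: "u x + RV s u x = e" for x using u(2)[of x] by (simp add: inner_part_def e_def algebra_simps)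
  have w_eq: "w x + RV s w x = h x + RV s w 0" for x using w(2)[of x] by (simp add: inner_part_def algebra_simps)
  have e: "e \<noteq> 0"
  proof
    assume "e = 0"
    then have "u 0 = 0" using inj[OF u(1)] u_eq by simp
    then show False using u(2)[of 0] by (simp add: inner_part_def)
  qed
  define a where "a = RV s w 0 / e"
  have au: "(\<lambda>x. a * u x) \<in> bounded_radial" by (rule bounded_radial_cmult[OF u(1)])
  show thesis
  proof (rule that)
    show "(\<lambda>x. w x - a * u x) \<in> bounded_radial" by (rule bounded_radial_diff[OF w(1) au])
    fix x
    have "(w x - a * u x) + RV s (\<lambda>x. w x - a * u x) x = (w x + RV s w x) - a * (u x + RV s u x)"
      unfolding RV_diff[OF bounded_radial_admissible[OF w(1)] bounded_radial_admissible[OF au] s(2)] RV_cmult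
      by (simp add: algebra_simps)
    also have "\<dots> = h x" unfolding w_eq u_eq using e by (simp add: a_def)
    finally show "(w x - a * u x) + RV s (\<lambda>x. w x - a * u x) x = h x" .
  qed
qed

end

section \<open>Borel representatives of radial classes\<close>

lemma AE_norm_pullback:
  assumes [measurable]: "Measurable.pred borel P" and "AE r in lborel. P r"
  shows "AE x in (lborel :: 'a::euclidean_space measure). P (norm x)"
proof -
  have "AE r in distr lborel borel (norm :: 'a \<Rightarrow> real). P r"
    unfolding distr_norm_lborel using assms(2) by (subst AE_density) auto
  then show ?thesis by (subst (asm) AE_distr_iff) auto
qed

text \<open>
  The profile in the definition of \<open>radial\<close> need not be measurable.  By Fubini the values of \<open>f\<close> along
  almost every ray agree with it almost everywhere, and these values form a Borel profile.
\<close>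
lemma radial_borel_representative:
  fixes f :: "real^'n \<Rightarrow> complex"
  assumes [measurable]: "f \<in> borel_measurable borel" and "radial f"
  obtains f' where "f' \<in> borel_measurable borel" "radial_fun f'" "ae_eq f f'"
proof -
  obtain g where g: "AE x in lborel. f x = g (norm x)"
    using assms(2) by (auto simp: radial_def ae_eq_def)
  obtain N where N: "{x \<in> space lborel. \<not> f x = g (norm x)} \<subseteq> N" "emeasure lborel N = 0" "N \<in> sets lborel"
    using AE_E[OF g] by blast
  have N_meas [measurable]: "N \<in> sets borel" using N(3) by simp
  have notN: "AE x in lborel. x \<notin> N" using N by (intro AE_not_in) auto
  have fg: "f x = g (norm x)" if "x \<notin> N" for x using N(1) that by auto
  have scale: "AE x in lborel. l > 0 \<longrightarrow> l *\<^sub>R x \<notin> N" for l :: real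
  proof (cases "l > 0")
    case True
    have "lborel = density (distr lborel borel (\<lambda>x::real^'n. 0 + l *\<^sub>R x)) (\<lambda>_. \<bar>l\<bar> ^ DIM(real^'n))"
      using True by (intro lborel_affine) auto
    then have "AE x in density (distr lborel borel (\<lambda>x::real^'n. 0 + l *\<^sub>R x)) (\<lambda>_. \<bar>l\<bar> ^ DIM(real^'n)). x \<notin> N"
      using notN by metis
    then have "AE x in distr lborel borel (\<lambda>x::real^'n. 0 + l *\<^sub>R x). x \<notin> N"
      using True by (subst (asm) AE_density) auto
    then show ?thesis by (subst (asm) AE_distr_iff) auto
  qed simp
  have "AE x in (lborel :: (real^'n) measure). AE l in (lborel :: real measure). l > 0 \<longrightarrow> l *\<^sub>R x \<notin> N"
  proof (subst lborel_pair.AE_commute[symmetric])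
    show "{p \<in> space (lborel \<Otimes>\<^sub>M lborel). fst p > (0::real) \<longrightarrow> fst p *\<^sub>R (snd p :: real^'n) \<notin> N} \<in> sets (lborel \<Otimes>\<^sub>M lborel)"
      by measurable
    show "AE l in lborel. AE x in lborel. (l::real) > 0 \<longrightarrow> l *\<^sub>R (x::real^'n) \<notin> N"
      using scale by simp
  qed
  then have ae: "AE x in (lborel :: (real^'n) measure). x \<noteq> 0 \<and> (AE l in (lborel :: real measure). l > 0 \<longrightarrow> l *\<^sub>R x \<notin> N)"
    using AE_lborel_singleton[of "0::real^'n"] by eventually_elim simp
  have "\<exists>x0::real^'n. x0 \<noteq> 0 \<and> (AE l in (lborel :: real measure). l > 0 \<longrightarrow> l *\<^sub>R x0 \<notin> N)"
  proof (rule ccontr)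
    assume "\<not> ?thesis"
    then have "AE x in (lborel :: (real^'n) measure). False" using ae by (auto elim: eventually_mono)
    then have "emeasure (lborel :: (real^'n) measure) UNIV = 0"
      by (subst (asm) AE_iff_measurable[where N = UNIV]) auto
    then show False by simp
  qed
  then obtain x0 :: "real^'n" where x0: "x0 \<noteq> 0" and ray: "AE l in (lborel :: real measure). l > 0 \<longrightarrow> l *\<^sub>R x0 \<notin> N" by blast
  have "AE r in lborel. 0 + (1 / norm x0) * r > 0 \<longrightarrow> (0 + (1 / norm x0) * r) *\<^sub>R x0 \<notin> N"
    using x0 ray by (intro AE_borel_affine[where P = "\<lambda>l. l > 0 \<longrightarrow> l *\<^sub>R x0 \<notin> N"]) auto
  then have "AE x in (lborel :: (real^'n) measure). 0 + (1 / norm x0) * norm x > 0 \<longrightarrow> (0 + (1 / norm x0) * norm x) *\<^sub>R x0 \<notin> N"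
    by (intro AE_norm_pullback[where P = "\<lambda>r. 0 + (1 / norm x0) * r > 0 \<longrightarrow> (0 + (1 / norm x0) * r) *\<^sub>R x0 \<notin> N"]) measurable
  then have "AE x in lborel. f x = f ((norm x / norm x0) *\<^sub>R x0)"
    using AE_lborel_singleton[of "0::real^'n"] notN
  proof eventually_elim
    case (elim x)
    then have "(norm x / norm x0) *\<^sub>R x0 \<notin> N" using x0 by auto
    then show ?case using fg[of x] fg[of "(norm x / norm x0) *\<^sub>R x0"] elim x0 by simp
  qed
  then have "ae_eq f (\<lambda>x. f ((norm x / norm x0) *\<^sub>R x0))" by (simp add: ae_eq_def)
  moreover have "radial_fun (\<lambda>x. f ((norm x / norm x0) *\<^sub>R x0))" by (simp add: radial_fun_def)
  moreover have "(\<lambda>x. f ((norm x / norm x0) *\<^sub>R x0)) \<in> borel_measurable borel" by measurable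
  ultimately show thesis using that by blast
qed

section \<open>Elementary facts on \<open>L\<^sup>q\<close>\<close>

text \<open>
  A form of Young's inequality with constant 1: compare \<open>b\<close> with \<open>a powr (1 / (q - 1))\<close>.
\<close>
lemma young_powr:
  assumes "q > 1" "a \<ge> 0" "b \<ge> (0::real)"
  shows "a * b \<le> a powr (q / (q - 1)) + b powr q"
proof (cases "a = 0 \<or> b = 0")
  case False
  then have ab: "a > 0" "b > 0" using assms by auto
  show ?thesis
  proof (cases "b \<le> a powr (1 / (q - 1))")
    case True
    have "a * b \<le> a * a powr (1 / (q - 1))" using True ab by (intro mult_left_mono) auto
    also have "\<dots> = a powr (1 + 1 / (q - 1))" using ab by (simp add: powr_add)
    also have "1 + 1 / (q - 1) = q / (q - 1)" using assms by (simp add: field_simps)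
    finally show ?thesis by (simp add: add_increasing2)
  next
    case False
    then have "(a powr (1 / (q - 1))) powr (q - 1) \<le> b powr (q - 1)"
      using assms ab by (intro powr_mono2) auto
    then have "a \<le> b powr (q - 1)" using assms ab by (simp add: powr_powr)
    then have "a * b \<le> b powr (q - 1) * b" using ab by (intro mult_right_mono) auto
    also have "\<dots> = b powr q" using ab powr_add[of b "q - 1" 1] by simp
    finally show ?thesis by (simp add: add_increasing)
  qed
qed (use assms in auto)

lemma LqD: "f \<in> Lq q \<Longrightarrow> f \<in> borel_measurable borel" "f \<in> Lq q \<Longrightarrow> integrable lborel (\<lambda>x. norm (f x) powr q)"
  by (auto simp: Lq_def)

lemma Lq_norm_nonneg: "0 \<le> Lq_norm q f" by (simp add: Lq_norm_def)

lemma Lq_norm_powr: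
  assumes "q > 0"
  shows "Lq_norm q f powr q = (LINT x|lborel. norm (f x) powr q)"
proof -
  have "0 \<le> (LINT x|lborel. norm (f x) powr q)" by (intro Bochner_Integration.integral_nonneg) simp
  then show ?thesis using assms by (simp add: Lq_norm_def powr_powr)
qed

text \<open>
  Hoelder's inequality with an unspecified constant, from Young's inequality applied to \<open>f\<close> divided by its norm.
\<close>
lemma hoelder:
  fixes a :: "real^'n \<Rightarrow> real"
  assumes q: "q > 1" and [measurable]: "a \<in> borel_measurable borel" and a: "\<And>y. 0 \<le> a y"
    and int: "integrable lborel (\<lambda>y. a y powr (q / (q - 1)))"
  obtains C where "C > 0" "\<And>f. f \<in> Lq q \<Longrightarrow> integrable lborel (\<lambda>y. a y * norm (f y))"
    "\<And>f. f \<in> Lq q \<Longrightarrow> (LINT y|lborel. a y * norm (f y)) \<le> C * Lq_norm q f"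
proof -
  define A where "A = (LINT y|lborel. a y powr (q / (q - 1)))"
  have A: "A \<ge> 0" unfolding A_def by (intro Bochner_Integration.integral_nonneg) simp
  have *: "integrable lborel (\<lambda>y. a y * norm (f y)) \<and> (LINT y|lborel. a y * norm (f y)) \<le> (A + 1) * Lq_norm q f" if f: "f \<in> Lq q" for f
  proof -
    note [measurable] = LqD(1)[OF f]
    note fi = LqD(2)[OF f]
    define M where "M = Lq_norm q f"
    have Mq: "M powr q = (LINT x|lborel. norm (f x) powr q)" using q by (simp add: M_def Lq_norm_powr)
    have bi: "integrable lborel (\<lambda>y. a y powr (q / (q - 1)) + norm (f y) powr q)" using int fi by simp
    have ii: "integrable lborel (\<lambda>y. a y * norm (f y))"
      by (rule Bochner_Integration.integrable_bound[OF bi]) (use a young_powr[OF q] in \<open>auto intro!: AE_I2\<close>)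
    show ?thesis
    proof (cases "M = 0")
      case True
      then have "(LINT x|lborel. norm (f x) powr q) = 0" using Mq by simp
      then have "AE x in lborel. norm (f x) powr q = 0"
        by (subst (asm) integral_nonneg_eq_0_iff_AE[OF fi]) auto
      then have "AE x in lborel. a x * norm (f x) = 0" by eventually_elim simp
      then have "(LINT y|lborel. a y * norm (f y)) = 0"
        by (subst integral_nonneg_eq_0_iff_AE[OF ii]) (use a in auto)
      then show ?thesis using ii True by (simp add: M_def)
    next
      case False
      then have M: "M > 0" using Lq_norm_nonneg[of q f] by (simp add: M_def)
      have "a y * norm (f y) \<le> M * (a y powr (q / (q - 1)) + norm (f y) powr q / M powr q)" for y
      proof -
        have "a y * (norm (f y) / M) \<le> a y powr (q / (q - 1)) + (norm (f y) / M) powr q"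
          using a M by (intro young_powr q) auto
        then have "M * (a y * (norm (f y) / M)) \<le> M * (a y powr (q / (q - 1)) + (norm (f y) / M) powr q)"
          using M by (intro mult_left_mono) auto
        then show ?thesis using M by (simp add: powr_divide)
      qed
      then have "(LINT y|lborel. a y * norm (f y)) \<le> (LINT y|lborel. M * (a y powr (q / (q - 1)) + norm (f y) powr q / M powr q))"
        using int fi by (intro integral_mono ii) auto
      also have "\<dots> = M * (A + (LINT y|lborel. norm (f y) powr q) / M powr q)"
        using int fi by (simp add: A_def)
      also have "\<dots> = (A + 1) * M" unfolding Mq[symmetric] using M by simp
      finally show ?thesis using ii by (simp add: M_def)
    qed
  qed
  show thesis by (rule that[of "A + 1"]) (use A * in auto)
qed

text \<open>
  The constant 4 is immaterial and comes from estimating sums by twice the maximum.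
\<close>
lemma Lq_diff:
  assumes q: "q > 1" and f: "f \<in> Lq q" and g: "g \<in> Lq q"
  shows "(\<lambda>x. f x - g x) \<in> Lq q" "Lq_norm q (\<lambda>x. f x - g x) \<le> 4 * (Lq_norm q f + Lq_norm q g)"
proof -
  note [measurable] = LqD(1)[OF f] LqD(1)[OF g]
  have le: "norm (f x - g x) powr q \<le> 2 powr q * (norm (f x) powr q + norm (g x) powr q)" for x
  proof -
    let ?m = "max (norm (f x)) (norm (g x))"
    have "norm (f x - g x) \<le> 2 * ?m" using norm_triangle_ineq4[of "f x" "g x"] by linarith
    then have "norm (f x - g x) powr q \<le> (2 * ?m) powr q" using q by (intro powr_mono2) auto
    also have "\<dots> = 2 powr q * ?m powr q" by (rule powr_mult)
    also have "\<dots> \<le> 2 powr q * (norm (f x) powr q + norm (g x) powr q)"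
      by (intro mult_left_mono) (auto simp: max_def)
    finally show ?thesis .
  qed
  have bi: "integrable lborel (\<lambda>x. 2 powr q * (norm (f x) powr q + norm (g x) powr q))"
    using LqD(2)[OF f] LqD(2)[OF g] by simp
  have ii: "integrable lborel (\<lambda>x. norm (f x - g x) powr q)"
    by (rule Bochner_Integration.integrable_bound[OF bi]) (use le in \<open>auto intro!: AE_I2 order_trans[OF _ abs_ge_self]\<close>)
  then show "(\<lambda>x. f x - g x) \<in> Lq q" by (simp add: Lq_def)
  let ?m = "Lq_norm q f + Lq_norm q g"
  have m: "0 \<le> ?m" using Lq_norm_nonneg[of q f] Lq_norm_nonneg[of q g] by simp
  have "(LINT x|lborel. norm (f x - g x) powr q) \<le> (LINT x|lborel. 2 powr q * (norm (f x) powr q + norm (g x) powr q))"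
    using ii bi le by (rule integral_mono)
  also have "\<dots> = 2 powr q * (Lq_norm q f powr q + Lq_norm q g powr q)"
    using LqD(2)[OF f] LqD(2)[OF g] q by (simp add: Lq_norm_powr)
  also have "\<dots> \<le> 2 powr q * (?m powr q + ?m powr q)"
    using q Lq_norm_nonneg[of q f] Lq_norm_nonneg[of q g] by (intro mult_left_mono add_mono powr_mono2) auto
  also have "\<dots> \<le> 2 powr q * (2 powr q * ?m powr q)"
  proof -
    have "(2::real) powr 1 \<le> 2 powr q" using q by (intro powr_mono) auto
    then have "2 * ?m powr q \<le> 2 powr q * ?m powr q" by (intro mult_right_mono) auto
    then show ?thesis by (intro mult_left_mono) auto
  qed
  also have "\<dots> = (2 * (2 * ?m)) powr q" by (simp only: powr_mult)
  also have "2 * (2 * ?m) = 4 * ?m" by simp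
  finally have "(LINT x|lborel. norm (f x - g x) powr q) powr (1 / q) \<le> ((4 * ?m) powr q) powr (1 / q)"
    using q by (intro powr_mono2 Bochner_Integration.integral_nonneg) auto
  then show "Lq_norm q (\<lambda>x. f x - g x) \<le> 4 * ?m"
    using q m by (simp add: Lq_norm_def powr_powr)
qed

lemma Lq_minus: "f \<in> Lq q \<Longrightarrow> (\<lambda>x. - f x) \<in> Lq q"
  by (auto simp: Lq_def)

lemma radial_fun_imp_radial:
  fixes f :: "real^'n \<Rightarrow> complex"
  assumes "radial_fun f" "f \<in> borel_measurable borel"
  shows "radial f"
proof -
  obtain g where "\<And>x. f x = g (norm x)" using radial_fun_profile[OF assms] by blast
  then show ?thesis unfolding radial_def ae_eq_def by auto
qed

lemma radial_diff: "radial f \<Longrightarrow> radial g \<Longrightarrow> radial (\<lambda>x. f x - g x)"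
  and radial_add: "radial f \<Longrightarrow> radial g \<Longrightarrow> radial (\<lambda>x. f x + g x)"
proof -
  assume "radial f" "radial g"
  then obtain a b where a: "AE x in lborel. f x = a (norm x)" and b: "AE x in lborel. g x = b (norm x)"
    by (auto simp: radial_def ae_eq_def)
  from a b have "AE x in lborel. f x - g x = a (norm x) - b (norm x)" by eventually_elim simp
  then show "radial (\<lambda>x. f x - g x)" unfolding radial_def ae_eq_def by (intro exI[of _ "\<lambda>r. a r - b r"])
  from a b have "AE x in lborel. f x + g x = a (norm x) + b (norm x)" by eventually_elim simp
  then show "radial (\<lambda>x. f x + g x)" unfolding radial_def ae_eq_def by (intro exI[of _ "\<lambda>r. a r + b r"])
qed

context critical_dimension
begin

lemma decay_bounded_Lq:
  assumes [measurable]: "g \<in> borel_measurable borel" and K: "K \<ge> 0" "\<And>x. norm (g x) \<le> K * decay x"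
  shows "g \<in> Lq q" "Lq_norm q g \<le> K * (LINT x|lborel. decay x powr q) powr (1 / q)"
proof -
  have q: "q > 0" using q_gt_1 by simp
  have le: "norm (g x) powr q \<le> K powr q * decay x powr q" for x
    using powr_mono2[OF less_imp_le[OF q] norm_ge_zero K(2)[of x]] by (simp add: powr_mult)
  have bi: "integrable lborel (\<lambda>x. K powr q * decay x powr q)" using decay_powr_integrable by simp
  have ii: "integrable lborel (\<lambda>x. norm (g x) powr q)"
    by (rule Bochner_Integration.integrable_bound[OF bi]) (use le in \<open>auto intro!: AE_I2 order_trans[OF _ abs_ge_self]\<close>)
  then show "g \<in> Lq q" by (simp add: Lq_def)
  have "(LINT x|lborel. norm (g x) powr q) \<le> (LINT x|lborel. K powr q * decay x powr q)"
    using ii bi le by (rule integral_mono)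
  then have "(LINT x|lborel. norm (g x) powr q) powr (1 / q) \<le> (K powr q * (LINT x|lborel. decay x powr q)) powr (1 / q)"
    using q by (intro powr_mono2 Bochner_Integration.integral_nonneg) auto
  also have "\<dots> = K * (LINT x|lborel. decay x powr q) powr (1 / q)"
    using q K(1) by (simp add: powr_mult powr_powr)
  finally show "Lq_norm q g \<le> K * (LINT x|lborel. decay x powr q) powr (1 / q)" by (simp add: Lq_norm_def)
qed

lemma RV_cong_AE:
  fixes f g :: "real^'n \<Rightarrow> complex"
  assumes "ae_eq f g" and [measurable]: "f \<in> borel_measurable borel" "g \<in> borel_measurable borel"
  shows "RV s f = RV s g"
proof
  fix x
  show "RV s f x = RV s g x"
    unfolding RV_def resolvent_def
    by (rule integral_cong_AE) (use assms(1) in \<open>auto simp: ae_eq_def elim!: eventually_mono\<close>)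
qed

text \<open>
  Every element of \<open>L\<^sup>q\<^sub>r\<^sub>a\<^sub>d\<close> has a representative to which Newton's theorem applies.
\<close>
lemma Lq_rad_representative:
  obtains C where "C > 0" "\<And>f. f \<in> Lq_rad q \<Longrightarrow> \<exists>f'\<in>admissible. ae_eq f f' \<and>
    (LINT y|lborel. Vwt y * norm (f' y)) \<le> C * Lq_norm q f \<and>
    integrable lborel (\<lambda>y. \<bar>V y\<bar> * norm (f' y)) \<and> (LINT y|lborel. \<bar>V y\<bar> * norm (f' y)) \<le> C * Lq_norm q f"
proof -
  obtain C1 where C1: "C1 > 0" "\<And>f. f \<in> Lq q \<Longrightarrow> integrable lborel (\<lambda>y. Vwt y * norm (f y))"
    "\<And>f. f \<in> Lq q \<Longrightarrow> (LINT y|lborel. Vwt y * norm (f y)) \<le> C1 * Lq_norm q f"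
    using hoelder[OF q_gt_1 Vwt_measurable Vwt_nonneg Vwt_powr_integrable] by blast
  have "(\<lambda>y::real^'n. \<bar>V y\<bar>) \<in> borel_measurable borel" by measurable
  then obtain C2 where C2: "C2 > 0" "\<And>f::real^'n \<Rightarrow> complex. f \<in> Lq q \<Longrightarrow> integrable lborel (\<lambda>y. \<bar>V y\<bar> * norm (f y))"
    "\<And>f::real^'n \<Rightarrow> complex. f \<in> Lq q \<Longrightarrow> (LINT y|lborel. \<bar>V y\<bar> * norm (f y)) \<le> C2 * Lq_norm q f"
    using hoelder[OF q_gt_1 _ abs_ge_zero V_powr_integrable] by blast
  show thesis
  proof (rule that[of "max C1 C2"])
    fix f :: "real^'n \<Rightarrow> complex" assume "f \<in> Lq_rad q"
    then have f: "f \<in> Lq q" "radial f" by (auto simp: Lq_rad_def)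
    note [measurable] = LqD(1)[OF f(1)]
    obtain f' where f': "f' \<in> borel_measurable borel" "radial_fun f'" "ae_eq f f'"
      using radial_borel_representative[OF LqD(1)[OF f(1)] f(2)] by blast
    note [measurable] = f'(1)
    have ae: "AE x in lborel. norm (f x) powr q = norm (f' x) powr q"
      using f'(3) by (auto simp: ae_eq_def elim!: eventually_mono)
    have "f' \<in> Lq q"
      using integrable_cong_AE_imp[OF LqD(2)[OF f(1)] _ ae] by (simp add: Lq_def)
    moreover have "Lq_norm q f' = Lq_norm q f"
      unfolding Lq_norm_def by (rule arg_cong[where f = "\<lambda>t. t powr (1 / q)"], rule integral_cong_AE) (use ae in \<open>auto elim: eventually_mono\<close>)
    ultimately have "integrable lborel (\<lambda>y. Vwt y * norm (f' y))" "(LINT y|lborel. Vwt y * norm (f' y)) \<le> C1 * Lq_norm q f"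
      "integrable lborel (\<lambda>y. \<bar>V y\<bar> * norm (f' y))" "(LINT y|lborel. \<bar>V y\<bar> * norm (f' y)) \<le> C2 * Lq_norm q f"
      using C1(2,3)[of f'] C2(2,3)[of f'] by auto
    moreover have "C1 * Lq_norm q f \<le> max C1 C2 * Lq_norm q f" "C2 * Lq_norm q f \<le> max C1 C2 * Lq_norm q f"
      by (intro mult_right_mono Lq_norm_nonneg; simp)+
    ultimately show "\<exists>f'\<in>admissible. ae_eq f f' \<and>
      (LINT y|lborel. Vwt y * norm (f' y)) \<le> max C1 C2 * Lq_norm q f \<and>
      integrable lborel (\<lambda>y. \<bar>V y\<bar> * norm (f' y)) \<and> (LINT y|lborel. \<bar>V y\<bar> * norm (f' y)) \<le> max C1 C2 * Lq_norm q f"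
      using f' by (intro bexI[of _ f']) (auto simp: admissible_def)
  qed (use C1 in auto)
qed

lemma zpair_bound:
  obtains C where "C > 0" "\<And>f. f \<in> admissible \<Longrightarrow> norm (zpair f) \<le> C * (LINT y|lborel. Vwt y * norm (f y))"
proof -
  obtain C where C: "C > 0" "\<And>y. y \<noteq> 0 \<Longrightarrow> \<bar>VZ y\<bar> \<le> C * Vwt y" using VZ_le_Vwt by blast
  show thesis
  proof (rule that[OF C(1)])
    fix f assume f: "f \<in> admissible"
    have "norm (zpair f) \<le> (LINT y|lborel. norm (complex_of_real (VZ y) * f y))"
      unfolding zpair_def by (rule integral_norm_bound)
    also have "\<dots> \<le> (LINT y|lborel. C * (Vwt y * norm (f y)))"
    proof (rule integral_mono_AE)
      show "integrable lborel (\<lambda>y. norm (complex_of_real (VZ y) * f y))" using VZ_mult_integrable[OF f] by simp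
      show "integrable lborel (\<lambda>y. C * (Vwt y * norm (f y)))" using admissibleD(3)[OF f] by simp
      show "AE y in lborel. norm (complex_of_real (VZ y) * f y) \<le> C * (Vwt y * norm (f y))"
      proof (rule eventually_mono[OF AE_lborel_singleton[of 0]])
        fix y :: "real^'n" assume "y \<noteq> 0"
        then have "\<bar>VZ y\<bar> * norm (f y) \<le> C * Vwt y * norm (f y)" by (intro mult_right_mono C) auto
        then show "norm (complex_of_real (VZ y) * f y) \<le> C * (Vwt y * norm (f y))" by (simp add: norm_mult mult.assoc)
      qed
    qed
    finally show "norm (zpair f) \<le> C * (LINT y|lborel. Vwt y * norm (f y))" by simp
  qed
qed

text \<open>
  The two memberships make the real and the imaginary part of the complex pairing vanish.
\<close>
lemma zpair_eq_0_of_X: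
  assumes f: "f \<in> X q" "(\<lambda>x. \<i> * f x) \<in> X q" and f': "f' \<in> admissible" "ae_eq f f'"
  shows "zpair f' = 0"
proof -
  have fL: "f \<in> Lq q" using f(1) by (simp add: X_def Lq_rad_def)
  note [measurable] = LqD(1)[OF fL] admissibleD(1)[OF f'(1)]
  have "zpair f' = (LINT y|lborel. f y * cnj (complex_of_real (V y * LambdaW y)))"
    unfolding zpair_def VZ_def by (rule integral_cong_AE) (use f'(2) in \<open>auto simp: ae_eq_def mult_ac elim!: eventually_mono\<close>)
  moreover have "Re (LINT y|lborel. f y * cnj (complex_of_real (V y * LambdaW y))) = 0"
    using f(1) by (simp add: X_def pairing_def)
  moreover have "Im (LINT y|lborel. f y * cnj (complex_of_real (V y * LambdaW y))) = 0"
  proof -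
    have "(LINT y|lborel. \<i> * f y * cnj (complex_of_real (V y * LambdaW y))) = \<i> * (LINT y|lborel. f y * cnj (complex_of_real (V y * LambdaW y)))"
      by (subst integral_mult_right_zero[symmetric]) (simp add: mult.assoc)
    then show ?thesis using f(2) by (simp add: X_def pairing_def)
  qed
  ultimately show ?thesis by (simp add: complex_eq_iff)
qed

text \<open>
  On \<open>L\<^sup>q\<close> the inverse is \<open>f \<mapsto> f - v\<close>, where \<open>v\<close> is the bounded solution with right-hand side
  \<open>RV s f\<close>; the smoothing by the potential makes both inhomogeneity and solution bounded and decaying.
\<close>
lemma resolvent_estimate:
  obtains s0 C where "s0 > 0" "C > 0"
    "\<And>s. 0 < s \<Longrightarrow> s < s0 \<Longrightarrow> \<exists>S. inverse_on_Lq_rad q (one_plus_RV s) S \<and>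
      (\<forall>f \<in> Lq_rad q. Lq_norm q (S f) \<le> C / gap_rate CARD('n) s * Lq_norm q f) \<and>
      (\<forall>f \<in> X q. (\<lambda>x. \<i> * f x) \<in> X q \<longrightarrow> Lq_norm q (S (f :: real^'n \<Rightarrow> complex)) \<le> C * Lq_norm q f)"
proof -
  obtain C where C: "C > 0" and ev: "\<forall>\<^sub>F s in at_right 0. 0 < s \<and> small_gap s \<and> gap_rate CARD('n) s \<le> 1 \<and>
      (\<forall>v \<in> bounded_radial. \<forall>H. (\<forall>x. norm (v x + RV s v x) \<le> H * decay x) \<longrightarrow>
        (\<forall>x. norm (v x) \<le> C * (H + norm (zpair (\<lambda>x. v x + RV s v x)) / gap_rate CARD('n) s)))"
    using bounded_a_priori by blast
  obtain CD where CD: "CD > 0" "\<And>s x. 0 < s \<Longrightarrow> s < 1 \<Longrightarrow> \<bar>defect s x\<bar> \<le> CD * gap_rate CARD('n) s" using defect_le_rate by blast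
  obtain CH where CH: "CH > 0" "\<And>f. f \<in> Lq_rad q \<Longrightarrow> \<exists>f'\<in>admissible. ae_eq f f' \<and>
    (LINT y|lborel. Vwt y * norm (f' y)) \<le> CH * Lq_norm q f \<and>
    integrable lborel (\<lambda>y. \<bar>V y\<bar> * norm (f' y)) \<and> (LINT y|lborel. \<bar>V y\<bar> * norm (f' y)) \<le> CH * Lq_norm q f"
    using Lq_rad_representative by blast
  obtain CZ where CZ: "CZ > 0" "\<And>f. f \<in> admissible \<Longrightarrow> norm (zpair f) \<le> CZ * (LINT y|lborel. Vwt y * norm (f y))"
    using zpair_bound by blast
  obtain b where b: "b > 0" "\<And>s. 0 < s \<Longrightarrow> s < b \<Longrightarrow> 0 < s \<and> small_gap s \<and> gap_rate CARD('n) s \<le> 1 \<and>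
      (\<forall>v \<in> bounded_radial. \<forall>H. (\<forall>x. norm (v x + RV s v x) \<le> H * decay x) \<longrightarrow>
        (\<forall>x. norm (v x) \<le> C * (H + norm (zpair (\<lambda>x. v x + RV s v x)) / gap_rate CARD('n) s)))"
    using ev unfolding eventually_at_right[of 0 1, OF zero_less_one] by blast
  define A where "A = (LINT y|lborel. Vwt y)"
  have A: "A \<ge> 0" unfolding A_def by (intro Bochner_Integration.integral_nonneg) auto
  define D where "D = (LINT x|lborel. decay x powr q) powr (1 / q)"
  have D: "D \<ge> 0" by (simp add: D_def)
  define K0 where "K0 = 4 * (1 + (CH + A * (C * (CH + CD * CH))) * D)"
  define K1 where "K1 = 4 * A * C * D"
  have K0: "K0 > 0" using CH CD A C D by (simp add: K0_def add_pos_nonneg)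
  have K1: "K1 \<ge> 0" using A C D by (simp add: K1_def)
  define K where "K = K0 + K1 * (CZ * CH)"
  have K: "K > 0" using K0 K1 CZ CH by (simp add: K_def add_pos_nonneg)
  show thesis
  proof (rule that[of "min b 1" K])
    show "min b 1 > 0" using b by simp
    show "K > 0" by fact
    fix s :: real assume "0 < s" "s < min b 1"
    then have s: "0 < s" "s < 1" "s < b" "0 \<le> s" by auto
    let ?r = "gap_rate CARD('n) s"
    have r: "0 < ?r" "?r \<le> 1" using gap_rate_pos[OF s(1)] dim34 b(2)[OF s(1,3)] by auto
    have sg: "small_gap s" using b(2)[OF s(1,3)] by blast
    have ap: "norm (v x) \<le> C * (H + norm (zpair (\<lambda>x. v x + RV s v x)) / ?r)"
      if "v \<in> bounded_radial" "\<And>x. norm (v x + RV s v x) \<le> H * decay x" for v H x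
      using b(2)[OF s(1,3)] that by blast
    have inj: "v x = 0" if v: "v \<in> bounded_radial" "\<And>x. v x + RV s v x = 0" for v x
      using ap[OF v(1), of 0 x] v(2) by (simp add: zpair_def)
    define sol where "sol h = (SOME v. v \<in> bounded_radial \<and> (\<forall>x. v x + RV s v x = h x))" for h
    have sol: "sol h \<in> bounded_radial \<and> (\<forall>x. sol h x + RV s (sol h) x = h x)" if "h \<in> bounded_radial" for h
    proof -
      have "\<exists>v. v \<in> bounded_radial \<and> (\<forall>x. v x + RV s v x = h x)"
      proof (rule bounded_solvable[OF sg s(4) _ that])
        show "v x = 0" if "v \<in> bounded_radial" "\<And>x. v x + RV s v x = 0" for v x by (rule inj[OF that])
      qed blast
      then show ?thesis unfolding sol_def by (rule someI_ex)
    qed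
    define S where "S f = (\<lambda>x. f x - sol (RV s f) x)" for f
    have unique: "v = w" if "v \<in> bounded_radial" "w \<in> bounded_radial" "\<And>x. v x + RV s v x = w x + RV s w x" for v w
    proof
      fix x
      have "(v y - w y) + RV s (\<lambda>y. v y - w y) y = 0" for y
        using that(3)[of y] by (simp add: RV_diff[OF bounded_radial_admissible[OF that(1)] bounded_radial_admissible[OF that(2)] s(4)] algebra_simps)
      from inj[OF bounded_radial_diff[OF that(1,2)] this, of x] show "v x = w x" by simp
    qed
    have RVf: "\<exists>f'\<in>admissible. ae_eq f f' \<and> RV s f = RV s f' \<and>
      (LINT y|lborel. Vwt y * norm (f' y)) \<le> CH * Lq_norm q f \<and>
      integrable lborel (\<lambda>y. \<bar>V y\<bar> * norm (f' y)) \<and> (LINT y|lborel. \<bar>V y\<bar> * norm (f' y)) \<le> CH * Lq_norm q f"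
      if f: "f \<in> Lq_rad q" for f :: "real^'n \<Rightarrow> complex"
    proof -
      obtain f' where f': "f' \<in> admissible" "ae_eq f f'" "(LINT y|lborel. Vwt y * norm (f' y)) \<le> CH * Lq_norm q f"
        "integrable lborel (\<lambda>y. \<bar>V y\<bar> * norm (f' y))" "(LINT y|lborel. \<bar>V y\<bar> * norm (f' y)) \<le> CH * Lq_norm q f"
        using CH(2)[OF f] by blast
      have "f \<in> Lq q" using f by (simp add: Lq_rad_def)
      then have "RV s f = RV s f'" by (intro RV_cong_AE f' admissibleD(1) LqD(1))
      then show ?thesis using f' by blast
    qed
    have RV_br: "RV s f \<in> bounded_radial" if "f \<in> Lq_rad q" for f
      using RVf[OF that] RV_bounded_radial[OF _ s(4)] by metis
    have RV_decay: "norm (RV s f x) \<le> CH * Lq_norm q f * decay x" if f: "f \<in> Lq_rad q" for f :: "real^'n \<Rightarrow> complex" and x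
    proof -
      obtain f' where f': "f' \<in> admissible" "RV s f = RV s f'" "(LINT y|lborel. Vwt y * norm (f' y)) \<le> CH * Lq_norm q f"
        using RVf[OF f] by blast
      have "norm (RV s f x) \<le> decay x * (LINT y|lborel. Vwt y * norm (f' y))"
        unfolding f'(2) by (rule RV_integrable_and_bound(2)[OF f'(1) s(4)])
      also have "\<dots> \<le> decay x * (CH * Lq_norm q f)" by (intro mult_left_mono f') (simp add: less_imp_le)
      finally show ?thesis by (simp add: mult_ac)
    qed
    have RV_Lq: "RV s f \<in> Lq_rad q" if f: "f \<in> Lq_rad q" for f :: "real^'n \<Rightarrow> complex"
      unfolding Lq_rad_def
      using decay_bounded_Lq(1)[OF bounded_radialD(1)[OF RV_br[OF f]] _ RV_decay[OF f]] CH(1) Lq_norm_nonneg[of q f]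
        radial_fun_imp_radial[OF bounded_radialD(2)[OF RV_br[OF f]] bounded_radialD(1)[OF RV_br[OF f]]] by simp
    have T_Lq: "one_plus_RV s f \<in> Lq_rad q" if f: "f \<in> Lq_rad q" for f :: "real^'n \<Rightarrow> complex"
    proof -
      have "(\<lambda>x. f x - (- RV s f x)) \<in> Lq q"
        using f RV_Lq[OF f] by (intro Lq_diff(1) q_gt_1 Lq_minus) (auto simp: Lq_rad_def)
      moreover have "radial (\<lambda>x. f x + RV s f x)" using f RV_Lq[OF f] by (intro radial_add) (auto simp: Lq_rad_def)
      ultimately show ?thesis unfolding Lq_rad_def one_plus_RV_eq[abs_def] by simp
    qed
    (* Both estimates follow from this one, in which only the pairing with V \<Lambda>W is divided by the rate. *)
    have main: "sol (RV s f) \<in> Lq q \<and> radial (sol (RV s f)) \<and> (\<exists>f'\<in>admissible. ae_eq f f' \<and> norm (zpair f') \<le> CZ * (CH * Lq_norm q f) \<and>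
        Lq_norm q (S f) \<le> K0 * Lq_norm q f + K1 * (norm (zpair f') / ?r))" if f: "f \<in> Lq_rad q" for f :: "real^'n \<Rightarrow> complex"
    proof -
      define v where "v = sol (RV s f)"
      define F where "F = Lq_norm q f"
      have F: "F \<ge> 0" by (simp add: F_def Lq_norm_nonneg)
      have v: "v \<in> bounded_radial" "\<And>x. v x + RV s v x = RV s f x" using sol[OF RV_br[OF f]] by (auto simp: v_def)
      obtain f' where f': "f' \<in> admissible" "ae_eq f f'" "RV s f = RV s f'" "(LINT y|lborel. Vwt y * norm (f' y)) \<le> CH * F"
        "integrable lborel (\<lambda>y. \<bar>V y\<bar> * norm (f' y))" "(LINT y|lborel. \<bar>V y\<bar> * norm (f' y)) \<le> CH * F"
        using RVf[OF f] unfolding F_def by blast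
      define P where "P = norm (zpair f') / ?r"
      have P: "P \<ge> 0" using r by (simp add: P_def)
      (* By duality the pairing of the right-hand side RV s f' is that of - f' up to the order of the rate. *)
      have dz: "norm (zpair (RV s f')) \<le> norm (zpair f') + CD * ?r * (CH * F)"
      proof -
        have "zpair (RV s f') = (LINT y|lborel. complex_of_real (V y) * f' y * complex_of_real (defect s y)) - zpair f'"
          using zpair_one_plus_RV(2)[OF f'(1) s(4)] by (simp add: algebra_simps)
        also have "norm \<dots> \<le> norm (LINT y|lborel. complex_of_real (V y) * f' y * complex_of_real (defect s y)) + norm (zpair f')"
          by (rule norm_triangle_ineq4)
        also have "norm (LINT y|lborel. complex_of_real (V y) * f' y * complex_of_real (defect s y)) \<le> (LINT y|lborel. norm (complex_of_real (V y) * f' y * complex_of_real (defect s y)))"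
          by (rule integral_norm_bound)
        also have "\<dots> \<le> (LINT y|lborel. CD * ?r * (\<bar>V y\<bar> * norm (f' y)))"
        proof (rule integral_mono)
          show "integrable lborel (\<lambda>y. norm (complex_of_real (V y) * f' y * complex_of_real (defect s y)))"
            using zpair_one_plus_RV(1)[OF f'(1) s(4)] by simp
          show "integrable lborel (\<lambda>y. CD * ?r * (\<bar>V y\<bar> * norm (f' y)))" using f'(5) by simp
          fix y
          have "\<bar>V y\<bar> * norm (f' y) * \<bar>defect s y\<bar> \<le> \<bar>V y\<bar> * norm (f' y) * (CD * ?r)"
            by (intro mult_left_mono CD s) auto
          then show "norm (complex_of_real (V y) * f' y * complex_of_real (defect s y)) \<le> CD * ?r * (\<bar>V y\<bar> * norm (f' y))"
            by (simp add: norm_mult mult_ac)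
        qed
        also have "\<dots> = CD * ?r * (LINT y|lborel. \<bar>V y\<bar> * norm (f' y))" by simp
        also have "\<dots> \<le> CD * ?r * (CH * F)" using CD(1) r by (intro mult_left_mono f') auto
        finally show ?thesis by simp
      qed
      have v_le: "norm (v x) \<le> C * ((CH + CD * CH) * F + P)" for x
      proof -
        have "norm (v x) \<le> C * (CH * F + norm (zpair (\<lambda>x. v x + RV s v x)) / ?r)"
          by (rule ap[OF v(1)]) (use v(2) RV_decay[OF f] in \<open>simp add: F_def\<close>)
        also have "(\<lambda>x. v x + RV s v x) = RV s f'" using v(2) f'(3) by auto
        also have "norm (zpair (RV s f')) / ?r \<le> (norm (zpair f') + CD * ?r * (CH * F)) / ?r"
          using dz r by (intro divide_right_mono) auto
        also have "(norm (zpair f') + CD * ?r * (CH * F)) / ?r = P + CD * (CH * F)"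
          using r by (simp add: P_def add_divide_distrib)
        finally show ?thesis using C by (simp add: algebra_simps)
      qed
      have v_decay: "norm (v x) \<le> (CH * F + A * (C * ((CH + CD * CH) * F + P))) * decay x" for x
      proof -
        have "v x = RV s f x - RV s v x" using v(2)[of x] by (simp add: algebra_simps)
        then have "norm (v x) \<le> norm (RV s f x) + norm (RV s v x)" using norm_triangle_ineq4[of "RV s f x" "RV s v x"] by simp
        also have "\<dots> \<le> CH * F * decay x + A * (C * ((CH + CD * CH) * F + P)) * decay x"
          unfolding A_def F_def by (intro add_mono RV_decay f RV_bounded_le v(1) s(4)) (use v_le in \<open>simp add: F_def\<close>)
        finally show ?thesis by (simp add: distrib_right)
      qed
      have nn: "0 \<le> CH * F + A * (C * ((CH + CD * CH) * F + P))"
        using CH(1) CD(1) A C F P by (intro add_nonneg_nonneg mult_nonneg_nonneg) auto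
      note vL = decay_bounded_Lq[OF bounded_radialD(1)[OF v(1)] nn v_decay, folded D_def]
      have "Lq_norm q (S f) \<le> 4 * (F + Lq_norm q v)"
        using Lq_diff(2)[OF q_gt_1 _ vL(1), of f] f by (simp add: S_def[abs_def] v_def F_def Lq_rad_def)
      also have "\<dots> \<le> 4 * (F + (CH * F + A * (C * ((CH + CD * CH) * F + P))) * D)" using vL(2) by simp
      also have "\<dots> = K0 * F + K1 * P" unfolding K0_def K1_def by (simp add: algebra_simps)
      finally have 1: "Lq_norm q (S f) \<le> K0 * F + K1 * P" .
      have "norm (zpair f') \<le> CZ * (LINT y|lborel. Vwt y * norm (f' y))" by (rule CZ(2)[OF f'(1)])
      also have "\<dots> \<le> CZ * (CH * F)" using CZ(1) by (intro mult_left_mono f') auto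
      finally have 2: "norm (zpair f') \<le> CZ * (CH * F)" .
      show ?thesis
        using 1 2 vL(1) f' radial_fun_imp_radial[OF bounded_radialD(2)[OF v(1)] bounded_radialD(1)[OF v(1)]]
        unfolding v_def[symmetric] F_def P_def by blast
    qed
    have S_Lq: "S f \<in> Lq_rad q" if f: "f \<in> Lq_rad q" for f :: "real^'n \<Rightarrow> complex"
      using main[OF f] f Lq_diff(1)[OF q_gt_1] radial_diff unfolding S_def Lq_rad_def by blast
    have RV_eq: "RV s f = RV s g" if "f \<in> Lq_rad q" "g \<in> Lq_rad q" "ae_eq f g" for f g :: "real^'n \<Rightarrow> complex"
      using that by (intro RV_cong_AE) (auto simp: Lq_rad_def Lq_def)
    have TS: "one_plus_RV s (S f) x = f x" if f: "f \<in> Lq_rad q" for f :: "real^'n \<Rightarrow> complex" and x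
    proof -
      define v where "v = sol (RV s f)"
      have v: "v \<in> bounded_radial" "\<And>x. v x + RV s v x = RV s f x" using sol[OF RV_br[OF f]] by (auto simp: v_def)
      obtain f' where f': "f' \<in> admissible" "ae_eq f f'" "RV s f = RV s f'" using RVf[OF f] by blast
      have fm: "f \<in> borel_measurable borel" using f by (simp add: Lq_rad_def Lq_def)
      have "RV s (\<lambda>x. f x - v x) = RV s (\<lambda>x. f' x - v x)"
        using f'(2) fm admissibleD(1)[OF f'(1)] bounded_radialD(1)[OF v(1)]
        by (intro RV_cong_AE) (auto simp: ae_eq_def elim!: eventually_mono)
      then have e: "RV s (\<lambda>x. f x - v x) x = RV s f x - RV s v x"
        by (simp add: RV_diff[OF f'(1) bounded_radial_admissible[OF v(1)] s(4)] f'(3))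
      show ?thesis
        unfolding one_plus_RV_eq S_def v_def[symmetric] e v(2)[of x, symmetric] by simp
    qed
    have ST: "S (one_plus_RV s f) x = f x" if f: "f \<in> Lq_rad q" for f :: "real^'n \<Rightarrow> complex" and x
    proof -
      obtain f' where f': "f' \<in> admissible" "ae_eq f f'" "RV s f = RV s f'" using RVf[OF f] by blast
      note Tf = T_Lq[OF f]
      have fm: "f \<in> borel_measurable borel" using f by (simp add: Lq_rad_def Lq_def)
      note Rm = bounded_radialD(1)[OF RV_br[OF f]]
      have "RV s (one_plus_RV s f) = RV s (\<lambda>x. f' x + RV s f x)"
        unfolding one_plus_RV_eq[abs_def] using f'(2) fm admissibleD(1)[OF f'(1)] Rm
        by (intro RV_cong_AE) (auto simp: ae_eq_def elim!: eventually_mono)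
      then have e: "RV s (one_plus_RV s f) x = RV s f x + RV s (RV s f) x" for x
        by (simp add: RV_add[OF f'(1) bounded_radial_admissible[OF RV_br[OF f]] s(4)] f'(3)[symmetric])
      have "sol (RV s (one_plus_RV s f)) = RV s f"
      proof (rule unique)
        show "sol (RV s (one_plus_RV s f)) x + RV s (sol (RV s (one_plus_RV s f))) x = RV s f x + RV s (RV s f) x" for x
          using sol[OF RV_br[OF Tf]] e by simp
      qed (use sol[OF RV_br[OF Tf]] RV_br[OF f] in auto)
      then show ?thesis by (simp add: S_def one_plus_RV_eq)
    qed
    have "inverse_on_Lq_rad q (one_plus_RV s) S"
      unfolding inverse_on_Lq_rad_def operator_on_Lq_rad_def
    proof (intro conjI ballI impI)
      fix f g :: "real^'n \<Rightarrow> complex" assume fg: "f \<in> Lq_rad q" "g \<in> Lq_rad q" "ae_eq f g"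
      note e = RV_eq[OF fg]
      show "ae_eq (one_plus_RV s f) (one_plus_RV s g)"
        using fg(3) unfolding one_plus_RV_eq[abs_def] e ae_eq_def by (auto elim: eventually_mono)
      show "ae_eq (S f) (S g)"
        using fg(3) unfolding S_def e ae_eq_def by (auto elim: eventually_mono)
    qed (auto simp: T_Lq S_Lq TS ST ae_eq_def)
    moreover have "Lq_norm q (S f) \<le> K / ?r * Lq_norm q f" if f: "f \<in> Lq_rad q" for f :: "real^'n \<Rightarrow> complex"
    proof -
      let ?F = "Lq_norm q f"
      have F: "?F \<ge> 0" by (rule Lq_norm_nonneg)
      obtain f' where f': "norm (zpair f') \<le> CZ * (CH * ?F)" "Lq_norm q (S f) \<le> K0 * ?F + K1 * (norm (zpair f') / ?r)"
        using main[OF f] by blast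
      note f'(2)
      also have "K0 * ?F + K1 * (norm (zpair f') / ?r) \<le> K0 * ?F / ?r + K1 * (CZ * (CH * ?F) / ?r)"
      proof (intro add_mono mult_left_mono divide_right_mono f' K1)
        show "K0 * ?F \<le> K0 * ?F / ?r" using r K0 F mult_left_le[of ?r "K0 * ?F"] by (simp add: field_simps)
      qed (use r in simp)
      also have "\<dots> = K / ?r * ?F" by (simp add: K_def add_divide_distrib algebra_simps)
      finally show ?thesis .
    qed
    moreover have "Lq_norm q (S f) \<le> K * Lq_norm q f" if f: "f \<in> X q" "(\<lambda>x. \<i> * f x) \<in> X q" for f
    proof -
      let ?F = "Lq_norm q f"
      have F: "?F \<ge> 0" by (rule Lq_norm_nonneg)
      have "f \<in> Lq_rad q" using f(1) by (simp add: X_def)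
      then obtain f' where f': "f' \<in> admissible" "ae_eq f f'" "Lq_norm q (S f) \<le> K0 * ?F + K1 * (norm (zpair f') / ?r)"
        using main by blast
      have "zpair f' = 0" by (rule zpair_eq_0_of_X[OF f f'(1,2)])
      then have "Lq_norm q (S f) \<le> K0 * ?F" using f'(3) by simp
      also have "\<dots> \<le> K * ?F" using F K1 CZ(1) CH(1) by (intro mult_right_mono) (simp_all add: K_def)
      finally show ?thesis .
    qed
    ultimately show "\<exists>S. inverse_on_Lq_rad q (one_plus_RV s) S \<and>
      (\<forall>f \<in> Lq_rad q. Lq_norm q (S f) \<le> K / ?r * Lq_norm q f) \<and>
      (\<forall>f \<in> X q. (\<lambda>x. \<i> * f x) \<in> X q \<longrightarrow> Lq_norm q (S (f :: real^'n \<Rightarrow> complex)) \<le> K * Lq_norm q f)"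
      by blast
  qed
qed

end

section \<open>Invertibility and estimates\<close>

theorem proposition3p1:
  fixes q :: real
  assumes "CARD('n::finite) = 3 \<or> CARD('n) = 4"
    and "real CARD('n) / (real CARD('n) - 2) < q"
  shows "\<exists>s0>0. \<exists>C>0. \<forall>s. 0 < s \<and> s < s0 \<longrightarrow>
    (\<exists>S :: (real^'n \<Rightarrow> complex) \<Rightarrow> real^'n \<Rightarrow> complex.
       inverse_on_Lq_rad q (one_plus_RV s) S \<and>
       (\<forall>f \<in> Lq_rad q. Lq_norm q (S f) \<le> C * delta CARD('n) s * (1 / s) * Lq_norm q f) \<and>
       (\<forall>f \<in> X q. (\<lambda>x. \<i> * f x) \<in> X q \<longrightarrow> Lq_norm q (S f) \<le> C * Lq_norm q f))"
proof -
  let ?d = "real CARD('n)"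
  (* The midpoint of the interval of admissible decay rates. *)
  define \<gamma> where "\<gamma> = (?d / q + (?d - 2)) / 2"
  have d: "?d \<ge> 3" using assms(1) by auto
  have "0 < ?d / (?d - 2)" using d by simp
  then have q: "q > 0" using assms(2) by linarith
  have "?d / q < ?d - 2" using assms(2) d q by (simp add: field_simps)
  then have g: "?d / q < \<gamma>" "\<gamma> < ?d - 2" unfolding \<gamma>_def by argo+
  interpret critical_dimension "TYPE('n)" q \<gamma>
    by unfold_locales (use assms g q in \<open>auto simp: field_simps\<close>)
  obtain s0 C where "s0 > 0" "C > 0" and est:
    "\<And>s. 0 < s \<Longrightarrow> s < s0 \<Longrightarrow> \<exists>S. inverse_on_Lq_rad q (one_plus_RV s) S \<and>
      (\<forall>f \<in> Lq_rad q. Lq_norm q (S f) \<le> C / gap_rate CARD('n) s * Lq_norm q f) \<and>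
      (\<forall>f \<in> X q. (\<lambda>x. \<i> * f x) \<in> X q \<longrightarrow> Lq_norm q (S (f :: real^'n \<Rightarrow> complex)) \<le> C * Lq_norm q f)"
    using resolvent_estimate by blast
  have rate: "C / gap_rate CARD('n) s = C * delta CARD('n) s * (1 / s)" for s
    by (simp add: gap_rate_def)
  show ?thesis
    using \<open>s0 > 0\<close> \<open>C > 0\<close> est unfolding rate by blast
qed

end
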